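(* Let $$D=\{(t,x)\in\mathbb{R}^{1+3}:\ (x_1-1)^2H(x_1-1)+x_2^2/4+x_3^2/4<(1-t)^2\},$$ where $H(x_1-1)=1$ when $x_1<1$ and $H(x_1-1)=1/4$ when $x_1>1$, and set $D_t=\{x:(t,x)\in D\}$. There exist a space-time $(D,g)$ and coordinates $x_\alpha:D\to\mathbb{R}$, $\alpha=0,1,2,3$, such that: 1. The metric $g$ satisfies the Einstein vacuum equation $\mathrm{Ric}(g)=0$ on $D$. 2. The coordinates $x_\alpha$ are wave coordinates: $\partial_\alpha\big(\sqrt{|g|}\,g^{\alpha\beta}\big)=0$ on $D$ for $\beta=0,1,2,3$. 3. The metric $g$ has finite initial data in $H^2(D_0)\times H^1(D_0)$: $$\|g_{\alpha\beta}\|_{H^2(D_0)}+\|\partial_tg_{\alpha\beta}\|_{H^1(D_0)}<\infty,\qquad \alpha,\beta\in\{0,1,2,3\}.$$ 4. The $H^2(D_t)$ norm of $g_{00}$ at any other time $t$ is infinite: $$\|g_{00}\|_{H^2(D_t)}=\infty\qquad\text{for all } t\in(-1,1)\setminus\{0\}.$$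
   Context: A space-time $(D,g)$ is the set $D$ with a Lorentzian metric $g$. $g_{\alpha\beta}$ are the components of $g$ in the coordinates $x_\alpha$, $g^{\alpha\beta}$ is the inverse matrix, $|g|=|\det(g_{\alpha\beta})|$, $\mathrm{Ric}(g)$ is the Ricci curvature, and repeated indices are summed over $0,\dots,3$. Norms over $D_t$ are those of the restriction to time $t$, and a norm being infinite means that the function does not belong to the space. The value of $H$ at $x_1=1$ is immaterial because it multiplies $(x_1-1)^2$. *)

theory Defs
  imports "HOL-Analysis.Analysis"
begin

text \<open>
  Points of space-time are vectors in \<^typ>\<open>real^4\<close>, with components \<open>0, 1, 2, 3\<close>, the component
  \<open>0\<close> being the time \<open>t\<close> (in the index type \<^typ>\<open>4\<close>, \<open>0\<close> and \<open>4\<close> are the same index).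
  The coordinates \<open>x\<^sub>\<alpha>\<close> are the coordinate functions \<open>p \<mapsto> p $ \<alpha>\<close>, and a metric is
  given by the matrix of its components \<open>g\<^sub>\<alpha>\<^sub>\<beta>\<close> in them.
\<close>

definition partial :: "'n::finite \<Rightarrow> (real^'n \<Rightarrow> real) \<Rightarrow> real^'n \<Rightarrow> real" where
  "partial i f x = deriv (\<lambda>h. f (x + h *\<^sub>R axis i 1)) 0"

fun Ck_on :: "nat \<Rightarrow> (real^'n) set \<Rightarrow> (real^'n::finite \<Rightarrow> real) \<Rightarrow> bool" where
  "Ck_on 0 S f \<longleftrightarrow> continuous_on S f"
| "Ck_on (Suc k) S f \<longleftrightarrow> f differentiable_on S \<and> (\<forall>i. Ck_on k S (partial i f))"

definition smooth_on :: "(real^'n) set \<Rightarrow> (real^'n::finite \<Rightarrow> real) \<Rightarrow> bool" where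
  "smooth_on S f \<longleftrightarrow> (\<forall>k. Ck_on k S f)"


subsection \<open>Lorentzian metrics and Ricci curvature\<close>

type_synonym metric = "real^4 \<Rightarrow> real^4^4"

definition minkowski :: "real^4^4" where
  "minkowski = (\<chi> i j. if i = j then (if i = 0 then -1 else 1) else 0)"

text \<open>A symmetric bilinear form has signature \<open>(-,+,+,+)\<close> iff it is diagonal with entries
  \<open>-1, 1, 1, 1\<close> in some basis, here the columns of \<open>P\<close>.\<close>

definition lorentzian_on :: "(real^4) set \<Rightarrow> metric \<Rightarrow> bool" where
  "lorentzian_on S g \<longleftrightarrow>
     (\<forall>\<alpha> \<beta>. smooth_on S (\<lambda>p. g p $ \<alpha> $ \<beta>)) \<and>
     (\<forall>p\<in>S. transpose (g p) = g p \<and>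
            (\<exists>P. invertible P \<and> transpose P ** g p ** P = minkowski))"

definition metric_inv :: "metric \<Rightarrow> 4 \<Rightarrow> 4 \<Rightarrow> real^4 \<Rightarrow> real" where
  "metric_inv g \<alpha> \<beta> p = matrix_inv (g p) $ \<alpha> $ \<beta>"

text \<open>\<open>christoffel g \<rho> \<mu> \<nu>\<close> is \<open>\<Gamma>\<^sup>\<rho>\<^sub>\<mu>\<^sub>\<nu>\<close>.\<close>

definition christoffel :: "metric \<Rightarrow> 4 \<Rightarrow> 4 \<Rightarrow> 4 \<Rightarrow> real^4 \<Rightarrow> real" where
  "christoffel g \<rho> \<mu> \<nu> p =
     (\<Sum>\<sigma>\<in>UNIV. metric_inv g \<rho> \<sigma> p *
        (partial \<mu> (\<lambda>q. g q $ \<nu> $ \<sigma>) p + partial \<nu> (\<lambda>q. g q $ \<mu> $ \<sigma>) p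
          - partial \<sigma> (\<lambda>q. g q $ \<mu> $ \<nu>) p)) / 2"

text \<open>\<open>riemann g \<rho> \<sigma> \<mu> \<nu>\<close> is \<open>R\<^sup>\<rho>\<^sub>\<sigma>\<^sub>\<mu>\<^sub>\<nu>\<close>, that is,
  the \<open>\<rho>\<close> component of \<open>R(\<partial>\<^sub>\<mu>, \<partial>\<^sub>\<nu>) \<partial>\<^sub>\<sigma>\<close>.\<close>

definition riemann :: "metric \<Rightarrow> 4 \<Rightarrow> 4 \<Rightarrow> 4 \<Rightarrow> 4 \<Rightarrow> real^4 \<Rightarrow> real" where
  "riemann g \<rho> \<sigma> \<mu> \<nu> p =
     partial \<mu> (christoffel g \<rho> \<nu> \<sigma>) p - partial \<nu> (christoffel g \<rho> \<mu> \<sigma>) p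
     + (\<Sum>\<kappa>\<in>UNIV. christoffel g \<rho> \<mu> \<kappa> p * christoffel g \<kappa> \<nu> \<sigma> p)
     - (\<Sum>\<kappa>\<in>UNIV. christoffel g \<rho> \<nu> \<kappa> p * christoffel g \<kappa> \<mu> \<sigma> p)"

definition ricci :: "metric \<Rightarrow> 4 \<Rightarrow> 4 \<Rightarrow> real^4 \<Rightarrow> real" where
  "ricci g \<mu> \<nu> p = (\<Sum>\<rho>\<in>UNIV. riemann g \<rho> \<mu> \<rho> \<nu> p)"


subsection \<open>Sobolev norms on subsets of three-dimensional space\<close>

definition test_fun :: "(real^3) set \<Rightarrow> (real^3 \<Rightarrow> real) \<Rightarrow> bool" where
  "test_fun \<Omega> \<phi> \<longleftrightarrow> smooth_on UNIV \<phi> \<and>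
     compact (closure {x. \<phi> x \<noteq> 0}) \<and> closure {x. \<phi> x \<noteq> 0} \<subseteq> \<Omega>"

definition multi_deriv :: "(3 \<Rightarrow> nat) \<Rightarrow> (real^3 \<Rightarrow> real) \<Rightarrow> real^3 \<Rightarrow> real" where
  "multi_deriv a f = (partial 1 ^^ a 1) ((partial 2 ^^ a 2) ((partial 3 ^^ a 3) f))"

definition multi_order :: "(3 \<Rightarrow> nat) \<Rightarrow> nat" where
  "multi_order a = (\<Sum>i\<in>UNIV. a i)"

definition locally_integrable :: "(real^3) set \<Rightarrow> (real^3 \<Rightarrow> real) \<Rightarrow> bool" where
  "locally_integrable \<Omega> f \<longleftrightarrow> (\<forall>K. compact K \<and> K \<subseteq> \<Omega> \<longrightarrow> integrable (lebesgue_on K) f)"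

definition weak_deriv ::
    "(real^3) set \<Rightarrow> (3 \<Rightarrow> nat) \<Rightarrow> (real^3 \<Rightarrow> real) \<Rightarrow> (real^3 \<Rightarrow> real) \<Rightarrow> bool" where
  "weak_deriv \<Omega> a f w \<longleftrightarrow> locally_integrable \<Omega> f \<and> locally_integrable \<Omega> w \<and>
     (\<forall>\<phi>. test_fun \<Omega> \<phi> \<longrightarrow>
        (LINT x|lebesgue_on \<Omega>. f x * multi_deriv a \<phi> x) =
        (-1) ^ multi_order a * (LINT x|lebesgue_on \<Omega>. w x * \<phi> x))"

definition square_integrable :: "(real^3) set \<Rightarrow> (real^3 \<Rightarrow> real) \<Rightarrow> bool" where
  "square_integrable \<Omega> f \<longleftrightarrow>
     f \<in> borel_measurable (lebesgue_on \<Omega>) \<and> integrable (lebesgue_on \<Omega>) (\<lambda>x. (f x)\<^sup>2)"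

text \<open>
  The norm of \<open>H\<^sup>k(\<Omega>)\<close>. The infimum ranges over the families \<open>w\<close> of square-integrable
  weak derivatives of \<open>f\<close> of order at most \<open>k\<close>. Such a family is unique up to null sets, so all
  members have the same value; if there is none, i.e. \<open>f\<close> is not in \<open>H\<^sup>k(\<Omega>)\<close>, the infimum
  of the empty set is \<open>\<infinity>\<close>.
\<close>

definition sobolev_norm :: "nat \<Rightarrow> (real^3) set \<Rightarrow> (real^3 \<Rightarrow> real) \<Rightarrow> ennreal" where
  "sobolev_norm k \<Omega> f =
     (INF w \<in> {w. \<forall>a. multi_order a \<le> k \<longrightarrow> weak_deriv \<Omega> a f (w a) \<and> square_integrable \<Omega> (w a)}.
        ennreal (sqrt (\<Sum>a | multi_order a \<le> k. LINT x|lebesgue_on \<Omega>. (w a x)\<^sup>2)))"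


subsection \<open>The domain\<close>

definition spacetime_point :: "real \<Rightarrow> real^3 \<Rightarrow> real^4" where
  "spacetime_point t x =
     (\<chi> \<alpha>. if \<alpha> = 0 then t else if \<alpha> = 1 then x $ 1 else if \<alpha> = 2 then x $ 2 else x $ 3)"

definition H_step :: "real \<Rightarrow> real" where
  "H_step s = (if s < 0 then 1 else 1/4)"

definition D_dom :: "(real^4) set" where
  "D_dom = {p. (p $ 1 - 1)\<^sup>2 * H_step (p $ 1 - 1) + (p $ 2)\<^sup>2 / 4 + (p $ 3)\<^sup>2 / 4 < (1 - p $ 0)\<^sup>2}"

definition D_slice :: "real \<Rightarrow> (real^3) set" where
  "D_slice t = {x. spacetime_point t x \<in> D_dom}"

definition at_time :: "real \<Rightarrow> (real^4 \<Rightarrow> real) \<Rightarrow> real^3 \<Rightarrow> real" where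
  "at_time t f x = f (spacetime_point t x)"

end

theory Submission
  imports Defs
begin

text \<open>
  The metric is a vacuum plane wave \<open>du dv + a\<^sub>2\<^sup>2 dx\<^sub>2\<^sup>2 + a\<^sub>3\<^sup>2 dx\<^sub>3\<^sup>2\<close> with \<open>u = x\<^sub>1 - t\<close>, where
  \<open>a\<^sub>2 = L exp \<beta>\<close> and \<open>a\<^sub>3 = L exp (-\<beta>)\<close> are functions of \<open>u\<close>. It is Ricci flat iff
  \<open>L'' = - \<beta>'\<^sup>2 L\<close>. The function \<open>u\<close> is a wave coordinate, and so is the function \<open>V\<close> with \<open>v = L V\<close>;
  with \<open>V = x\<^sub>1 + t\<close> the metric becomes \<open>L du dV + V L' du\<^sup>2 + a\<^sub>2\<^sup>2 dx\<^sub>2\<^sup>2 + a\<^sub>3\<^sup>2 dx\<^sub>3\<^sup>2\<close>.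

  On \<open>t < 1\<close> the domain lies in \<open>u > 0\<close>, and near the tip \<open>u = 0\<close> of \<open>D\<^sub>t\<close> it looks like the paraboloid
  \<open>x\<^sub>2\<^sup>2 + x\<^sub>3\<^sup>2 < c u\<close>, so square integrability of a function of \<open>u\<close> is measured by the weight \<open>u du\<close>.
  We take \<open>\<beta>'\<close> of size \<open>\<lambda>\<^bsup>1/4\<^esup>\<close> with \<open>\<lambda> = 1 + log (1 + 1/u)\<close>. Then \<open>\<beta>''\<close> is of size
  \<open>1 / (u \<lambda>\<^bsup>3/4\<^esup>)\<close>, which is square integrable, whereas \<open>L''' \<sim> \<beta>' \<beta>''\<close> is of size \<open>1 / (u \<lambda>\<^bsup>1/2\<^esup>)\<close>,
  which just fails to be. In \<open>g\<^sub>0\<^sub>0 = - L + V L'\<close> the function \<open>L'''\<close> appears in the second derivatives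
  with the factor \<open>V = u + 2 t\<close>, which vanishes at the tip exactly when \<open>t = 0\<close>. On the other component
  \<open>t > 1\<close> of the domain the metric is the Minkowski metric.
\<close>

section \<open>Smooth functions\<close>

text \<open>The powers of \<open>lam\<close> are dictated by two integrals at the tip. The integral
  of \<open>lam^q du / u\<close> near 0 converges iff q < -1. If \<beta>' has size
  \<open>lam^p\<close>, then \<beta>'' has size \<open>lam^(p-1) / u\<close>, which is square
  integrable for \<open>u du\<close> iff p < 1/2, and L''' has size \<open>lam^(2p-1) / u\<close>,
  which fails to be so iff p \<ge> 1/4. Both demands meet because L depends quadratically on
  \<beta>; p = 1/4 is the borderline, where the divergence over the scales u ~ 4^-n is exactly that
  of the harmonic series. The transverse components contain \<beta>'' without a factor V, so the
  first demand cannot be relaxed even at t = 0. The vacuum equation is solved backwards: -L'' is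
  prescribed in closed form, L comes from two integrations, and \<beta>' is the square root of
  -L''/L. No differential equation has to be solved. The constraint is that L stays positive for
  every u > 0, because the domain extends to all negative t. A positive concave function on a
  half-line is nondecreasing, so L'' must be integrable at infinity as well as at the tip.\<close>

lemma partial_eqI:
  assumes "((\<lambda>h. f (x + h *\<^sub>R axis i 1)) has_real_derivative d) (at 0)"
  shows "partial i f x = d"
  using assms unfolding partial_def by (rule DERIV_imp_deriv)

lemma partial_has_derivative:
  fixes f :: "real^'n::finite \<Rightarrow> real"
  assumes "(f has_derivative f') (at x)"
  shows "((\<lambda>h. f (x + h *\<^sub>R axis i 1)) has_real_derivative f' (axis i 1)) (at 0)"
proof -
  have 1: "((\<lambda>h::real. x + h *\<^sub>R axis i (1::real)) has_derivative (\<lambda>h. h *\<^sub>R axis i 1)) (at 0)"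
    by (auto intro!: derivative_eq_intros)
  have 2: "(f has_derivative f') (at (x + (0::real) *\<^sub>R axis i 1))" using assms by simp
  have "((\<lambda>h. f (x + h *\<^sub>R axis i 1)) has_derivative (\<lambda>h. f' (h *\<^sub>R axis i 1))) (at 0)"
    using diff_chain_at[OF 1 2] by (simp add: o_def)
  moreover have "(\<lambda>h. f' (h *\<^sub>R axis i 1)) = (\<lambda>h. f' (axis i 1) * h)"
    using linear_cmul[OF has_derivative_linear[OF assms]] by auto
  ultimately show ?thesis by (simp add: has_field_derivative_def)
qed

lemma partial_of_has_derivative:
  "(f has_derivative f') (at x) \<Longrightarrow> partial i f x = f' (axis i 1)"
  by (rule partial_eqI[OF partial_has_derivative])

lemma differentiable_imp_has_partial:
  assumes "f differentiable (at x)"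
  shows "((\<lambda>h. f (x + h *\<^sub>R axis i 1)) has_real_derivative partial i f x) (at 0)"
  using assms partial_has_derivative partial_of_has_derivative
  unfolding differentiable_def by metis

lemma eventually_line_in_open:
  assumes "open S" "(x::real^'n::finite) \<in> S"
  shows "\<forall>\<^sub>F h in nhds (0::real). x + h *\<^sub>R axis i 1 \<in> S"
proof -
  have "((\<lambda>h::real. x + h *\<^sub>R axis i 1) \<longlongrightarrow> x + 0 *\<^sub>R axis i 1) (nhds 0)"
    by (intro tendsto_intros filterlim_ident)
  then show ?thesis using assms by (intro topological_tendstoD) auto
qed

lemma partial_cong_open:
  assumes "open S" "x \<in> S" "\<And>y. y \<in> S \<Longrightarrow> f y = g y"
  shows "partial i f x = partial i g x"
  unfolding partial_def
  by (rule deriv_cong_ev[OF eventually_mono[OF eventually_line_in_open[OF assms(1,2)]]])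
     (use assms in auto)

lemma differentiable_on_cong_open:
  assumes "open S" "\<And>y. y \<in> S \<Longrightarrow> f y = g y" "f differentiable_on S"
  shows "g differentiable_on S"
  unfolding differentiable_on_def
proof
  fix x assume "x \<in> S"
  then show "g differentiable at x within S"
    using assms differentiable_transform_within[of f x S 1 g] unfolding differentiable_on_def by auto
qed

text \<open>On an open set, agreement of two functions is inherited by their partial derivatives of
  every order. This allows each metric component to be replaced by its closed form.\<close>

lemma Ck_on_cong:
  assumes "open S" "\<And>y. y \<in> S \<Longrightarrow> f y = g y" "Ck_on k S f"
  shows "Ck_on k S g"
  using assms(2,3)
proof (induction k arbitrary: f g)
  case 0
  then show ?case by (simp cong: continuous_on_cong)
next
  case (Suc k)
  have "Ck_on k S (partial i g)" for i
    by (rule Suc.IH[of "partial i f" "partial i g"])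
       (use partial_cong_open[OF assms(1) _ Suc.prems(1)] Suc.prems(2) in auto)
  moreover have "g differentiable_on S"
    by (rule differentiable_on_cong_open[OF assms(1) Suc.prems(1)]) (use Suc.prems(2) in auto)
  ultimately show ?case by simp
qed

lemma Ck_on_continuous: "Ck_on k S f \<Longrightarrow> continuous_on S f"
  by (cases k) (auto intro: differentiable_imp_continuous_on)

lemma Ck_on_Suc_imp: "Ck_on (Suc k) S f \<Longrightarrow> Ck_on k S f"
proof (induction k arbitrary: f)
  case 0
  then show ?case by (auto intro: differentiable_imp_continuous_on)
next
  case (Suc k)
  have "f differentiable_on S" "Ck_on (Suc k) S (partial i f)" for i
    using Suc.prems Ck_on.simps(2)[of "Suc k" S f] by blast+
  then show ?case using Suc.IH Ck_on.simps(2)[of k S f] by blast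
qed

text \<open>Serves to glue the metric, which is given by different formulas on two separate open
  pieces of the domain.\<close>

lemma Ck_on_Un:
  assumes "open S" "open T" "Ck_on k S f" "Ck_on k T f"
  shows "Ck_on k (S \<union> T) f"
  using assms(3,4)
proof (induction k arbitrary: f)
  case 0
  then show ?case using assms by (simp add: continuous_on_open_Un)
next
  case (Suc k)
  then show ?case
    using assms(1,2) by (auto simp: differentiable_on_eq_differentiable_at open_Un)
qed

lemma Ck_on_add:
  assumes "open S" "Ck_on k S f" "Ck_on k S g"
  shows "Ck_on k S (\<lambda>x. f x + g x)"
  using assms(2,3)
proof (induction k arbitrary: f g)
  case 0
  then show ?case by (simp add: continuous_on_add)
next
  case (Suc k)
  have *: "partial i (\<lambda>x. f x + g x) x = partial i f x + partial i g x" if "x \<in> S" for i x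
    using Suc.prems that assms(1)
    by (intro partial_eqI DERIV_add differentiable_imp_has_partial)
       (auto simp: differentiable_on_eq_differentiable_at)
  have "Ck_on k S (partial i (\<lambda>x. f x + g x))" for i
    by (rule Ck_on_cong[OF assms(1) _ Suc.IH[of "partial i f" "partial i g"]])
       (use * Suc.prems in auto)
  then show ?case using Suc.prems by (auto intro: differentiable_on_add)
qed

lemma Ck_on_mult:
  assumes "open S" "Ck_on k S f" "Ck_on k S g"
  shows "Ck_on k S (\<lambda>x. f x * g x)"
  using assms(2,3)
proof (induction k arbitrary: f g)
  case 0
  then show ?case by (simp add: continuous_on_mult)
next
  case (Suc k)
  have *: "partial i (\<lambda>x. f x * g x) x = partial i f x * g x + partial i g x * f x"
    if "x \<in> S" for i x
    using DERIV_mult[OF differentiable_imp_has_partial[of f x i] differentiable_imp_has_partial[of g x i]]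
      Suc.prems that assms(1)
    by (intro partial_eqI) (auto simp: differentiable_on_eq_differentiable_at)
  have "Ck_on k S (\<lambda>x. partial i f x * g x + partial i g x * f x)" for i
    by (intro Ck_on_add assms(1) Suc.IH) (use Suc.prems Ck_on_Suc_imp in auto)
  then have "Ck_on k S (partial i (\<lambda>x. f x * g x))" for i
    using Ck_on_cong[OF assms(1), of "\<lambda>x. partial i f x * g x + partial i g x * f x"] * by auto
  then show ?case using Suc.prems by (auto intro: differentiable_on_mult)
qed

section \<open>Smooth functions of one real variable and their composition with affine forms\<close>

fun Ck_real :: "nat \<Rightarrow> real set \<Rightarrow> (real \<Rightarrow> real) \<Rightarrow> bool" where
  "Ck_real 0 I f \<longleftrightarrow> continuous_on I f"
| "Ck_real (Suc k) I f \<longleftrightarrow>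
     (\<exists>f'. (\<forall>s\<in>I. (f has_real_derivative f' s) (at s)) \<and> Ck_real k I f')"

lemma Ck_real_SucI:
  "(\<And>s. s \<in> I \<Longrightarrow> (f has_real_derivative f' s) (at s)) \<Longrightarrow> Ck_real k I f' \<Longrightarrow> Ck_real (Suc k) I f"
  by auto

lemma Ck_real_Suc_imp: "Ck_real (Suc k) I f \<Longrightarrow> Ck_real k I f"
proof (induction k arbitrary: f)
  case 0
  then show ?case by (auto simp: continuous_on_eq_continuous_within
      intro: continuous_at_imp_continuous_within DERIV_isCont)
next
  case (Suc k)
  obtain f' where "\<forall>s\<in>I. (f has_real_derivative f' s) (at s)" "Ck_real (Suc k) I f'"
    using Suc.prems Ck_real.simps(2)[of "Suc k" I f] by blast
  then show ?case using Suc.IH Ck_real.simps(2)[of k I f] by blast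
qed

lemma Ck_real_const: "Ck_real k I (\<lambda>s. c)"
proof (induction k arbitrary: c)
  case (Suc k)
  then show ?case by (intro Ck_real_SucI[where f'="\<lambda>s. 0"]) auto
qed auto

lemma Ck_real_ident: "Ck_real k I (\<lambda>s. s)"
proof (cases k)
  case (Suc k)
  then show ?thesis using Ck_real_const by (auto intro!: exI[of _ "\<lambda>_. 1"])
qed (auto simp: continuous_on_id)

lemma Ck_real_add: "Ck_real k I f \<Longrightarrow> Ck_real k I g \<Longrightarrow> Ck_real k I (\<lambda>s. f s + g s)"
proof (induction k arbitrary: f g)
  case (Suc k)
  then obtain f' g' where *: "\<And>s. s \<in> I \<Longrightarrow> (f has_real_derivative f' s) (at s)" "Ck_real k I f'"
    "\<And>s. s \<in> I \<Longrightarrow> (g has_real_derivative g' s) (at s)" "Ck_real k I g'"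
    unfolding Ck_real.simps by blast
  show ?case
    by (rule Ck_real_SucI[where f'="\<lambda>s. f' s + g' s"]) (auto intro: DERIV_add * Suc.IH)
qed (auto intro: continuous_on_add)

lemma Ck_real_mult: "Ck_real k I f \<Longrightarrow> Ck_real k I g \<Longrightarrow> Ck_real k I (\<lambda>s. f s * g s)"
proof (induction k arbitrary: f g)
  case (Suc k)
  then obtain f' g' where *: "\<And>s. s \<in> I \<Longrightarrow> (f has_real_derivative f' s) (at s)" "Ck_real k I f'"
    "\<And>s. s \<in> I \<Longrightarrow> (g has_real_derivative g' s) (at s)" "Ck_real k I g'"
    unfolding Ck_real.simps by blast
  show ?case
    by (rule Ck_real_SucI[where f'="\<lambda>s. f' s * g s + g' s * f s"])
       (auto intro!: DERIV_mult * Suc.IH Ck_real_add intro: Ck_real_Suc_imp[OF Suc.prems(1)] Ck_real_Suc_imp[OF Suc.prems(2)])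
qed (auto intro: continuous_on_mult)

lemma Ck_real_minus: "Ck_real k I f \<Longrightarrow> Ck_real k I (\<lambda>s. - f s)"
  using Ck_real_mult[OF Ck_real_const[of k I "-1"], of f] by simp

lemma Ck_real_diff: "Ck_real k I f \<Longrightarrow> Ck_real k I g \<Longrightarrow> Ck_real k I (\<lambda>s. f s - g s)"
  using Ck_real_add[OF _ Ck_real_minus, of k I f g] by simp

text \<open>Bootstrapping: f has the regularity of \<open>q * f\<close>, its own derivative, and so
  gains one order at each step. The square roots and exponentials of the profile solve such
  equations, which spares the higher chain rule.\<close>

lemma Ck_real_linear_ode:
  assumes "\<And>s. s \<in> I \<Longrightarrow> (f has_real_derivative q s * f s) (at s)" "\<And>k. Ck_real k I q"
  shows "Ck_real k I f"
proof (induction k)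
  case 0
  then show ?case using assms(1) 
    by (auto intro!: DERIV_continuous_on intro: has_field_derivative_at_within)
next
  case (Suc k)
  then show ?case by (intro Ck_real_SucI[OF assms(1)] Ck_real_mult assms(2)) auto
qed

lemma Ck_real_inverse:
  assumes "\<And>k. Ck_real k I f" "\<And>s. s \<in> I \<Longrightarrow> f s \<noteq> 0"
  shows "Ck_real k I (\<lambda>s. inverse (f s))"
proof (induction k)
  case 0
  then show ?case using assms(1)[of 0] assms(2) by (auto intro!: continuous_on_inverse)
next
  case (Suc k)
  obtain f' where f': "\<And>s. s \<in> I \<Longrightarrow> (f has_real_derivative f' s) (at s)" "Ck_real k I f'"
    using assms(1)[of "Suc k"] by auto
  show ?case
    by (rule Ck_real_SucI[where f'="\<lambda>s. - (inverse (f s) * f' s * inverse (f s))"])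
       (use f' assms(2) Suc in \<open>auto intro!: DERIV_inverse' Ck_real_minus Ck_real_mult\<close>)
qed

lemma Ck_real_divide:
  assumes "Ck_real k I g" "\<And>k. Ck_real k I f" "\<And>s. s \<in> I \<Longrightarrow> f s \<noteq> 0"
  shows "Ck_real k I (\<lambda>s. g s / f s)"
  using Ck_real_mult[OF assms(1) Ck_real_inverse[OF assms(2,3)]] by (simp add: field_simps)

lemma has_derivative_affine_comp:
  fixes v x :: "real^'n::finite"
  assumes "(f has_real_derivative d) (at (c + v \<bullet> x))"
  shows "((\<lambda>x. f (c + v \<bullet> x)) has_derivative (\<lambda>h. d * (v \<bullet> h))) (at x)"
proof -
  have "((\<lambda>x. c + v \<bullet> x) has_derivative (\<lambda>h. v \<bullet> h)) (at x)"
    by (auto intro!: derivative_eq_intros)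
  from diff_chain_at[OF this assms[unfolded has_field_derivative_def]]
  show ?thesis by (simp add: o_def)
qed

text \<open>The i-th partial derivative is again a composition with the same affine form, with f
  replaced by \<open>v $ i * f'\<close>, so the induction never leaves this class.\<close>

lemma Ck_on_affine_comp:
  fixes v :: "real^'n::finite"
  assumes "Ck_real k I f" "open S" "\<And>x. x \<in> S \<Longrightarrow> c + v \<bullet> x \<in> I"
  shows "Ck_on k S (\<lambda>x. f (c + v \<bullet> x))"
  using assms(1)
proof (induction k arbitrary: f)
  case 0
  then show ?case using assms(3)
    by (auto intro!: continuous_on_compose2[of I f] continuous_intros)
next
  case (Suc k)
  then obtain f' where f': "\<And>s. s \<in> I \<Longrightarrow> (f has_real_derivative f' s) (at s)" "Ck_real k I f'"
    by auto
  have d: "((\<lambda>x. f (c + v \<bullet> x)) has_derivative (\<lambda>h. f' (c + v \<bullet> x) * (v \<bullet> h))) (at x)"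
    if "x \<in> S" for x
    by (rule has_derivative_affine_comp[OF f'(1)[OF assms(3)[OF that]]])
  have "Ck_on k S (partial i (\<lambda>x. f (c + v \<bullet> x)))" for i
  proof (rule Ck_on_cong[OF assms(2)])
    show "Ck_on k S (\<lambda>x. (\<lambda>s. v $ i * f' s) (c + v \<bullet> x))"
      using Suc.IH[OF Ck_real_mult[OF Ck_real_const f'(2)]] .
    show "v $ i * f' (c + v \<bullet> y) = partial i (\<lambda>x. f (c + v \<bullet> x)) y" if "y \<in> S" for y
      using partial_of_has_derivative[OF d[OF that], of i] by (simp add: inner_axis mult.commute)
  qed
  then show ?case using d unfolding Ck_on.simps differentiable_on_def differentiable_def
    by (blast intro: has_derivative_at_withinI)
qed

section \<open>Plane waves in wave coordinates\<close>

text \<open>In the index type the literal 4 equals 0. Expansions over 1, 2, 3, 4 are rewritten so as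
  to start at the time index.\<close>

lemma UNIV_4_from_0: "(UNIV :: 4 set) = {0, 1, 2, 3}"
proof -
  have "(4::4) = 0" by simp
  then show ?thesis using UNIV_4 by (metis insert_commute)
qed

lemma sum_4_from_0: "(\<Sum>i\<in>UNIV. f (i::4)) = f 0 + f 1 + f 2 + (f 3 :: 'a::comm_monoid_add)"
  unfolding UNIV_4_from_0 by (simp add: ac_simps)

lemma forall_4_from_0: "(\<forall>i::4. P i) \<longleftrightarrow> P 0 \<and> P 1 \<and> P 2 \<and> P 3"
  using UNIV_4_from_0 by (metis UNIV_I empty_iff insert_iff)

lemma det_4_from_0:
  "det (A::real^4^4) =
    A$0$0 * (A$1$1 * (A$2$2 * A$3$3 - A$2$3 * A$3$2) - A$1$2 * (A$2$1 * A$3$3 - A$2$3 * A$3$1)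
      + A$1$3 * (A$2$1 * A$3$2 - A$2$2 * A$3$1))
  - A$0$1 * (A$1$0 * (A$2$2 * A$3$3 - A$2$3 * A$3$2) - A$1$2 * (A$2$0 * A$3$3 - A$2$3 * A$3$0)
      + A$1$3 * (A$2$0 * A$3$2 - A$2$2 * A$3$0))
  + A$0$2 * (A$1$0 * (A$2$1 * A$3$3 - A$2$3 * A$3$1) - A$1$1 * (A$2$0 * A$3$3 - A$2$3 * A$3$0)
      + A$1$3 * (A$2$0 * A$3$1 - A$2$1 * A$3$0))
  - A$0$3 * (A$1$0 * (A$2$1 * A$3$2 - A$2$2 * A$3$1) - A$1$1 * (A$2$0 * A$3$2 - A$2$2 * A$3$0)
      + A$1$2 * (A$2$0 * A$3$1 - A$2$1 * A$3$0))"
proof -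
  have f: "finite {1::4, 2, 3}" "0 \<notin> {1::4, 2, 3}" "finite {2::4, 3}" "1 \<notin> {2::4, 3}"
    "finite {3::4}" "2 \<notin> {3::4}" by auto
  show ?thesis
    unfolding det_def UNIV_4_from_0
    unfolding sum_over_permutations_insert[OF f(1,2)]
    unfolding sum_over_permutations_insert[OF f(3,4)]
    unfolding sum_over_permutations_insert[OF f(5,6)]
    unfolding permutes_sing
    by (simp add: sign_swap_id permutation_swap_id sign_compose sign_id permutation_compose
        transpose_apply_other field_simps)
qed

lemma matrix_inv_eqI:
  fixes A B :: "real^'n::finite^'n"
  assumes "A ** B = mat 1"
  shows "matrix_inv A = B"
proof -
  have "B ** A = mat 1" using assms by (simp add: matrix_left_right_inverse)
  with assms have "\<exists>A'. A ** A' = mat 1 \<and> A' ** A = mat 1" by blast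
  from someI_ex[OF this] have "matrix_inv A ** A = mat 1" unfolding matrix_inv_def by blast
  then have "matrix_inv A ** (A ** B) = B" by (simp add: matrix_mul_assoc)
  then show ?thesis using assms by simp
qed

text \<open>With u = x1 - t and V = x1 + t, the derivative in t is the V-derivative minus the
  u-derivative, and the derivative in x1 is their sum. The metric, the Christoffel symbols and the
  densities in the wave condition are all affine in V, so this one computation serves for all of
  them.\<close>

lemma partial_affine_form:
  fixes S :: "(real^4) set"
  assumes "open S" "p \<in> S"
    and "\<And>q. q \<in> S \<Longrightarrow> f q = \<phi> (q$1 - q$0) + \<psi> (q$1 - q$0) * (q$1 + q$0)"
    and "(\<phi> has_real_derivative \<phi>') (at (p$1 - p$0))" "(\<psi> has_real_derivative \<psi>') (at (p$1 - p$0))"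
  shows "partial i f p =
    (if i = 0 then \<psi> (p$1 - p$0) - (\<phi>' + \<psi>' * (p$1 + p$0))
     else if i = 1 then \<psi> (p$1 - p$0) + (\<phi>' + \<psi>' * (p$1 + p$0)) else 0)"
proof -
  let ?v = "axis 1 1 - axis 0 1 :: real^4"
  have v: "0 + ?v \<bullet> q = q$1 - q$0" for q by (simp add: inner_diff_left inner_axis')
  have d: "((\<lambda>q::real^4. h (q$1 - q$0)) has_derivative (\<lambda>k. h' * (k$1 - k$0))) (at p)"
    if "(h has_real_derivative h') (at (p$1 - p$0))" for h h'
    using has_derivative_affine_comp[where c=0 and v="?v" and x=p, unfolded v, OF that]
    by (simp add: inner_diff_left inner_axis')
  have "((\<lambda>q. \<phi> (q$1 - q$0) + \<psi> (q$1 - q$0) * (q$1 + q$0)) has_derivative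
     (\<lambda>h. \<phi>' * (h$1 - h$0) + (\<psi> (p$1 - p$0) * (h$1 + h$0) + \<psi>' * (h$1 - h$0) * (p$1 + p$0)))) (at p)"
    by (intro has_derivative_add has_derivative_mult d assms(4,5) bounded_linear_imp_has_derivative
        bounded_linear_add bounded_linear_vec_nth)
  note eq = partial_of_has_derivative[OF this, of i]
  have "partial i f p = partial i (\<lambda>q. \<phi> (q$1 - q$0) + \<psi> (q$1 - q$0) * (q$1 + q$0)) p"
    by (rule partial_cong_open[OF assms(1,2)]) (rule assms(3))
  then show ?thesis
    unfolding eq by (cases "i = 0"; cases "i = 1") (auto simp: axis_def algebra_simps)
qed

text \<open>The condition compares indices and does not involve s, so a table of components is
  differentiated entry by entry without splitting into cases.\<close>

lemma has_real_derivative_if: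
  assumes "(f has_real_derivative D) F" "(g has_real_derivative E) F"
  shows "((\<lambda>s. if c then f s else g s) has_real_derivative (if c then D else E)) F"
  using assms by simp

text \<open>The components of \<open>l du dV + m V du^2 + A dx2^2 + B dx3^2\<close> in t, x1, x2,
  x3, where u = x1 - t and V = x1 + t, so that du dV = dx1^2 - dt^2.\<close>

definition pw_matrix :: "real \<Rightarrow> real \<Rightarrow> real \<Rightarrow> real \<Rightarrow> real \<Rightarrow> real^4^4" where
  "pw_matrix l m A B V = (\<chi> \<alpha> \<beta>.
     if \<alpha> = 0 \<and> \<beta> = 0 then - l + m * V
     else if \<alpha> = 1 \<and> \<beta> = 1 then l + m * V
     else if \<alpha> = 0 \<and> \<beta> = 1 \<or> \<alpha> = 1 \<and> \<beta> = 0 then - m * V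
     else if \<alpha> = 2 \<and> \<beta> = 2 then A
     else if \<alpha> = 3 \<and> \<beta> = 3 then B else 0)"

definition pw_inverse :: "real \<Rightarrow> real \<Rightarrow> real \<Rightarrow> real \<Rightarrow> real \<Rightarrow> real^4^4" where
  "pw_inverse l m A B V = (\<chi> \<alpha> \<beta>.
     if \<alpha> = 0 \<and> \<beta> = 0 then - (l + m * V) / l\<^sup>2
     else if \<alpha> = 1 \<and> \<beta> = 1 then (l - m * V) / l\<^sup>2
     else if \<alpha> = 0 \<and> \<beta> = 1 \<or> \<alpha> = 1 \<and> \<beta> = 0 then - (m * V) / l\<^sup>2
     else if \<alpha> = 2 \<and> \<beta> = 2 then 1 / A
     else if \<alpha> = 3 \<and> \<beta> = 3 then 1 / B else 0)"

lemma matrix_inv_pw: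
  assumes "l > 0" "A > 0" "B > 0"
  shows "matrix_inv (pw_matrix l m A B V) = pw_inverse l m A B V"
  by (rule matrix_inv_eqI)
     (use assms in \<open>simp add: vec_eq_iff matrix_matrix_mult_def mat_def sum_4_from_0 forall_4_from_0
       pw_matrix_def pw_inverse_def field_simps power2_eq_square\<close>)

text \<open>V drops out, since the block of t and x1 has determinant
  \<open>(m V)^2 - l^2 - (m V)^2\<close>. The volume density therefore depends on u alone.\<close>

lemma det_pw: "det (pw_matrix l m A B V) = - (l\<^sup>2 * A * B)"
  unfolding det_4_from_0 by (simp add: pw_matrix_def algebra_simps power2_eq_square)

lemma pw_congruent_minkowski:
  assumes "l > 0" "A > 0" "B > 0"
  shows "\<exists>P. invertible P \<and> transpose P ** pw_matrix l m A B V ** P = minkowski"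
proof -
  \<comment> \<open>The sum of the first two columns of P is the null direction (1, 1) of the t, x1
    plane, and their difference is (-1, 1) plus 2k times it, both divided by r. This k makes the
    difference null as well, and r normalises the product of the two null vectors.\<close>
  define k where "k = - (m * V) / (2 * l)"
  define r where "r = sqrt l"
  define P :: "real^4^4" where "P = (\<chi> \<alpha> \<beta>.
     if \<alpha> = 0 \<and> \<beta> = 0 then (1 - k) / r else if \<alpha> = 1 \<and> \<beta> = 0 then - k / r
     else if \<alpha> = 0 \<and> \<beta> = 1 then k / r else if \<alpha> = 1 \<and> \<beta> = 1 then (1 + k) / r
     else if \<alpha> = 2 \<and> \<beta> = 2 then 1 / sqrt A
     else if \<alpha> = 3 \<and> \<beta> = 3 then 1 / sqrt B else 0)"
  have r: "r > 0" "l = r * r" using assms by (auto simp: r_def)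
  have k: "m * V = - 2 * (r * r) * k" using assms r by (simp add: k_def field_simps)
  have sq: "A = sqrt A * sqrt A" "B = sqrt B * sqrt B" using assms by auto
  have pos: "sqrt A > 0" "sqrt B > 0" using assms by auto
  have "transpose P ** pw_matrix l m A B V ** P = minkowski"
    unfolding pw_matrix_def P_def minkowski_def
    using r(1) pos assms(2,3)
    by (simp add: vec_eq_iff matrix_matrix_mult_def transpose_def sum_4_from_0 forall_4_from_0 k)
       (simp add: r(2) field_simps)
  moreover from this have "det P * det (pw_matrix l m A B V) * det P = det minkowski"
    by (metis det_mul det_transpose)
  moreover have "det minkowski = -1"
    unfolding det_4_from_0 by (simp add: minkowski_def)
  ultimately show ?thesis using invertible_det_nz by force
qed

lemma transpose_pw: "transpose (pw_matrix l m A B V) = pw_matrix l m A B V"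
  by (simp add: vec_eq_iff transpose_def forall_4_from_0 pw_matrix_def)

text \<open>Here \<open>m = L'\<close>, \<open>b = \<beta>'\<close>, \<open>e = \<beta>''\<close>, and \<open>A\<close>, \<open>B\<close> are the squares of the transverse scale factors.
  The metric and the Christoffel symbols are affine in \<open>V\<close>: \<open>g0 + g1 V\<close> and \<open>G0 + G1 V\<close> with coefficients
  depending on \<open>u\<close> only, whose derivatives are called \<open>dg0\<close>, \<open>dg1\<close>, \<open>dG0\<close>, \<open>dG1\<close>.\<close>

locale plane_wave =
  fixes S :: "(real^4) set" and I :: "real set" and g :: metric
    and L m b e A B :: "real \<Rightarrow> real"
  assumes open_S: "open S"
    and in_I: "\<And>p. p \<in> S \<Longrightarrow> p$1 - p$0 \<in> I"
    and g_eq: "\<And>p. p \<in> S \<Longrightarrow>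
      g p = pw_matrix (L (p$1 - p$0)) (m (p$1 - p$0)) (A (p$1 - p$0)) (B (p$1 - p$0)) (p$1 + p$0)"
    and pos: "\<And>s. s \<in> I \<Longrightarrow> L s > 0" "\<And>s. s \<in> I \<Longrightarrow> A s > 0" "\<And>s. s \<in> I \<Longrightarrow> B s > 0"
    and AB: "\<And>s. s \<in> I \<Longrightarrow> A s * B s = L s ^ 4"
    and der_L: "\<And>s. s \<in> I \<Longrightarrow> (L has_real_derivative m s) (at s)"
    and der_m: "\<And>s. s \<in> I \<Longrightarrow> (m has_real_derivative - ((b s)\<^sup>2 * L s)) (at s)"
    and der_b: "\<And>s. s \<in> I \<Longrightarrow> (b has_real_derivative e s) (at s)"
    and der_A: "\<And>s. s \<in> I \<Longrightarrow> (A has_real_derivative 2 * (m s / L s + b s) * A s) (at s)"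
    and der_B: "\<And>s. s \<in> I \<Longrightarrow> (B has_real_derivative 2 * (m s / L s - b s) * B s) (at s)"
    and smooth: "\<And>k. Ck_real k I L" "\<And>k. Ck_real k I m" "\<And>k. Ck_real k I A" "\<And>k. Ck_real k I B"
begin

text \<open>The logarithmic derivative of L. Thus \<open>r + b\<close> and \<open>r - b\<close> are
  the logarithmic derivatives of the two transverse scale factors, and the curvature becomes
  polynomial in these quantities up to the factors \<open>A / L\<close> and
  \<open>B / L\<close>.\<close>

definition "r s = m s / L s"

definition "g0 \<alpha> \<beta> s = (if \<alpha> = (0::4) \<and> \<beta> = (0::4) then - L s else if \<alpha> = 1 \<and> \<beta> = 1 then L s
   else if \<alpha> = 2 \<and> \<beta> = 2 then A s else if \<alpha> = 3 \<and> \<beta> = 3 then B s else 0)"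

definition "g1 \<alpha> \<beta> s = (if \<alpha> = (0::4) \<and> \<beta> = (0::4) \<or> \<alpha> = 1 \<and> \<beta> = 1 then m s
   else if \<alpha> = 0 \<and> \<beta> = 1 \<or> \<alpha> = 1 \<and> \<beta> = 0 then - m s else 0)"

definition "dg0 \<alpha> \<beta> s = (if \<alpha> = (0::4) \<and> \<beta> = (0::4) then - m s else if \<alpha> = 1 \<and> \<beta> = 1 then m s
   else if \<alpha> = 2 \<and> \<beta> = 2 then 2 * (r s + b s) * A s
   else if \<alpha> = 3 \<and> \<beta> = 3 then 2 * (r s - b s) * B s else 0)"

definition "dg1 \<alpha> \<beta> s = (if \<alpha> = (0::4) \<and> \<beta> = (0::4) \<or> \<alpha> = 1 \<and> \<beta> = 1 then - ((b s)\<^sup>2 * L s)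
   else if \<alpha> = 0 \<and> \<beta> = 1 \<or> \<alpha> = 1 \<and> \<beta> = 0 then (b s)\<^sup>2 * L s else 0)"

definition "G0 \<rho> \<mu> \<nu> s =
  (if \<rho> = (0::4) \<or> \<rho> = 1 then
     (if \<mu> = (0::4) \<and> \<nu> = (0::4) then - r s else if \<mu> = 1 \<and> \<nu> = 1 then r s
      else if \<mu> = 2 \<and> \<nu> = 2 then - ((r s + b s) * (A s / L s))
      else if \<mu> = 3 \<and> \<nu> = 3 then - ((r s - b s) * (B s / L s)) else 0)
   else if \<rho> = 2 then
     (if \<mu> = 0 \<and> \<nu> = 2 \<or> \<mu> = 2 \<and> \<nu> = 0 then - (r s + b s)
      else if \<mu> = 1 \<and> \<nu> = 2 \<or> \<mu> = 2 \<and> \<nu> = 1 then r s + b s else 0)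
   else
     (if \<mu> = 0 \<and> \<nu> = 3 \<or> \<mu> = 3 \<and> \<nu> = 0 then - (r s - b s)
      else if \<mu> = 1 \<and> \<nu> = 3 \<or> \<mu> = 3 \<and> \<nu> = 1 then r s - b s else 0))"

definition "G1 \<rho> \<mu> \<nu> s =
  (if \<rho> = (0::4) \<or> \<rho> = 1 then
     (if \<mu> = (0::4) \<and> \<nu> = (0::4) \<or> \<mu> = 1 \<and> \<nu> = 1 then - ((b s)\<^sup>2 / 2)
      else if \<mu> = 0 \<and> \<nu> = 1 \<or> \<mu> = 1 \<and> \<nu> = 0 then (b s)\<^sup>2 / 2 else 0)
   else 0)"

text \<open>The equation L'' = -b^2 L in Riccati form.\<close>

definition "dr s = - ((b s)\<^sup>2) - (r s)\<^sup>2"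

definition "dG0 \<rho> \<mu> \<nu> s =
  (if \<rho> = (0::4) \<or> \<rho> = 1 then
     (if \<mu> = (0::4) \<and> \<nu> = (0::4) then - dr s else if \<mu> = 1 \<and> \<nu> = 1 then dr s
      else if \<mu> = 2 \<and> \<nu> = 2 then
        - ((dr s + e s + (r s + b s) * (2 * (r s + b s) - r s)) * (A s / L s))
      else if \<mu> = 3 \<and> \<nu> = 3 then
        - ((dr s - e s + (r s - b s) * (2 * (r s - b s) - r s)) * (B s / L s)) else 0)
   else if \<rho> = 2 then
     (if \<mu> = 0 \<and> \<nu> = 2 \<or> \<mu> = 2 \<and> \<nu> = 0 then - (dr s + e s)
      else if \<mu> = 1 \<and> \<nu> = 2 \<or> \<mu> = 2 \<and> \<nu> = 1 then dr s + e s else 0)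
   else
     (if \<mu> = 0 \<and> \<nu> = 3 \<or> \<mu> = 3 \<and> \<nu> = 0 then - (dr s - e s)
      else if \<mu> = 1 \<and> \<nu> = 3 \<or> \<mu> = 3 \<and> \<nu> = 1 then dr s - e s else 0))"

definition "dG1 \<rho> \<mu> \<nu> s =
  (if \<rho> = (0::4) \<or> \<rho> = 1 then
     (if \<mu> = (0::4) \<and> \<nu> = (0::4) \<or> \<mu> = 1 \<and> \<nu> = 1 then - (b s * e s)
      else if \<mu> = 0 \<and> \<nu> = 1 \<or> \<mu> = 1 \<and> \<nu> = 0 then b s * e s else 0)
   else 0)"

lemma g_entry:
  "p \<in> S \<Longrightarrow> g p $ \<alpha> $ \<beta> = g0 \<alpha> \<beta> (p$1 - p$0) + g1 \<alpha> \<beta> (p$1 - p$0) * (p$1 + p$0)"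
  by (simp add: g_eq pw_matrix_def g0_def g1_def)

lemma der_g0: "s \<in> I \<Longrightarrow> (g0 \<alpha> \<beta> has_real_derivative dg0 \<alpha> \<beta> s) (at s)"
  unfolding g0_def[abs_def] dg0_def r_def
  by (intro has_real_derivative_if DERIV_minus DERIV_const der_L der_A der_B)

lemma der_g1:
  assumes "s \<in> I"
  shows "(g1 \<alpha> \<beta> has_real_derivative dg1 \<alpha> \<beta> s) (at s)"
proof -
  have "((\<lambda>s. - m s) has_real_derivative (b s)\<^sup>2 * L s) (at s)"
    using DERIV_minus[OF der_m[OF assms]] by simp
  then show ?thesis
    unfolding g1_def[abs_def] dg1_def
    by (intro has_real_derivative_if DERIV_const der_m assms)
qed

lemma der_r: "s \<in> I \<Longrightarrow> (r has_real_derivative dr s) (at s)"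
  unfolding r_def[abs_def] dr_def using DERIV_divide[OF der_m der_L, of s] pos(1)[of s]
  by (simp add: field_simps power2_eq_square)

lemma der_AL: "s \<in> I \<Longrightarrow> ((\<lambda>s. A s / L s) has_real_derivative (2 * (r s + b s) - r s) * (A s / L s)) (at s)"
  using DERIV_divide[OF der_A der_L, of s] pos(1)[of s] unfolding r_def
  by (simp add: field_simps power2_eq_square)

lemma der_BL: "s \<in> I \<Longrightarrow> ((\<lambda>s. B s / L s) has_real_derivative (2 * (r s - b s) - r s) * (B s / L s)) (at s)"
  using DERIV_divide[OF der_B der_L, of s] pos(1)[of s] unfolding r_def
  by (simp add: field_simps power2_eq_square)

lemma der_G0:
  assumes "s \<in> I"
  shows "(G0 \<rho> \<mu> \<nu> has_real_derivative dG0 \<rho> \<mu> \<nu> s) (at s)"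
proof -
  note d = DERIV_add[OF der_r der_b, OF assms assms] DERIV_diff[OF der_r der_b, OF assms assms]
  have "((\<lambda>s. (r s + b s) * (A s / L s)) has_real_derivative
      (dr s + e s + (r s + b s) * (2 * (r s + b s) - r s)) * (A s / L s)) (at s)"
    using DERIV_mult[OF d(1) der_AL[OF assms]] by (rule DERIV_cong) (simp only: distrib_right distrib_left ac_simps)
  moreover have "((\<lambda>s. (r s - b s) * (B s / L s)) has_real_derivative
      (dr s - e s + (r s - b s) * (2 * (r s - b s) - r s)) * (B s / L s)) (at s)"
    using DERIV_mult[OF d(2) der_BL[OF assms]] by (rule DERIV_cong) (simp only: distrib_right distrib_left ac_simps)
  ultimately show ?thesis
    unfolding G0_def[abs_def] dG0_def
    by (intro has_real_derivative_if DERIV_minus DERIV_const der_r d assms)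
qed

lemma der_G1:
  assumes "s \<in> I"
  shows "(G1 \<rho> \<mu> \<nu> has_real_derivative dG1 \<rho> \<mu> \<nu> s) (at s)"
proof -
  have "((\<lambda>s. (b s)\<^sup>2 / 2) has_real_derivative b s * e s) (at s)"
    using DERIV_cdivide[OF DERIV_power[OF der_b[OF assms], of 2], of 2] by (simp add: mult.commute)
  then show ?thesis
    unfolding G1_def[abs_def] dG1_def
    by (intro has_real_derivative_if DERIV_minus DERIV_const)
qed

lemma metric_inv_eq:
  "p \<in> S \<Longrightarrow> metric_inv g \<alpha> \<beta> p = pw_inverse (L (p$1 - p$0)) (m (p$1 - p$0)) (A (p$1 - p$0)) (B (p$1 - p$0)) (p$1 + p$0) $ \<alpha> $ \<beta>"
  unfolding metric_inv_def using g_eq matrix_inv_pw pos in_I by simp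

lemma partial_g:
  "p \<in> S \<Longrightarrow> partial i (\<lambda>q. g q $ \<alpha> $ \<beta>) p =
    (if i = 0 then g1 \<alpha> \<beta> (p$1 - p$0) - (dg0 \<alpha> \<beta> (p$1 - p$0) + dg1 \<alpha> \<beta> (p$1 - p$0) * (p$1 + p$0))
     else if i = 1 then g1 \<alpha> \<beta> (p$1 - p$0) + (dg0 \<alpha> \<beta> (p$1 - p$0) + dg1 \<alpha> \<beta> (p$1 - p$0) * (p$1 + p$0)) else 0)"
  by (rule partial_affine_form[OF open_S _ g_entry der_g0 der_g1]) (auto intro: in_I)

text \<open>A priori the product of inverse metric and derivatives is quadratic in V. The
  V-dependent part of the metric is a multiple of du^2, that of the inverse is a multiple of the
  square of the vector (1, 1, 0, 0), and du annihilates this vector; so no V^2 survives.\<close>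

lemma christoffel_eq:
  assumes p: "p \<in> S"
  shows "christoffel g \<rho> \<mu> \<nu> p = G0 \<rho> \<mu> \<nu> (p$1 - p$0) + G1 \<rho> \<mu> \<nu> (p$1 - p$0) * (p$1 + p$0)"
proof -
  define s V where sV: "s = p$1 - p$0" "V = p$1 + p$0"
  have P: "L s > 0" "A s > 0" "B s > 0" using pos in_I[OF p] by (auto simp: sV)
  have m: "m s = r s * L s" using P by (simp add: r_def)
  have "\<forall>\<rho> \<mu> \<nu>. christoffel g \<rho> \<mu> \<nu> p = G0 \<rho> \<mu> \<nu> s + G1 \<rho> \<mu> \<nu> s * V"
    unfolding christoffel_def sum_4_from_0 metric_inv_eq[OF p] partial_g[OF p] sV[symmetric]
      forall_4_from_0
    using P
    by (simp add: pw_inverse_def g1_def dg0_def dg1_def G0_def G1_def m)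
       (simp add: field_simps power2_eq_square)
  then show ?thesis by (simp add: sV)
qed

lemma partial_christoffel:
  "p \<in> S \<Longrightarrow> partial i (christoffel g \<rho> \<mu> \<nu>) p =
    (if i = 0 then G1 \<rho> \<mu> \<nu> (p$1 - p$0) - (dG0 \<rho> \<mu> \<nu> (p$1 - p$0) + dG1 \<rho> \<mu> \<nu> (p$1 - p$0) * (p$1 + p$0))
     else if i = 1 then G1 \<rho> \<mu> \<nu> (p$1 - p$0) + (dG0 \<rho> \<mu> \<nu> (p$1 - p$0) + dG1 \<rho> \<mu> \<nu> (p$1 - p$0) * (p$1 + p$0)) else 0)"
  by (rule partial_affine_form[OF open_S _ christoffel_eq der_G0 der_G1]) (auto intro: in_I)

text \<open>For a plane wave the only Ricci component that can be non-zero is the one along du^2, a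
  multiple of L''/L + b^2. The vacuum equation is already built into \<open>dr\<close>,
  \<open>G1\<close> and their derivatives, so what remains is an algebraic identity.\<close>

lemma ricci_flat:
  assumes p: "p \<in> S"
  shows "ricci g \<mu> \<nu> p = 0"
proof -
  define s V where sV: "s = p$1 - p$0" "V = p$1 + p$0"
  have "\<forall>\<mu> \<nu>. ricci g \<mu> \<nu> p = 0"
    unfolding ricci_def riemann_def sum_4_from_0 christoffel_eq[OF p] partial_christoffel[OF p]
      sV[symmetric] forall_4_from_0
    by (simp add: G0_def G1_def dG0_def dG1_def dr_def)
       (simp add: algebra_simps power2_eq_square add_divide_distrib diff_divide_distrib)
  then show ?thesis by simp
qed

lemma sqrt_det:
  assumes q: "q \<in> S"
  shows "sqrt \<bar>det (g q)\<bar> = L (q$1 - q$0) ^ 3"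
proof (rule real_sqrt_unique)
  show "(L (q$1 - q$0) ^ 3)\<^sup>2 = \<bar>det (g q)\<bar>"
    using AB[OF in_I[OF q]] pos[OF in_I[OF q]]
    by (simp add: g_eq[OF q] det_pw abs_mult mult.assoc)
qed (use pos(1)[OF in_I[OF q]] in simp)

text \<open>In the block of t and x1 the density is \<open>h0 + h1 V\<close>. The coefficient
  \<open>h1\<close> is the same for all four entries, so the terms with \<open>k1\<close> cancel in
  the divergence; there remains twice \<open>h1\<close> against \<open>k0\<close>, that is, 2 L L'
  against the derivative of L^2. This is the cancellation that v = L V is designed for.\<close>

lemma wave_coordinates:
  assumes p: "p \<in> S"
  shows "(\<Sum>\<alpha>\<in>UNIV. partial \<alpha> (\<lambda>q. sqrt \<bar>det (g q)\<bar> * metric_inv g \<alpha> \<beta> q) p) = 0"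
proof -
  define h0 where "h0 \<alpha> \<beta> s = (if \<alpha> = (0::4) \<and> \<beta> = (0::4) then - (L s * L s)
    else if \<alpha> = 1 \<and> \<beta> = 1 then L s * L s else 0)" for \<alpha> \<beta> s
  define h1 where "h1 \<alpha> \<beta> s = (if (\<alpha> = (0::4) \<or> \<alpha> = 1) \<and> (\<beta> = (0::4) \<or> \<beta> = 1) then - (L s * m s) else 0)"
    for \<alpha> \<beta> s
  define k0 where "k0 \<alpha> \<beta> s = (if \<alpha> = (0::4) \<and> \<beta> = (0::4) then - (2 * L s * m s)
    else if \<alpha> = 1 \<and> \<beta> = 1 then 2 * L s * m s else 0)" for \<alpha> \<beta> s
  define k1 where "k1 \<alpha> \<beta> s = (if (\<alpha> = (0::4) \<or> \<alpha> = 1) \<and> (\<beta> = (0::4) \<or> \<beta> = 1)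
    then - (m s * m s - L s * ((b s)\<^sup>2 * L s)) else 0)" for \<alpha> \<beta> s
  have d: "(h0 \<alpha> \<beta> has_real_derivative k0 \<alpha> \<beta> s) (at s)" "(h1 \<alpha> \<beta> has_real_derivative k1 \<alpha> \<beta> s) (at s)"
    if "s \<in> I" for \<alpha> \<beta> s
    unfolding h0_def[abs_def] k0_def h1_def[abs_def] k1_def
    by (auto intro!: derivative_eq_intros der_L der_m that simp: algebra_simps)
  have "sqrt \<bar>det (g q)\<bar> * metric_inv g \<alpha> \<beta> q =
      h0 \<alpha> \<beta> (q$1 - q$0) + h1 \<alpha> \<beta> (q$1 - q$0) * (q$1 + q$0)" 
    if q: "q \<in> S" and ab: "\<alpha> = 0 \<or> \<alpha> = 1" for \<alpha> \<beta> q
  proof -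
    have P: "L (q$1 - q$0) > 0" using pos in_I[OF q] by auto
    then show ?thesis using ab
      by (auto simp: sqrt_det[OF q] metric_inv_eq[OF q] pw_inverse_def h0_def h1_def
          field_simps eval_nat_numeral)
  qed
  then have part: "partial \<alpha> (\<lambda>q. sqrt \<bar>det (g q)\<bar> * metric_inv g \<alpha> \<beta> q) p =
    (if \<alpha> = 0 then h1 \<alpha> \<beta> (p$1 - p$0) - (k0 \<alpha> \<beta> (p$1 - p$0) + k1 \<alpha> \<beta> (p$1 - p$0) * (p$1 + p$0))
     else if \<alpha> = 1 then h1 \<alpha> \<beta> (p$1 - p$0) + (k0 \<alpha> \<beta> (p$1 - p$0) + k1 \<alpha> \<beta> (p$1 - p$0) * (p$1 + p$0)) else 0)"
    if "\<alpha> = 0 \<or> \<alpha> = 1" for \<alpha> \<beta>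
    using that
    by (intro partial_affine_form[where \<phi>="h0 \<alpha> \<beta>" and \<psi>="h1 \<alpha> \<beta>", OF open_S p]
        d(1)[OF in_I[OF p]] d(2)[OF in_I[OF p]])
  have part0: "partial \<alpha> (\<lambda>q. sqrt \<bar>det (g q)\<bar> * metric_inv g \<alpha> \<beta> q) p = 0"
    if "\<alpha> = 2 \<or> \<alpha> = 3" for \<alpha> \<beta>
  proof -
    \<comment> \<open>The transverse densities depend on u only, and derivatives in x2 and x3 do not
      see u. Differentiability alone is needed here, and the value of D is irrelevant.\<close>
    define \<phi> where "\<phi> s = (if \<beta> = \<alpha> then L s ^ 3 / (if \<alpha> = 2 then A s else B s) else 0)" for s
    have "(\<lambda>s. L s ^ 3 / A s) differentiable at s" "(\<lambda>s. L s ^ 3 / B s) differentiable at s" if "s \<in> I" for s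
    proof -
      have "L differentiable at s" "A differentiable at s" "B differentiable at s"
        using der_L[OF that] der_A[OF that] der_B[OF that] real_differentiable_def by blast+
      then show "(\<lambda>s. L s ^ 3 / A s) differentiable at s" "(\<lambda>s. L s ^ 3 / B s) differentiable at s"
        using pos[OF that] by (auto intro!: differentiable_divide differentiable_power)
    qed
    then have "\<exists>D. (\<phi> has_real_derivative D) (at s)" if "s \<in> I" for s
      using that unfolding \<phi>_def[abs_def]
      by (cases "\<beta> = \<alpha>"; cases "\<alpha> = 2") (auto simp: real_differentiable_def intro: DERIV_const)
    then obtain D where "(\<phi> has_real_derivative D) (at (p$1 - p$0))" using in_I[OF p] by blast
    moreover have "sqrt \<bar>det (g q)\<bar> * metric_inv g \<alpha> \<beta> q = \<phi> (q$1 - q$0) + 0 * (q$1 + q$0)"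
      if q: "q \<in> S" for q
      using \<open>\<alpha> = 2 \<or> \<alpha> = 3\<close>
      by (auto simp: sqrt_det[OF q] metric_inv_eq[OF q] pw_inverse_def \<phi>_def)
    ultimately show ?thesis
      using that partial_affine_form[where \<phi>=\<phi> and \<psi>="\<lambda>_. 0" and \<phi>'=D and \<psi>'=0, OF open_S p, of _ \<alpha>]
      by auto
  qed
  have "\<forall>\<beta>. (\<Sum>\<alpha>\<in>UNIV. partial \<alpha> (\<lambda>q. sqrt \<bar>det (g q)\<bar> * metric_inv g \<alpha> \<beta> q) p) = 0"
    unfolding sum_4_from_0 forall_4_from_0
    by (simp add: part part0) (simp add: h1_def k0_def k1_def algebra_simps)
  then show ?thesis by blast
qed

lemma lorentzian: "lorentzian_on S g"
proof -
  let ?u = "axis 1 1 - axis 0 1 :: real^4" and ?v = "axis 1 1 + axis 0 1 :: real^4"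
  have u: "0 + ?u \<bullet> q = q$1 - q$0" and v: "0 + ?v \<bullet> q = q$1 + q$0" for q
    by (simp_all add: inner_diff_left inner_add_left inner_axis')
  have "\<forall>\<alpha> \<beta>. Ck_real k I (g0 \<alpha> \<beta>) \<and> Ck_real k I (g1 \<alpha> \<beta>)" for k
    unfolding forall_4_from_0
    by (simp add: g0_def[abs_def] g1_def[abs_def] smooth Ck_real_minus Ck_real_const)
  then have s: "Ck_real k I (g0 \<alpha> \<beta>)" "Ck_real k I (g1 \<alpha> \<beta>)" for k \<alpha> \<beta> by auto
  have c: "Ck_on k S (\<lambda>p. f (p$1 - p$0))" if "Ck_real k I f" for f k
    using Ck_on_affine_comp[OF that open_S, of 0 ?u] in_I unfolding u by blast
  have i: "Ck_on k S (\<lambda>p. p$1 + p$0)" for k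
    using Ck_on_affine_comp[OF Ck_real_ident[of k UNIV] open_S, of 0 ?v] unfolding v by blast
  have "Ck_on k S (\<lambda>p. g p $ \<alpha> $ \<beta>)" for k \<alpha> \<beta>
    by (rule Ck_on_cong[OF open_S g_entry[symmetric]])
       (auto intro!: Ck_on_add Ck_on_mult open_S c s i)
  then show ?thesis
    unfolding lorentzian_on_def smooth_on_def
    using pos in_I by (auto simp: g_eq transpose_pw intro!: pw_congruent_minkowski)
qed

end

section \<open>Integration by parts and weak derivatives\<close>

lemma lborel_integral_translate:
  fixes h :: "'a::euclidean_space \<Rightarrow> real"
  assumes "h \<in> borel_measurable borel"
  shows "integral\<^sup>L lborel (\<lambda>x. h (c + x)) = integral\<^sup>L lborel h"
proof -
  have "integral\<^sup>L (distr lborel borel ((+) c)) h = integral\<^sup>L lborel (\<lambda>x. h (c + x))"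
    by (rule integral_distr) (use assms in auto)
  then show ?thesis by (simp add: lborel_distr_plus)
qed

lemma integrable_continuous_compact_support:
  fixes h :: "'a::euclidean_space \<Rightarrow> real"
  assumes "continuous_on UNIV h" "bounded K" "\<And>x. x \<notin> K \<Longrightarrow> h x = 0"
  shows "integrable lborel h"
proof -
  obtain a where a: "K \<subseteq> cbox (-a) a" using bounded_subset_cbox_symmetric[OF assms(2)] by blast
  have "integrable lborel (\<lambda>x. indicator (cbox (-a) a) x *\<^sub>R h x)"
    by (rule borel_integrable_compact) (use continuous_on_subset[OF assms(1)] in auto)
  moreover have "(\<lambda>x. indicator (cbox (-a) a) x *\<^sub>R h x) = h"
    using assms(3) a by (auto simp: indicator_def fun_eq_iff)
  ultimately show ?thesis by simp
qed

text \<open>By translation invariance every difference quotient of h in direction v has integral 0.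
  They are bounded by the maximum of the derivative and supported in a common ball, so dominated
  convergence passes to the limit. This replaces Fubini in the integration by parts.\<close>

lemma integral_directional_derivative_eq_0:
  fixes h h' :: "'a::euclidean_space \<Rightarrow> real"
  assumes ch: "continuous_on UNIV h" and ch': "continuous_on UNIV h'" and K: "compact K"
    and h0: "\<And>x. x \<notin> K \<Longrightarrow> h x = 0" and h'0: "\<And>x. x \<notin> K \<Longrightarrow> h' x = 0"
    and der: "\<And>x. ((\<lambda>\<tau>. h (x + \<tau> *\<^sub>R v)) has_real_derivative h' x) (at 0)"
  shows "integral\<^sup>L lborel h' = 0"
proof -
  have "bounded (h' ` K)"
    using compact_imp_bounded[OF compact_continuous_image[OF continuous_on_subset[OF ch'] K]] by auto
  then obtain M0 where "\<forall>y\<in>h' ` K. norm y \<le> M0" using bounded_iff by blast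
  \<comment> \<open>The absolute value matters off K, where 0 has to be bounded: if K is empty, M0
    may be negative.\<close>
  then have M: "\<bar>h' x\<bar> \<le> \<bar>M0\<bar>" for x using h'0 by (cases "x \<in> K") force+
  have der': "((\<lambda>\<tau>. h (x + \<tau> *\<^sub>R v)) has_real_derivative h' (x + t *\<^sub>R v)) (at t)" for x t
  proof -
    have "((\<lambda>\<tau>. h ((x + t *\<^sub>R v) + \<tau> *\<^sub>R v)) has_real_derivative h' (x + t *\<^sub>R v)) (at 0)" by (rule der)
    then show ?thesis using DERIV_shift[of "\<lambda>\<tau>. h (x + \<tau> *\<^sub>R v)" "h' (x + t *\<^sub>R v)" 0 t]
      by (simp add: algebra_simps scaleR_add_left add.commute)
  qed
  have lip: "\<bar>h (x + d *\<^sub>R v) - h x\<bar> \<le> \<bar>M0\<bar> * d" if "d \<ge> 0" for x d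
    using field_differentiable_bound[of "{0..d}" "\<lambda>\<tau>. h (x + \<tau> *\<^sub>R v)" "\<lambda>\<tau>. h' (x + \<tau> *\<^sub>R v)" "\<bar>M0\<bar>" d 0]
      that M has_field_derivative_at_within[OF der'] by auto
  define D where "D n x = (h (inverse (Suc n) *\<^sub>R v + x) - h x) * real (Suc n)" for n x
  obtain R where R: "K \<subseteq> cball 0 R" "R > 0"
    using compact_imp_bounded[OF K] by (metis bounded_pos mem_cball_0 subsetI)
  \<comment> \<open>The shifts have length at most \<open>norm v\<close>, so outside this ball both
    terms of the quotient vanish.\<close>
  define w where "w x = \<bar>M0\<bar> * indicator (cball (0::'a) (R + norm v)) x" for x
  have cD: "continuous_on UNIV (D n)" for n
    unfolding D_def
    by (intro continuous_intros continuous_on_compose2[OF ch]) auto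
  have int_h: "integrable lborel h"
    by (rule integrable_continuous_compact_support[OF ch compact_imp_bounded[OF K] h0])
  have mh: "h \<in> borel_measurable borel" "h' \<in> borel_measurable borel"
    using ch ch' borel_measurable_continuous_onI by auto
  have int_h2: "integrable lborel (\<lambda>x. h (c + x))" for c
    by (rule integrable_continuous_compact_support[where K="(\<lambda>x. x - c) ` K"])
       (auto intro!: continuous_intros continuous_on_compose2[OF ch] compact_imp_bounded
          compact_translation_subtract K h0 simp: image_iff algebra_simps)
  have I0: "integral\<^sup>L lborel (D n) = 0" for n
    unfolding D_def using int_h int_h2 lborel_integral_translate[OF mh(1)] by simp
  have "(\<lambda>n. integral\<^sup>L lborel (D n)) \<longlonglongrightarrow> integral\<^sup>L lborel h'"
  proof (rule integral_dominated_convergence[where w=w])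
    show "D n \<in> borel_measurable lborel" for n
      using cD borel_measurable_continuous_onI by auto
    show "integrable lborel w"
      unfolding w_def by (auto intro!: integrable_mult_right integrable_real_indicator emeasure_bounded_finite)
    have "(\<lambda>n. D n x) \<longlonglongrightarrow> h' x" for x
    proof -
      have "((\<lambda>\<tau>. (h (x + \<tau> *\<^sub>R v) - h x) / \<tau>) \<longlongrightarrow> h' x) (at 0)"
        using der[of x] unfolding has_field_derivative_iff by simp
      moreover have "filterlim (\<lambda>n. inverse (real (Suc n))) (at 0) sequentially"
        unfolding filterlim_at using LIMSEQ_inverse_real_of_nat by auto
      ultimately have "((\<lambda>n. (h (x + inverse (real (Suc n)) *\<^sub>R v) - h x) / inverse (real (Suc n)))
          \<longlonglongrightarrow> h' x)" by (rule filterlim_compose)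
      then show ?thesis unfolding D_def by (simp add: divide_inverse add.commute)
    qed
    then show "AE x in lborel. (\<lambda>n. D n x) \<longlonglongrightarrow> h' x" by simp
    have "norm (D n x) \<le> w x" for n x
    proof (cases "x \<in> cball 0 (R + norm v)")
      case True
      have "norm (D n x) = \<bar>h (x + inverse (Suc n) *\<^sub>R v) - h x\<bar> * real (Suc n)"
        unfolding D_def by (simp add: abs_mult add.commute)
      also have "\<dots> \<le> (\<bar>M0\<bar> * inverse (Suc n)) * real (Suc n)"
        by (intro mult_right_mono lip) auto
      also have "\<dots> = \<bar>M0\<bar>" by simp
      finally show ?thesis using True by (simp add: w_def)
    next
      case False
      have "norm x > R + norm v" using False by simp
      moreover have "norm x \<le> norm (inverse (Suc n) *\<^sub>R v + x) + norm v"
      proof -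
        have "norm x \<le> norm (inverse (Suc n) *\<^sub>R v + x) + norm (inverse (Suc n) *\<^sub>R v)"
          using norm_triangle_ineq4[of "inverse (Suc n) *\<^sub>R v + x" "inverse (Suc n) *\<^sub>R v"] by simp
        also have "norm (inverse (Suc n) *\<^sub>R v) \<le> norm v"
          using mult_right_mono[of "inverse (real (Suc n))" 1 "norm v"] by (simp add: field_simps)
        finally show ?thesis by simp
      qed
      ultimately have "norm (inverse (Suc n) *\<^sub>R v + x) > R" "norm x > R" 
        using norm_ge_zero[of v] by linarith+
      then have "inverse (Suc n) *\<^sub>R v + x \<notin> K" "x \<notin> K" using R by (meson mem_cball_0 not_le subsetD)+
      then show ?thesis using h0 by (simp add: D_def w_def)
    qed
    then show "AE x in lborel. norm (D n x) \<le> w x" for n by simp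
  qed (use mh in auto)
  then show ?thesis using I0 LIMSEQ_const_iff by (simp add: LIMSEQ_const_iff)
qed

section \<open>Test functions and weak derivatives of functions of one coordinate\<close>

lemma test_fun_continuous: "test_fun \<Omega> \<phi> \<Longrightarrow> continuous_on UNIV \<phi>"
  unfolding test_fun_def smooth_on_def using Ck_on_continuous by blast

lemma test_fun_has_partial:
  assumes "test_fun \<Omega> \<phi>"
  shows "((\<lambda>\<tau>. \<phi> (x + \<tau> *\<^sub>R axis i 1)) has_real_derivative partial i \<phi> x) (at 0)"
proof (rule differentiable_imp_has_partial)
  have "Ck_on (Suc 0) UNIV \<phi>" using assms unfolding test_fun_def smooth_on_def by blast
  then show "\<phi> differentiable at x" by (simp add: differentiable_on_def)
qed

lemma partial_eq_0_outside_support: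
  assumes "x \<notin> closure {x. \<phi> x \<noteq> 0}"
  shows "partial i \<phi> x = 0"
proof -
  have "partial i \<phi> x = partial i (\<lambda>_. 0) x"
  proof (rule partial_cong_open[of "- closure {x. \<phi> x \<noteq> 0}"])
    show "\<phi> y = 0" if "y \<in> - closure {x. \<phi> x \<noteq> 0}" for y
      using that closure_subset[of "{x. \<phi> x \<noteq> 0}"] by auto
  qed (use assms in auto)
  then show ?thesis by (simp add: partial_def)
qed

lemma test_fun_partial:
  assumes "test_fun \<Omega> \<phi>"
  shows "test_fun \<Omega> (partial i \<phi>)"
proof -
  let ?K = "closure {x. \<phi> x \<noteq> 0}"
  have "{x. partial i \<phi> x \<noteq> 0} \<subseteq> ?K" using partial_eq_0_outside_support by blast
  then have *: "closure {x. partial i \<phi> x \<noteq> 0} \<subseteq> ?K" by (simp add: closure_minimal)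
  then have "compact (closure {x. partial i \<phi> x \<noteq> 0})"
    using assms unfolding test_fun_def by (metis closed_Int_compact closed_closure inf.absorb1)
  moreover have "Ck_on k UNIV (partial i \<phi>)" for k
  proof -
    have "Ck_on (Suc k) UNIV \<phi>" using assms unfolding test_fun_def smooth_on_def by blast
    then show ?thesis by simp
  qed
  ultimately show ?thesis using assms * unfolding test_fun_def smooth_on_def by blast
qed

lemma test_fun_funpow: "test_fun \<Omega> \<phi> \<Longrightarrow> test_fun \<Omega> ((partial i ^^ n) \<phi>)"
  by (induction n) (auto intro: test_fun_partial)

text \<open>The zero extension is continuous on \<open>\<Omega>\<close> and on the complement of the
  support of \<open>\<phi>\<close>, two open sets that cover the space.\<close>

lemma continuous_on_times_test_fun:
  assumes "open \<Omega>" "continuous_on \<Omega> f" "test_fun \<Omega> \<phi>"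
  shows "continuous_on UNIV (\<lambda>x. if x \<in> \<Omega> then f x * \<phi> x else 0)"
proof -
  let ?K = "closure {x. \<phi> x \<noteq> 0}" and ?F = "\<lambda>x. if x \<in> \<Omega> then f x * \<phi> x else 0"
  have "continuous_on \<Omega> (\<lambda>x. f x * \<phi> x)"
    using assms(2) test_fun_continuous[OF assms(3)] by (intro continuous_on_mult) (auto intro: continuous_on_subset)
  then have "continuous_on \<Omega> ?F" by (rule continuous_on_eq) auto
  moreover have "continuous_on (- ?K) ?F"
  proof (rule continuous_on_eq[OF continuous_on_const])
    show "0 = ?F x" if "x \<in> - ?K" for x using that closure_subset[of "{x. \<phi> x \<noteq> 0}"] by auto
  qed
  moreover have "\<Omega> \<union> - ?K = UNIV" using assms(3) unfolding test_fun_def by auto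
  ultimately show ?thesis using continuous_on_open_Un[of \<Omega> "- ?K" ?F] assms(1) by auto
qed

lemma times_test_fun_integrable:
  assumes "open \<Omega>" "continuous_on \<Omega> f" "test_fun \<Omega> \<phi>"
  shows "integrable (lebesgue_on \<Omega>) (\<lambda>x. f x * \<phi> x)"
    and "(LINT x|lebesgue_on \<Omega>. f x * \<phi> x) = (LINT x|lborel. (if x \<in> \<Omega> then f x * \<phi> x else 0))"
proof -
  let ?F = "\<lambda>x. if x \<in> \<Omega> then f x * \<phi> x else 0"
  have c: "continuous_on UNIV ?F" by (rule continuous_on_times_test_fun[OF assms])
  have "integrable lborel ?F"
  proof (rule integrable_continuous_compact_support[OF c])
    show "bounded (closure {x. \<phi> x \<noteq> 0})"
      using assms(3) unfolding test_fun_def by (auto intro: compact_imp_bounded)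
    show "?F x = 0" if "x \<notin> closure {x. \<phi> x \<noteq> 0}" for x
      using that closure_subset[of "{x. \<phi> x \<noteq> 0}"] by auto
  qed
  moreover have m: "?F \<in> borel_measurable lborel" using borel_measurable_continuous_onI[OF c] by simp
  ultimately have "integrable lebesgue ?F" by (simp add: integrable_completion)
  then show "integrable (lebesgue_on \<Omega>) (\<lambda>x. f x * \<phi> x)"
  proof (subst integrable_restrict_space)
    have "(\<lambda>x. indicat_real \<Omega> x *\<^sub>R (f x * \<phi> x)) = ?F" by (auto simp: indicator_def fun_eq_iff)
    then show "integrable lebesgue ?F \<Longrightarrow> integrable lebesgue (\<lambda>x. indicat_real \<Omega> x *\<^sub>R (f x * \<phi> x))"
      by (simp only:)
  qed (use assms(1) in auto)
  show "(LINT x|lebesgue_on \<Omega>. f x * \<phi> x) = integral\<^sup>L lborel ?F"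
    using Lebesgue_Measure.integral_restrict_UNIV[of \<Omega> "\<lambda>x. f x * \<phi> x"] integral_completion[OF m] assms(1) by auto
qed

text \<open>The zero extension of \<open>f * \<phi>\<close> is continuous with compact support and
  has a continuous derivative in direction i everywhere, whose integral vanishes. There is no
  boundary term, and only differentiability of f along axis i is used.\<close>

lemma integral_by_parts_test_fun:
  assumes op: "open \<Omega>" and cf: "continuous_on \<Omega> f" and cf': "continuous_on \<Omega> f'"
    and der: "\<And>x. x \<in> \<Omega> \<Longrightarrow> ((\<lambda>\<tau>. f (x + \<tau> *\<^sub>R axis i 1)) has_real_derivative f' x) (at 0)"
    and \<phi>: "test_fun \<Omega> \<phi>"
  shows "(LINT x|lebesgue_on \<Omega>. f x * partial i \<phi> x) = - (LINT x|lebesgue_on \<Omega>. f' x * \<phi> x)"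
proof -
  define K where "K = closure {x. \<phi> x \<noteq> 0}"
  define F where "F x = (if x \<in> \<Omega> then f x * \<phi> x else 0)" for x
  define G1 where "G1 x = (if x \<in> \<Omega> then f' x * \<phi> x else 0)" for x
  define G2 where "G2 x = (if x \<in> \<Omega> then f x * partial i \<phi> x else 0)" for x
  have K0: "\<phi> x = 0" if "x \<notin> K" for x using that closure_subset[of "{x. \<phi> x \<noteq> 0}"] by (auto simp: K_def)
  have K\<Omega>: "K \<subseteq> \<Omega>" "compact K" using \<phi> unfolding test_fun_def K_def by auto
  have p0: "partial i \<phi> x = 0" if "x \<notin> K" for x
    by (rule partial_eq_0_outside_support[OF that[unfolded K_def]])
  have c: "continuous_on UNIV F" "continuous_on UNIV G1" "continuous_on UNIV G2"
    unfolding F_def[abs_def] G1_def[abs_def] G2_def[abs_def]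
    using continuous_on_times_test_fun[OF op] cf cf' \<phi> test_fun_partial[OF \<phi>] by blast+
  have int: "integrable lborel G1" "integrable lborel G2"
    by (rule integrable_continuous_compact_support[OF c(2) compact_imp_bounded[OF K\<Omega>(2)]],
        use K0 in \<open>simp add: G1_def\<close>,
        rule integrable_continuous_compact_support[OF c(3) compact_imp_bounded[OF K\<Omega>(2)]],
        use p0 in \<open>simp add: G2_def\<close>)
  have "integral\<^sup>L lborel (\<lambda>x. G1 x + G2 x) = 0"
  proof (rule integral_directional_derivative_eq_0[OF c(1) continuous_on_add[OF c(2,3)] K\<Omega>(2)])
    show "((\<lambda>\<tau>. F (x + \<tau> *\<^sub>R axis i 1)) has_real_derivative G1 x + G2 x) (at 0)" for x
    proof (cases "x \<in> \<Omega>")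
      case True
      have "((\<lambda>\<tau>. f (x + \<tau> *\<^sub>R axis i 1) * \<phi> (x + \<tau> *\<^sub>R axis i 1)) has_real_derivative
          f' x * \<phi> (x + 0 *\<^sub>R axis i 1) + partial i \<phi> x * f (x + 0 *\<^sub>R axis i 1)) (at 0)"
        by (rule DERIV_mult[OF der[OF True] test_fun_has_partial[OF \<phi>]])
      then have "((\<lambda>\<tau>. f (x + \<tau> *\<^sub>R axis i 1) * \<phi> (x + \<tau> *\<^sub>R axis i 1)) has_real_derivative G1 x + G2 x) (at 0)"
        using True by (simp add: G1_def G2_def mult.commute)
      then show ?thesis
      proof (rule DERIV_cong_ev[THEN iffD1, rotated -1])
        show "\<forall>\<^sub>F \<tau> in nhds 0. f (x + \<tau> *\<^sub>R axis i 1) * \<phi> (x + \<tau> *\<^sub>R axis i 1) = F (x + \<tau> *\<^sub>R axis i 1)"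
          using eventually_line_in_open[OF op True, of i] by eventually_elim (simp add: F_def)
      qed auto
    next
      case False
      then have x: "x \<in> - K" using K\<Omega> by auto
      have "((\<lambda>\<tau>. 0) has_real_derivative G1 x + G2 x) (at 0)"
        using False by (simp add: G1_def G2_def)
      then show ?thesis
      proof (rule DERIV_cong_ev[THEN iffD1, rotated -1])
        show "\<forall>\<^sub>F \<tau> in nhds 0. 0 = F (x + \<tau> *\<^sub>R axis i 1)"
          using eventually_line_in_open[OF open_Compl[OF compact_imp_closed[OF K\<Omega>(2)]] x, of i]
          by eventually_elim (use K0 in \<open>simp add: F_def\<close>)
      qed auto
    qed
  qed (use K0 p0 in \<open>auto simp: F_def G1_def G2_def\<close>)
  then have "integral\<^sup>L lborel G2 = - integral\<^sup>L lborel G1" using int by simp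
  then show ?thesis
    using times_test_fun_integrable(2)[OF op cf test_fun_partial[OF \<phi>, of i]]
      times_test_fun_integrable(2)[OF op cf' \<phi>] by (simp add: G1_def[abs_def] G2_def[abs_def])
qed

lemma integrable_lebesgue_on_compact:
  assumes "compact K" "continuous_on K (f::real^3 \<Rightarrow> real)"
  shows "integrable (lebesgue_on K) f"
proof -
  have K: "K \<in> lmeasurable" using assms(1) by (rule lmeasurable_compact)
  then have m: "f \<in> borel_measurable (lebesgue_on K)"
    using assms(2) by (intro continuous_imp_measurable_on_sets_lebesgue) auto
  obtain M where "\<forall>y\<in>f ` K. norm y \<le> M"
    using compact_imp_bounded[OF compact_continuous_image[OF assms(2,1)]] bounded_iff by blast
  then have "AE x in lebesgue_on K. norm (f x) \<le> M" by (intro AE_I2) auto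
  then show ?thesis
    using m finite_measure.integrable_const_bound[OF finite_measure_lebesgue_on[OF K], of f M] by blast
qed

lemma integral_x1_by_parts:
  assumes op: "open \<Omega>" and J: "\<And>x. x \<in> \<Omega> \<Longrightarrow> x$1 \<in> J"
    and der: "\<And>j s. j < k \<Longrightarrow> s \<in> J \<Longrightarrow> (h j has_real_derivative h (Suc j) s) (at s)"
    and cont: "\<And>j. j \<le> k \<Longrightarrow> continuous_on J (h j)"
    and \<phi>: "test_fun \<Omega> \<phi>" and n: "j + n \<le> k"
  shows "(LINT x|lebesgue_on \<Omega>. h j (x$1) * (partial 1 ^^ n) \<phi> x) =
     (-1)^n * (LINT x|lebesgue_on \<Omega>. h (j + n) (x$1) * \<phi> x)"
  using n
proof (induction n arbitrary: j)
  case (Suc n)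
  have c: "continuous_on \<Omega> (\<lambda>x. h j (x$1))" if "j \<le> k" for j
    using J that by (intro continuous_on_compose2[OF cont] continuous_intros) auto
  have "(LINT x|lebesgue_on \<Omega>. h j (x$1) * partial 1 ((partial 1 ^^ n) \<phi>) x) =
      - (LINT x|lebesgue_on \<Omega>. h (Suc j) (x$1) * (partial 1 ^^ n) \<phi> x)"
  proof (rule integral_by_parts_test_fun[OF op c c _ test_fun_funpow[OF \<phi>]])
    fix x assume x: "x \<in> \<Omega>"
    have "(h j has_real_derivative h (Suc j) (x$1)) (at (x$1))" using der J[OF x] Suc.prems by auto
    then have "((\<lambda>\<tau>. h j (x$1 + \<tau>)) has_real_derivative h (Suc j) (x$1)) (at 0)"
      using DERIV_shift[of "h j" "h (Suc j) (x$1)" 0 "x$1"] by (simp add: add.commute)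
    then show "((\<lambda>\<tau>. h j ((x + \<tau> *\<^sub>R axis 1 1)$1)) has_real_derivative h (Suc j) (x$1)) (at 0)" by simp
  qed (use Suc.prems in auto)
  then show ?case using Suc.IH[of "Suc j"] Suc.prems by simp
qed simp

lemma integral_x1_transverse:
  assumes op: "open \<Omega>" and c: "continuous_on \<Omega> (\<lambda>x. h (x$1))"
    and \<phi>: "test_fun \<Omega> \<phi>" and i: "i \<noteq> 1"
  shows "(LINT x|lebesgue_on \<Omega>. h (x$1) * partial i \<phi> x) = 0"
proof -
  have "(LINT x|lebesgue_on \<Omega>. h (x$1) * partial i \<phi> x) = - (LINT x|lebesgue_on \<Omega>. 0 * \<phi> x)"
    by (rule integral_by_parts_test_fun[OF op c _ _ \<phi>]) (use i in \<open>auto simp: axis_def\<close>)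
  then show ?thesis by simp
qed

text \<open>In \<open>multi_deriv\<close> the x1-derivatives are outermost, so they are moved onto h
  first. A remaining transverse derivative of the test function then integrates to 0 against a
  function of x1.\<close>

lemma weak_deriv_x1:
  assumes op: "open \<Omega>" and J: "\<And>x. x \<in> \<Omega> \<Longrightarrow> x$1 \<in> J"
    and der: "\<And>j s. j < k \<Longrightarrow> s \<in> J \<Longrightarrow> (h j has_real_derivative h (Suc j) s) (at s)"
    and cont: "\<And>j. j \<le> k \<Longrightarrow> continuous_on J (h j)"
    and f: "\<And>x. x \<in> \<Omega> \<Longrightarrow> f x = h 0 (x$1)"
    and a: "multi_order a \<le> k"
  shows "weak_deriv \<Omega> a f (\<lambda>x. if a 2 = 0 \<and> a 3 = 0 then h (a 1) (x$1) else 0)"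
proof -
  have mo: "multi_order a = a 1 + a 2 + a 3" by (simp add: multi_order_def sum_3)
  have c: "continuous_on \<Omega> (\<lambda>x. h j (x$1))" if "j \<le> k" for j
    using J that by (intro continuous_on_compose2[OF cont] continuous_intros) auto
  have li: "locally_integrable \<Omega> f'" if "\<And>x. x \<in> \<Omega> \<Longrightarrow> f' x = h j (x$1)" "j \<le> k" for f' j
    unfolding locally_integrable_def
  proof (intro allI impI, elim conjE)
    fix K assume K: "compact K" "K \<subseteq> \<Omega>"
    have "continuous_on K f'"
      by (rule continuous_on_eq[OF continuous_on_subset[OF c[OF that(2)] K(2)]]) (use that K in auto)
    then show "integrable (lebesgue_on K) f'" using integrable_lebesgue_on_compact K by blast
  qed
  have "(LINT x|lebesgue_on \<Omega>. f x * multi_deriv a \<phi> x) = (-1) ^ multi_order a *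
      (LINT x|lebesgue_on \<Omega>. (if a 2 = 0 \<and> a 3 = 0 then h (a 1) (x$1) else 0) * \<phi> x)"
    if \<phi>: "test_fun \<Omega> \<phi>" for \<phi>
  proof -
    let ?\<psi> = "(partial 2 ^^ a 2) ((partial 3 ^^ a 3) \<phi>)"
    have t: "test_fun \<Omega> ?\<psi>" by (intro test_fun_funpow \<phi>)
    have "(LINT x|lebesgue_on \<Omega>. f x * multi_deriv a \<phi> x) =
        (LINT x|lebesgue_on \<Omega>. h 0 (x$1) * (partial 1 ^^ a 1) ?\<psi> x)"
      unfolding multi_deriv_def by (rule Bochner_Integration.integral_cong) (auto simp: f)
    also have "\<dots> = (-1) ^ a 1 * (LINT x|lebesgue_on \<Omega>. h (a 1) (x$1) * ?\<psi> x)"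
      using integral_x1_by_parts[where h=h and k=k and j=0 and n="a 1", OF op J der cont t] a mo by simp
    also have "\<dots> = (-1) ^ multi_order a *
      (LINT x|lebesgue_on \<Omega>. (if a 2 = 0 \<and> a 3 = 0 then h (a 1) (x$1) else 0) * \<phi> x)"
    proof (cases "a 2 = 0")
      case True
      show ?thesis
      proof (cases "a 3")
        case 0
        then show ?thesis using True mo by simp
      next
        case (Suc n)
        then show ?thesis
          using True integral_x1_transverse[OF op c[of "a 1"] test_fun_funpow[OF \<phi>, of n 3], of 3] a mo by simp
      qed
    next
      case False
      then obtain n where n: "a 2 = Suc n" using not0_implies_Suc by blast
      then show ?thesis
        using integral_x1_transverse[OF op c[of "a 1"] test_fun_funpow[OF test_fun_funpow[OF \<phi>, of "a 3" 3], of n 2], of 2] a mo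
        by simp
    qed
    finally show ?thesis .
  qed
  moreover have "locally_integrable \<Omega> f" using li[of f 0] f by simp
  moreover have "locally_integrable \<Omega> (\<lambda>x. if a 2 = 0 \<and> a 3 = 0 then h (a 1) (x$1) else 0)"
  proof (cases "a 2 = 0 \<and> a 3 = 0")
    case True
    then show ?thesis using li[of "\<lambda>x. h (a 1) (x$1)" "a 1"] a mo by simp
  next
    case False
    then have "(\<lambda>x::real^3. if a 2 = 0 \<and> a 3 = 0 then h (a 1) (x$1) else 0) = (\<lambda>x. 0)" by auto
    moreover have "locally_integrable \<Omega> (\<lambda>x. 0)" by (simp add: locally_integrable_def)
    ultimately show ?thesis by (simp only:)
  qed
  ultimately show ?thesis unfolding weak_deriv_def by blast
qed

section \<open>Bump functions supported in boxes\<close>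

text \<open>The case n = 0 is the standard function that is flat at 0. The powers are included
  because the family has to be closed under differentiation, which makes smoothness an induction
  with n arbitrary.\<close>

definition flat_exp :: "nat \<Rightarrow> real \<Rightarrow> real" where
  "flat_exp n x = (if x > 0 then (1 / x) ^ n * exp (- (1 / x)) else 0)"

lemma der_flat_exp:
  "(flat_exp n has_real_derivative flat_exp (n + 2) x - real n * flat_exp (n + 1) x) (at x)"
proof -
  consider "x > 0" | "x < 0" | "x = 0" by linarith
  then show ?thesis
  proof cases
    case 1
    have "((\<lambda>x. (1 / x) ^ n * exp (- (1 / x))) has_real_derivative
        flat_exp (n + 2) x - real n * flat_exp (n + 1) x) (at x)"
    proof -
      have i: "((\<lambda>x. 1 / x) has_real_derivative - ((1 / x)\<^sup>2)) (at x)"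
        using 1 by (auto intro!: derivative_eq_intros simp: power2_eq_square)
      have "((\<lambda>x. exp (- (1 / x))) has_real_derivative exp (- (1 / x)) * ((1 / x)\<^sup>2)) (at x)"
        using DERIV_fun_exp[OF DERIV_minus[OF i]] by simp
      then have "((\<lambda>x. (1 / x) ^ n * exp (- (1 / x))) has_real_derivative
          (real n * (1 / x) ^ (n - 1) * - ((1 / x)\<^sup>2)) * exp (- (1 / x))
            + exp (- (1 / x)) * ((1 / x)\<^sup>2) * (1 / x) ^ n) (at x)"
        by (rule DERIV_cong[OF DERIV_mult[OF DERIV_power[OF i, of n]]]) (simp add: mult_ac)
      moreover have "(real n * (1 / x) ^ (n - 1) * - ((1 / x)\<^sup>2)) * exp (- (1 / x))
            + exp (- (1 / x)) * ((1 / x)\<^sup>2) * (1 / x) ^ n = flat_exp (n + 2) x - real n * flat_exp (n + 1) x"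
        using 1 by (cases n) (simp_all add: flat_exp_def power_add power2_eq_square algebra_simps add_divide_distrib)
      ultimately show ?thesis by (simp only:)
    qed
    then show ?thesis
      by (rule has_field_derivative_transform_within_open[where S="{0<..}"])
         (use 1 in \<open>auto simp: flat_exp_def\<close>)
  next
    case 2
    then have "((\<lambda>_. 0) has_real_derivative flat_exp (n + 2) x - real n * flat_exp (n + 1) x) (at x)"
      by (simp add: flat_exp_def)
    then show ?thesis
      by (rule has_field_derivative_transform_within_open[where S="{..<0}"])
         (use 2 in \<open>auto simp: flat_exp_def\<close>)
  next
    case 3
    have "((\<lambda>y. flat_exp n y / y) \<longlongrightarrow> 0) (at_left 0)"
      by (rule tendsto_eventually) (auto simp: eventually_at_filter flat_exp_def)
    moreover have "((\<lambda>y. flat_exp n y / y) \<longlongrightarrow> 0) (at_right 0)"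
    proof -
      have "((\<lambda>y. (inverse y) ^ (n + 1) / exp (inverse y)) \<longlongrightarrow> (0::real)) (at_right 0)"
        by (rule filterlim_compose[OF tendsto_power_div_exp_0 filterlim_inverse_at_top_right])
      then show ?thesis
        by (rule Lim_transform_eventually)
           (auto simp: eventually_at_filter flat_exp_def exp_minus field_simps)
    qed
    ultimately have "((\<lambda>y. flat_exp n y / y) \<longlongrightarrow> 0) (at 0)"
      by (simp add: filterlim_split_at)
    then show ?thesis using 3 by (simp add: has_field_derivative_iff flat_exp_def)
  qed
qed

lemma smooth_flat_exp: "Ck_real k UNIV (flat_exp n)"
proof (induction k arbitrary: n)
  case 0
  then show ?case
    using der_flat_exp DERIV_isCont by (simp add: continuous_on_eq_continuous_at) blast
next
  case (Suc k)
  show ?case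
    by (rule Ck_real_SucI[OF der_flat_exp], intro Ck_real_diff Ck_real_mult Ck_real_const Suc.IH)
qed

lemma flat_exp_bounds: "0 \<le> flat_exp 0 x" "flat_exp 0 x \<le> 1"
  by (auto simp: flat_exp_def)

lemma flat_exp_ge: "x \<ge> 1 / 4 \<Longrightarrow> exp (- 4) \<le> flat_exp 0 x"
  by (auto simp: flat_exp_def divide_le_eq)

text \<open>A bump on the box with corner a and side lengths d. It has no plateau; a positive lower
  bound on the concentric box of half the size, independent of a and d, is all that is
  required.\<close>

definition box_bump :: "real^3 \<Rightarrow> real^3 \<Rightarrow> real^3 \<Rightarrow> real" where
  "box_bump a d x = (\<Prod>i\<in>UNIV. flat_exp 0 ((x$i - a$i) / d$i) * flat_exp 0 ((a$i + d$i - x$i) / d$i))"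

lemma Ck_on_const: "Ck_on k S (\<lambda>x::real^'n::finite. c)"
proof (induction k arbitrary: c)
  case (Suc k)
  have "partial i (\<lambda>x::real^'n. c) = (\<lambda>x. 0)" for i by (simp add: partial_def fun_eq_iff)
  then show ?case using Suc by simp
qed simp

lemma Ck_on_prod:
  assumes "open S" "finite F" "\<And>i. i \<in> F \<Longrightarrow> Ck_on k S (f i)"
  shows "Ck_on k S (\<lambda>x. \<Prod>i\<in>F. f i x)"
  using assms(2,3)
  by (induction F rule: finite_induct) (auto intro: Ck_on_const Ck_on_mult[OF assms(1)])

lemma box_bump_smooth: "smooth_on UNIV (box_bump a d)"
  unfolding smooth_on_def box_bump_def[abs_def]
proof (intro allI Ck_on_prod Ck_on_mult open_UNIV finite)
  fix k and i :: 3
  have "Ck_on k UNIV (\<lambda>x::real^3. flat_exp 0 (c + v \<bullet> x))" for c v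
    by (rule Ck_on_affine_comp[OF smooth_flat_exp]) auto
  from this[of "- a$i / d$i" "axis i (1 / d$i)"] this[of "(a$i + d$i) / d$i" "axis i (- 1 / d$i)"]
  show "Ck_on k UNIV (\<lambda>x. flat_exp 0 ((x$i - a$i) / d$i))"
    "Ck_on k UNIV (\<lambda>x. flat_exp 0 ((a$i + d$i - x$i) / d$i))"
    by (simp_all add: inner_axis' diff_divide_distrib add.commute)
qed

lemma box_bump_bounds: "0 \<le> box_bump a d x" "box_bump a d x \<le> 1"
  unfolding box_bump_def using flat_exp_bounds
  by (auto intro!: prod_nonneg prod_le_1 mult_nonneg_nonneg mult_le_one)

lemma box_bump_support:
  assumes "\<And>i. d$i > 0" "box_bump a d x \<noteq> 0"
  shows "a$i < x$i \<and> x$i < a$i + d$i"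
proof -
  have "flat_exp 0 ((x$i - a$i) / d$i) \<noteq> 0" "flat_exp 0 ((a$i + d$i - x$i) / d$i) \<noteq> 0"
    using assms(2) unfolding box_bump_def by auto
  then show ?thesis using assms(1)[of i] by (auto simp: flat_exp_def zero_less_divide_iff split: if_splits)
qed

text \<open>On the middle half every one of the six factors has an argument of at least 1/4, hence
  is at least \<open>exp (- 4)\<close>.\<close>

lemma box_bump_ge:
  assumes "\<And>i. d$i > 0" "\<And>i. a$i + d$i / 4 \<le> x$i \<and> x$i \<le> a$i + 3 * d$i / 4"
  shows "exp (- 24) \<le> box_bump a d x"
proof -
  have "exp (- 8) \<le> flat_exp 0 ((x$i - a$i) / d$i) * flat_exp 0 ((a$i + d$i - x$i) / d$i)" for i
  proof -
    have "exp (- 4) * exp (- 4) \<le> flat_exp 0 ((x$i - a$i) / d$i) * flat_exp 0 ((a$i + d$i - x$i) / d$i)"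
      using assms(1)[of i] assms(2)[of i]
      by (intro mult_mono flat_exp_ge flat_exp_bounds) (auto simp: field_simps)
    then show ?thesis by (simp flip: exp_add)
  qed
  then have "(\<Prod>i\<in>(UNIV::3 set). exp (- 8 :: real)) \<le> box_bump a d x"
    unfolding box_bump_def by (intro prod_mono) auto
  moreover have "(\<Prod>i\<in>(UNIV::3 set). exp (- 8 :: real)) = exp (- 24)"
    by (simp flip: exp_of_nat_mult)
  ultimately show ?thesis by simp
qed

lemma box_bump_test_fun:
  assumes d: "\<And>i. d$i > 0" and sub: "cbox a (a + d) \<subseteq> \<Omega>"
  shows "test_fun \<Omega> (box_bump a d)"
proof -
  have "{x. box_bump a d x \<noteq> 0} \<subseteq> cbox a (a + d)"
    using box_bump_support[OF d] by (force simp: mem_box_cart less_imp_le)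
  then have c: "closure {x. box_bump a d x \<noteq> 0} \<subseteq> cbox a (a + d)"
    by (simp add: closure_minimal closed_cbox)
  then have "compact (closure {x. box_bump a d x \<noteq> 0})"
    using compact_Int_closed[OF compact_cbox closed_closure] by (metis inf.absorb2)
  then show ?thesis unfolding test_fun_def using c sub box_bump_smooth by blast
qed

lemma measure_cbox_3:
  assumes "\<And>i. 0 \<le> (d::real^3)$i"
  shows "measure lborel (cbox a (a + d)) = d$1 * d$2 * d$3"
proof -
  have "cbox a (a + d) \<noteq> {}" using assms by (auto simp: box_ne_empty inner_axis Basis_vec_def)
  then have "measure lborel (cbox a (a + d)) = (\<Prod>i\<in>UNIV. d$i)"
    by (subst content_cbox_cart) simp_all
  also have "\<dots> = d$1 * d$2 * d$3" unfolding UNIV_3 by (simp add: mult.assoc)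
  finally show ?thesis .
qed

lemma box_bump_integral:
  assumes d: "\<And>i. d$i > 0" and sub: "cbox a (a + d) \<subseteq> \<Omega>" and op: "open \<Omega>"
  shows "integrable (lebesgue_on \<Omega>) (box_bump a d)"
    and "exp (- 24) / 8 * (d$1 * d$2 * d$3) \<le> (LINT x|lebesgue_on \<Omega>. box_bump a d x)"
    and "integrable (lebesgue_on \<Omega>) (\<lambda>x. (box_bump a d x)\<^sup>2)"
    and "(LINT x|lebesgue_on \<Omega>. (box_bump a d x)\<^sup>2) \<le> d$1 * d$2 * d$3"
proof -
  let ?\<phi> = "box_bump a d"
  have t: "test_fun \<Omega> ?\<phi>" by (rule box_bump_test_fun[OF d sub])
  have c: "continuous_on \<Omega> ?\<phi>" using test_fun_continuous[OF t] continuous_on_subset by blast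
  show i1: "integrable (lebesgue_on \<Omega>) ?\<phi>"
    using times_test_fun_integrable(1)[OF op _ t, of "\<lambda>_. 1"] by simp
  show i2: "integrable (lebesgue_on \<Omega>) (\<lambda>x. (?\<phi> x)\<^sup>2)"
    using times_test_fun_integrable(1)[OF op c t] by (simp add: power2_eq_square)
  have \<Omega>: "\<Omega> \<in> sets lebesgue" using op by auto
  have ind: "integrable (lebesgue_on \<Omega>) (\<lambda>x. indicator (cbox u v) x :: real)"
      "(LINT x|lebesgue_on \<Omega>. indicator (cbox u v) x) = measure lborel (cbox u v)"
    if uv: "cbox u v \<subseteq> \<Omega>" for u v
  proof -
    have eq: "(\<lambda>x. indicat_real \<Omega> x *\<^sub>R indicat_real (cbox u v) x) = indicat_real (cbox u v)"
      using uv by (auto simp: indicator_def fun_eq_iff)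
    have "integrable lebesgue (indicat_real (cbox u v))"
      using lmeasurable_cbox lmeasurable_iff_integrable by blast
    then show "integrable (lebesgue_on \<Omega>) (\<lambda>x. indicator (cbox u v) x :: real)"
      using \<Omega> eq by (subst integrable_restrict_space) auto
    show "(LINT x|lebesgue_on \<Omega>. indicator (cbox u v) x) = measure lborel (cbox u v)"
      using \<Omega> eq by (subst integral_restrict_space) auto
  qed
  \<comment> \<open>The concentric box of half the side lengths, on which the bump is at least
    \<open>exp (- 24)\<close>; its share of the volume is the factor 1/8.\<close>
  let ?a = "a + (1 / 4) *\<^sub>R d" and ?d = "(1 / 2) *\<^sub>R d"
  have sub': "cbox ?a (?a + ?d) \<subseteq> cbox a (a + d)"
  proof
    fix x assume x: "x \<in> cbox ?a (?a + ?d)"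
    have "a$i \<le> x$i \<and> x$i \<le> a$i + d$i" for i
    proof -
      have "a$i + d$i / 4 \<le> x$i" "x$i \<le> a$i + d$i / 4 + d$i / 2"
        using x unfolding mem_box_cart by (simp_all add: add_ac)
      then show ?thesis using d[of i] by linarith
    qed
    then show "x \<in> cbox a (a + d)" by (simp add: mem_box_cart)
  qed
  have "exp (- 24) * (LINT x|lebesgue_on \<Omega>. indicator (cbox ?a (?a + ?d)) x) \<le> integral\<^sup>L (lebesgue_on \<Omega>) ?\<phi>"
    unfolding integral_mult_right_zero[symmetric]
  proof (rule integral_mono)
    show "integrable (lebesgue_on \<Omega>) (\<lambda>x. exp (- 24) * indicat_real (cbox ?a (?a + ?d)) x)"
      using ind(1) sub sub' by (intro integrable_mult_right) blast
    show "exp (- 24) * indicat_real (cbox ?a (?a + ?d)) x \<le> ?\<phi> x" for x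
      using box_bump_ge[OF d, of a x] box_bump_bounds(1)[of a d x]
      by (auto simp: indicator_def mem_box_cart algebra_simps)
  qed (rule i1)
  moreover have "(LINT x|lebesgue_on \<Omega>. indicator (cbox ?a (?a + ?d)) x) = d$1 * d$2 * d$3 / 8"
  proof -
    have "(LINT x|lebesgue_on \<Omega>. indicator (cbox ?a (?a + ?d)) x) = measure lborel (cbox ?a (?a + ?d))"
      by (rule ind(2)) (use sub sub' in blast)
    also have "\<dots> = ?d$1 * ?d$2 * ?d$3"
      by (rule measure_cbox_3) (use d in \<open>simp add: less_imp_le\<close>)
    finally show ?thesis by simp
  qed
  ultimately show "exp (- 24) / 8 * (d$1 * d$2 * d$3) \<le> integral\<^sup>L (lebesgue_on \<Omega>) ?\<phi>"
    by (simp only:)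
  have "integral\<^sup>L (lebesgue_on \<Omega>) (\<lambda>x. (?\<phi> x)\<^sup>2) \<le> (LINT x|lebesgue_on \<Omega>. indicator (cbox a (a + d)) x)"
  proof (rule integral_mono[OF i2 ind(1)[OF sub]])
    fix x
    show "(?\<phi> x)\<^sup>2 \<le> indicator (cbox a (a + d)) x"
    proof (cases "?\<phi> x = 0")
      case False
      then have "x \<in> cbox a (a + d)" using box_bump_support[OF d False] by (auto simp: mem_box_cart less_imp_le)
      then show ?thesis using box_bump_bounds[of a d x] by (simp add: power_le_one)
    qed simp
  qed
  then show "(LINT x|lebesgue_on \<Omega>. (?\<phi> x)\<^sup>2) \<le> d$1 * d$2 * d$3"
    using ind(2)[OF sub] measure_cbox_3[of d a] d by (simp add: less_imp_le)
qed

section \<open>The profile of the wave\<close>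

text \<open>\<open>wgt\<close> is \<open>- L''\<close>, and \<open>qf\<close> is its logarithmic derivative up to sign. The factor \<open>(1 + s)\<^sup>-\<^sup>2\<close> makes it
  integrable at infinity, so that \<open>L'\<close> can stay positive on the whole half-line.\<close>

definition lam :: "real \<Rightarrow> real" where "lam s = 1 + ln (1 + 1 / s)"

definition wgt :: "real \<Rightarrow> real" where "wgt s = sqrt (lam s) / (1 + s)\<^sup>2"

definition qf :: "real \<Rightarrow> real" where "qf s = 2 / (1 + s) + 1 / (2 * s * (1 + s) * lam s)"

lemma lam_ge_1: "s > 0 \<Longrightarrow> lam s \<ge> 1"
  by (simp add: lam_def)

lemma der_lam: "s > 0 \<Longrightarrow> (lam has_real_derivative - (1 / (s * (1 + s)))) (at s)"
  unfolding lam_def[abs_def]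
  by (auto intro!: derivative_eq_intros simp: field_simps add_pos_pos power2_eq_square)

lemma wgt_pos: "s > 0 \<Longrightarrow> wgt s > 0"
  using lam_ge_1[of s] by (simp add: wgt_def)

lemma qf_pos: "s > 0 \<Longrightarrow> qf s > 0"
  using lam_ge_1[of s] by (simp add: qf_def add_pos_pos)

lemma sqrt_lam_le: "s > 0 \<Longrightarrow> sqrt (lam s) \<le> lam s"
  using lam_ge_1[of s] by (intro real_le_lsqrt) (auto simp: power2_eq_square)

lemma wgt_le_sqrt: "s > 0 \<Longrightarrow> wgt s \<le> sqrt (lam s)"
  using lam_ge_1[of s] unfolding wgt_def by (simp add: divide_le_eq mult_ge1_I one_le_power)

lemma wgt_le_lam: "s > 0 \<Longrightarrow> wgt s \<le> lam s / (1 + s)\<^sup>2"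
  unfolding wgt_def by (intro divide_right_mono sqrt_lam_le) auto

text \<open>The bound ln y \<le> y - 1 is applied to the square root of 1 + 1/s. This gives growth
  s^(-1/2) instead of s^(-1), enough to make s lam^2 bounded for bounded s and s lam of order sqrt s
  near 0.\<close>

lemma lam_le: "s > 0 \<Longrightarrow> lam s \<le> 1 + 2 / sqrt s"
proof -
  assume s: "s > 0"
  have "ln (1 + 1 / s) = 2 * ln (sqrt (1 + 1 / s))" using s by (simp add: ln_sqrt add_pos_pos)
  also have "\<dots> \<le> 2 * (sqrt (1 + 1 / s) - 1)"
    using s by (intro mult_left_mono ln_le_minus_one) (auto simp: add_pos_pos)
  also have "sqrt (1 + 1 / s) \<le> 1 + sqrt (1 / s)" using sqrt_add_le_add_sqrt[of 1 "1 / s"] s by simp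
  finally show ?thesis by (simp add: lam_def real_sqrt_divide)
qed

lemma der_wgt:
  assumes s: "s > 0"
  shows "(wgt has_real_derivative - qf s * wgt s) (at s)"
proof -
  have l: "lam s > 0" "sqrt (lam s) > 0" using lam_ge_1[OF s] by auto
  have ll: "sqrt (lam s) * sqrt (lam s) = lam s" using l by simp
  have "((\<lambda>s. sqrt (lam s)) has_real_derivative (- (1 / (s * (1 + s)))) * (inverse (sqrt (lam s)) / 2)) (at s)"
    using DERIV_chain2[OF DERIV_real_sqrt[OF l(1)] der_lam[OF s]] by (simp add: mult.commute)
  moreover have "((\<lambda>s. (1 + s)\<^sup>2) has_real_derivative 2 * (1 + s)) (at s)"
    by (auto intro!: derivative_eq_intros)
  ultimately have "((\<lambda>s. sqrt (lam s) / (1 + s)\<^sup>2) has_real_derivative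
     ((- (1 / (s * (1 + s)))) * (inverse (sqrt (lam s)) / 2) * (1 + s)\<^sup>2 - sqrt (lam s) * (2 * (1 + s)))
       / ((1 + s)\<^sup>2 * (1 + s)\<^sup>2)) (at s)"
    using s by (intro DERIV_divide) auto
  moreover have "((- (1 / (s * (1 + s)))) * (inverse (sqrt (lam s)) / 2) * (1 + s)\<^sup>2 - sqrt (lam s) * (2 * (1 + s)))
       / ((1 + s)\<^sup>2 * (1 + s)\<^sup>2) = - qf s * wgt s"
  proof -
    define y where "y = sqrt (lam s)"
    have y: "y > 0" "lam s = y * y" using l ll by (auto simp: y_def)
    have "((- (1 / (s * u))) * (inverse y / 2) * u\<^sup>2 - y * (2 * u)) / (u\<^sup>2 * u\<^sup>2) =
        - (2 / u + 1 / (2 * s * u * (y * y))) * (y / u\<^sup>2)" if "u > 0" for u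
      using s y(1) that by (simp add: field_simps power2_eq_square)
    from this[of "1 + s"] show ?thesis unfolding qf_def wgt_def y_def[symmetric] y(2)
      using s y(1) by (simp add: real_sqrt_mult)
  qed
  ultimately show ?thesis unfolding wgt_def[abs_def] by simp
qed

lemma Ck_real_antiderivative:
  assumes "\<And>s. s \<in> I \<Longrightarrow> (f has_real_derivative f' s) (at s)" "\<And>k. Ck_real k I f'"
  shows "Ck_real k I f"
  by (rule Ck_real_Suc_imp, rule Ck_real_SucI[OF assms])

lemma smooth_lam: "Ck_real k {0<..} lam"
  by (rule Ck_real_antiderivative[where f'="\<lambda>s. - (1 / (s * (1 + s)))"])
     (auto intro!: der_lam Ck_real_minus Ck_real_divide Ck_real_mult Ck_real_add Ck_real_ident Ck_real_const)

lemma smooth_qf: "Ck_real k {0<..} qf"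
proof -
  have "2 * s * (1 + s) * lam s \<noteq> 0" if "s \<in> {0<..}" for s
    using that lam_ge_1[of s] by (auto simp: add_pos_pos)
  then show ?thesis unfolding qf_def[abs_def]
    by (intro Ck_real_divide Ck_real_mult Ck_real_add Ck_real_ident Ck_real_const smooth_lam) auto
qed

lemma smooth_wgt: "Ck_real k {0<..} wgt"
  by (rule Ck_real_linear_ode[of _ _ "\<lambda>s. - qf s"], rule der_wgt, simp, rule Ck_real_minus, rule smooth_qf)

lemma antiderivative_pos_reals:
  fixes f :: "real \<Rightarrow> real"
  assumes "continuous_on {0<..} f"
  obtains F where "\<And>s. s > 0 \<Longrightarrow> (F has_real_derivative f s) (at s)"
proof -
  have "\<exists>F. \<forall>x::real. ereal 0 < ereal x \<longrightarrow> ereal x < \<infinity> \<longrightarrow> (F has_vector_derivative f x) (at x)"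
    using assms by (intro einterval_antiderivative) (auto simp: continuous_on_eq_continuous_at)
  then show ?thesis using that by (auto simp: has_real_derivative_iff_has_vector_derivative)
qed

lemma deriv_nonneg_mono:
  fixes f :: "real \<Rightarrow> real"
  assumes "a \<le> c" "\<And>s. a \<le> s \<Longrightarrow> s \<le> c \<Longrightarrow> (f has_real_derivative f' s) (at s)"
    "\<And>s. a \<le> s \<Longrightarrow> s \<le> c \<Longrightarrow> f' s \<ge> 0"
  shows "f a \<le> f c"
  using assms by (intro DERIV_nonneg_imp_nondecreasing[of a c f]) auto

text \<open>An explicit antiderivative of \<open>lam s / (1 + s)\<^sup>2\<close>, found by
  integrating by parts against s / (1 + s). As this integrand dominates \<open>wgt\<close>, the
  range of \<open>Qf\<close> bounds the total variation of L'.\<close>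

definition Qf :: "real \<Rightarrow> real" where "Qf s = s / (1 + s) * (1 + lam s)"

lemma der_Qf:
  assumes s: "s > 0"
  shows "(Qf has_real_derivative lam s / (1 + s)\<^sup>2) (at s)"
proof -
  have "((\<lambda>s. s / (1 + s)) has_real_derivative 1 / (1 + s)\<^sup>2) (at s)"
    using s by (auto intro!: derivative_eq_intros simp: power2_eq_square)
  moreover have "((\<lambda>s. 1 + lam s) has_real_derivative - (1 / (s * (1 + s)))) (at s)"
    using DERIV_add[OF DERIV_const der_lam[OF s]] by simp
  ultimately have "(Qf has_real_derivative
      1 / (1 + s)\<^sup>2 * (1 + lam s) + - (1 / (s * (1 + s))) * (s / (1 + s))) (at s)"
    unfolding Qf_def[abs_def] by (rule DERIV_mult)
  moreover have "1 / u\<^sup>2 * (1 + l) + - (1 / (s * u)) * (s / u) = l / u\<^sup>2" if "u > 0" for u l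
    using s that by (simp add: field_simps power2_eq_square)
  ultimately show ?thesis using s by simp
qed

lemma Qf_bounds: "s > 0 \<Longrightarrow> 0 \<le> Qf s \<and> Qf s \<le> 2"
proof -
  assume s: "s > 0"
  have "lam s \<le> 1 + 1 / s" using ln_le_minus_one[of "1 + 1 / s"] s by (simp add: lam_def add_pos_pos)
  then have "Qf s \<le> s / (1 + s) * (2 + 1 / s)" unfolding Qf_def using s by (intro mult_left_mono) auto
  also have "\<dots> = (2 * s + 1) / (1 + s)" using s by (simp add: distrib_left add_divide_distrib mult.commute)
  also have "\<dots> \<le> 2" using s by (simp add: divide_le_eq)
  finally show ?thesis using s lam_ge_1[OF s] by (simp add: Qf_def)
qed

text \<open>\<open>der_m\<close> and \<open>b_sq\<close> together are the vacuum equation. The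
  bounds restricted to s < 3 serve the initial slice, where s = x1 lies between 0 and 3; positivity
  is demanded for all s > 0 because the slices with t < 1 together reach every u > 0.\<close>

locale profile =
  fixes L m b \<beta> :: "real \<Rightarrow> real"
  assumes L_ge_1: "\<And>s. s > 0 \<Longrightarrow> L s \<ge> 1" and L_le: "\<And>s. 0 < s \<Longrightarrow> s < 3 \<Longrightarrow> L s \<le> 16"
    and m_bounds: "\<And>s. s > 0 \<Longrightarrow> 0 < m s \<and> m s \<le> 5"
    and der_L: "\<And>s. s > 0 \<Longrightarrow> (L has_real_derivative m s) (at s)"
    and der_m: "\<And>s. s > 0 \<Longrightarrow> (m has_real_derivative - wgt s) (at s)"
    and b_pos: "\<And>s. s > 0 \<Longrightarrow> b s > 0"
    and b_sq: "\<And>s. s > 0 \<Longrightarrow> (b s)\<^sup>2 * L s = wgt s"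
    and der_b: "\<And>s. s > 0 \<Longrightarrow> (b has_real_derivative - (qf s + m s / L s) / 2 * b s) (at s)"
    and der_\<beta>: "\<And>s. s > 0 \<Longrightarrow> (\<beta> has_real_derivative b s) (at s)"
    and \<beta>_bound: "\<And>s. 0 < s \<Longrightarrow> s < 3 \<Longrightarrow> \<bar>\<beta> s\<bar> \<le> 32"
    and smooth: "\<And>k. Ck_real k {0<..} L" "\<And>k. Ck_real k {0<..} m"
      "\<And>k. Ck_real k {0<..} b" "\<And>k. Ck_real k {0<..} \<beta>"

text \<open>Normalised to be 3 at s = 1: on either side of 1 the slope changes by at most the
  variation of \<open>Qf\<close>, which is at most 2.\<close>

lemma ex_slope:
  obtains m where "\<And>s. s > 0 \<Longrightarrow> (m has_real_derivative - wgt s) (at s)"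
    "\<And>s. s > 0 \<Longrightarrow> 1 \<le> m s \<and> m s \<le> 5"
proof -
  have "continuous_on {0<..} (\<lambda>s. - wgt s)"
    using Ck_real_minus[OF smooth_wgt[of 0]] by simp
  then obtain m0 where m0: "\<And>s. s > 0 \<Longrightarrow> (m0 has_real_derivative - wgt s) (at s)"
    using antiderivative_pos_reals by blast
  have anti: "m0 c \<le> m0 a" if "0 < a" "a \<le> c" for a c
    using deriv_nonneg_mono[OF that(2), of "\<lambda>s. - m0 s" "\<lambda>s. wgt s"] that
      DERIV_minus[OF m0] wgt_pos by (force simp: less_imp_le)
  have mono: "m0 a + Qf a \<le> m0 c + Qf c" if "0 < a" "a \<le> c" for a c
  proof (rule deriv_nonneg_mono[OF that(2), where f'="\<lambda>s. - wgt s + lam s / (1 + s)\<^sup>2"])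
    fix s assume s: "a \<le> s" "s \<le> c"
    show "((\<lambda>a. m0 a + Qf a) has_real_derivative - wgt s + lam s / (1 + s)\<^sup>2) (at s)"
      using s that by (intro DERIV_add m0 der_Qf) auto
    show "0 \<le> - wgt s + lam s / (1 + s)\<^sup>2" using wgt_le_lam[of s] s that by simp
  qed
  show ?thesis
  proof
    show "((\<lambda>s. m0 s + (3 - m0 1)) has_real_derivative - wgt s) (at s)" if "s > 0" for s
      using DERIV_add[OF m0[OF that] DERIV_const] by simp
    show "1 \<le> m0 s + (3 - m0 1) \<and> m0 s + (3 - m0 1) \<le> 5" if "s > 0" for s
      using anti[of s 1] anti[of 1 s] mono[of s 1] mono[of 1 s] Qf_bounds[OF that] Qf_bounds[of 1] that
      by (cases "s \<le> 1") auto
  qed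
qed

lemma ex_profile: "\<exists>L m b \<beta>. profile L m b \<beta>"
proof -
  obtain m where m: "\<And>s. s > 0 \<Longrightarrow> (m has_real_derivative - wgt s) (at s)"
    "\<And>s. s > 0 \<Longrightarrow> 1 \<le> m s \<and> m s \<le> 5" by (rule ex_slope) blast
  have sm: "Ck_real k {0<..} m" for k
    by (rule Ck_real_antiderivative[of _ _ "\<lambda>s. - wgt s"]) (auto intro: m Ck_real_minus smooth_wgt)
  obtain L0 where L0: "\<And>s. s > 0 \<Longrightarrow> (L0 has_real_derivative m s) (at s)"
    using antiderivative_pos_reals sm[of 0] by auto
  \<comment> \<open>With slope between 1 and 5, the value 6 at s = 1 keeps L at least 6 - 5 = 1 on
    (0, 1) and at most 6 + 10 = 16 on (1, 3).\<close>
  define L where "L s = L0 s + (6 - L0 1)" for s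
  have L: "(L has_real_derivative m s) (at s)" if "s > 0" for s
    unfolding L_def using DERIV_add[OF L0[OF that] DERIV_const] by simp
  have L1: "L 1 = 6" by (simp add: L_def)
  have mono: "L a \<le> L c" if "0 < a" "a \<le> c" for a c
  proof (rule deriv_nonneg_mono[OF that(2) L])
    show "m s \<ge> 0" if "a \<le> s" for s using m(2)[of s] that \<open>0 < a\<close> by linarith
  qed (use that in auto)
  have lip: "L c - L a \<le> 5 * (c - a)" if "0 < a" "a \<le> c" for a c
  proof -
    have "5 * a - L a \<le> 5 * c - L c"
      by (rule deriv_nonneg_mono[OF that(2), where f'="\<lambda>s. 5 - m s"])
         (use that m(2) in \<open>auto intro!: derivative_eq_intros L\<close>)
    then show ?thesis by (simp add: algebra_simps)
  qed
  have L_ge: "L s \<ge> 1" if "s > 0" for s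
    using lip[of s 1] mono[of 1 s] L1 that by (cases "s \<le> 1") auto
  have L_le: "L s \<le> 16" if "s > 0" "s < 3" for s
    using lip[of 1 s] mono[of s 1] L1 that by (cases "s \<le> 1") auto
  have sL: "Ck_real k {0<..} L" for k
    by (rule Ck_real_antiderivative[OF L sm]) auto
  define b where "b s = sqrt (wgt s / L s)" for s
  have wL: "wgt s / L s > 0" if "s > 0" for s using wgt_pos L_ge that by (force intro: divide_pos_pos)
  have b_pos: "b s > 0" if "s > 0" for s using wL[OF that] by (simp add: b_def)
  have b_sq: "(b s)\<^sup>2 * L s = wgt s" if "s > 0" for s
    using wL[OF that] L_ge[OF that] by (simp add: b_def)
  have b: "(b has_real_derivative - (qf s + m s / L s) / 2 * b s) (at s)" if s: "s > 0" for s
  proof -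
    have Ls: "L s > 0" using L_ge[OF s] by simp
    have "((\<lambda>s. wgt s / L s) has_real_derivative - (qf s + m s / L s) * (wgt s / L s)) (at s)"
      using DERIV_divide[OF der_wgt[OF s] L[OF s]] Ls
      by (auto elim!: DERIV_cong simp: field_simps)
    from DERIV_chain2[OF DERIV_real_sqrt[OF wL[OF s]] this]
    have "(b has_real_derivative inverse (sqrt (wgt s / L s)) / 2 * (- (qf s + m s / L s) * (wgt s / L s))) (at s)"
      unfolding b_def .
    moreover have "inverse (sqrt x) / 2 * (- c * x) = - c / 2 * sqrt x" if "x > 0" for c x :: real
      using that by (simp add: field_simps flip: real_sqrt_mult)
    note this[OF wL[OF s], of "qf s + m s / L s"]
    ultimately show ?thesis by (simp only: b_def)
  qed
  have sr: "Ck_real k {0<..} (\<lambda>s. m s / L s)" for k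
    by (intro Ck_real_divide sm sL) (use L_ge in force)
  have sb: "Ck_real k {0<..} b" for k
    by (rule Ck_real_linear_ode[of _ _ "\<lambda>s. - (qf s + m s / L s) / 2"], rule b, simp,
        intro Ck_real_divide Ck_real_minus Ck_real_add smooth_qf sr Ck_real_const, simp)
  obtain \<beta>0 where \<beta>0: "\<And>s. s > 0 \<Longrightarrow> (\<beta>0 has_real_derivative b s) (at s)"
    using antiderivative_pos_reals sb[of 0] by auto
  define \<beta> where "\<beta> s = \<beta>0 s - \<beta>0 1" for s
  have \<beta>: "(\<beta> has_real_derivative b s) (at s)" if "s > 0" for s
    unfolding \<beta>_def using DERIV_diff[OF \<beta>0[OF that] DERIV_const] by simp
  have b_le: "b s \<le> lam s" if "s > 0" for s
  proof -
    have "(b s)\<^sup>2 \<le> (b s)\<^sup>2 * L s" using L_ge[OF that] by (simp add: mult_le_cancel_left1)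
    also have "\<dots> \<le> lam s" using b_sq[OF that] wgt_le_sqrt[OF that] sqrt_lam_le[OF that] by simp
    also have "\<dots> \<le> (lam s)\<^sup>2" using lam_ge_1[OF that] by (simp add: power2_eq_square)
    finally show ?thesis by (rule power2_le_imp_le) (use lam_ge_1[OF that] in simp)
  qed
  have mono\<beta>: "\<beta> a \<le> \<beta> c" if "0 < a" "a \<le> c" for a c
    using b_pos that by (intro deriv_nonneg_mono[OF that(2) \<beta>]) (auto intro: less_imp_le)
  have lip\<beta>: "\<beta> c - \<beta> a \<le> 32" if "0 < a" "a \<le> c" "c < 3" for a c
  proof -
    \<comment> \<open>For s < 3 the denominator (1 + s)^2 is at most 16, so 16 Qf grows at least as
      fast as \<beta>; as Qf varies by at most 2, \<beta> varies by at most 32.\<close>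
    have "16 * Qf a - \<beta> a \<le> 16 * Qf c - \<beta> c"
    proof (rule deriv_nonneg_mono[OF that(2), where f'="\<lambda>s. 16 * (lam s / (1 + s)\<^sup>2) - b s"])
      fix s assume s: "a \<le> s" "s \<le> c"
      show "((\<lambda>a. 16 * Qf a - \<beta> a) has_real_derivative 16 * (lam s / (1 + s)\<^sup>2) - b s) (at s)"
        using s that by (intro DERIV_diff DERIV_cmult der_Qf \<beta>) auto
      have "(1 + s)\<^sup>2 \<le> 4\<^sup>2" using s that by (intro power_mono) auto
      then have "lam s \<le> 16 * (lam s / (1 + s)\<^sup>2)"
        using s that lam_ge_1[of s] by (simp add: field_simps)
      then show "16 * (lam s / (1 + s)\<^sup>2) - b s \<ge> 0" using b_le[of s] s that by simp
    qed
    then show ?thesis using Qf_bounds[of a] Qf_bounds[of c] that by linarith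
  qed
  have \<beta>1: "\<beta> 1 = 0" by (simp add: \<beta>_def)
  have "\<bar>\<beta> s\<bar> \<le> 32" if "0 < s" "s < 3" for s
    using mono\<beta>[of s 1] mono\<beta>[of 1 s] lip\<beta>[of s 1] lip\<beta>[of 1 s] that \<beta>1 by (cases "s \<le> 1") auto
  moreover have "Ck_real k {0<..} \<beta>" for k
    by (rule Ck_real_antiderivative[OF \<beta> sb]) auto
  moreover have "0 < m s \<and> m s \<le> 5" if "s > 0" for s using m(2)[OF that] by auto
  ultimately have "profile L m b \<beta>"
    using L_ge L_le m(1) L b_pos b_sq b \<beta> sL sm sb by unfold_locales auto
  then show ?thesis by blast
qed

section \<open>A lower bound for weak second derivatives\<close>

text \<open>Test functions with disjoint supports are used in \<open>w\<^sup>2 \<ge> 2 k \<phi> w - k\<^sup>2 \<phi>\<^sup>2\<close>; this avoids identifying \<open>w\<close> with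
  the classical derivative almost everywhere.\<close>

lemma weak_second_derivative_lower_bound:
  fixes a d :: "nat \<Rightarrow> real^3"
  assumes op: "open \<Omega>" and J: "\<And>x. x \<in> \<Omega> \<Longrightarrow> x$1 \<in> J"
    and der: "\<And>j s. j < 2 \<Longrightarrow> s \<in> J \<Longrightarrow> (h j has_real_derivative h (Suc j) s) (at s)"
    and cont: "\<And>j. j \<le> 2 \<Longrightarrow> continuous_on J (h j)"
    and f: "\<And>x. x \<in> \<Omega> \<Longrightarrow> f x = h 0 (x$1)"
    and wd: "weak_deriv \<Omega> (\<lambda>i. if i = 1 then 2 else 0) f w" and sq: "square_integrable \<Omega> w"
    and d: "\<And>n i. d n $ i > 0" and sub: "\<And>n. cbox (a n) (a n + d n) \<subseteq> \<Omega>"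
    and disj: "\<And>j k. j < k \<Longrightarrow> a k $ 1 + d k $ 1 \<le> a j $ 1"
    and \<sigma>: "\<sigma> * \<sigma> = 1"
    and c: "\<And>n. c n \<ge> 0"
    and low: "\<And>n x. x \<in> cbox (a n) (a n + d n) \<Longrightarrow> c n \<le> \<sigma> * h 2 (x$1)"
  shows "(\<Sum>n<N. (exp (- 24) / 8)\<^sup>2 * ((c n)\<^sup>2 * (d n $ 1 * d n $ 2 * d n $ 3)))
           \<le> (LINT x|lebesgue_on \<Omega>. (w x)\<^sup>2)"
proof -
  let ?A = "\<lambda>i::3. if i = 1 then 2 else (0::nat)" and ?M = "lebesgue_on \<Omega>"
  define \<mu> :: real where "\<mu> = exp (- 24) / 8"
  define \<phi> where "\<phi> n = box_bump (a n) (d n)" for n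
  define vol where "vol n = d n $ 1 * d n $ 2 * d n $ 3" for n
  \<comment> \<open>The maximiser of 2 k \<mu> c - k^2, the net gain per unit volume on the n-th
    box.\<close>
  define k where "k n = \<mu> * c n" for n
  have t: "test_fun \<Omega> (\<phi> n)" for n unfolding \<phi>_def by (rule box_bump_test_fun[OF d sub])
  note bi = box_bump_integral[OF d sub op, folded \<phi>_def \<mu>_def vol_def]
  have mo: "multi_order ?A = 2" by (simp add: multi_order_def sum_3)
  have wd2: "weak_deriv \<Omega> ?A f (\<lambda>x. h 2 (x$1))"
    using weak_deriv_x1[where h=h and k=2 and f=f and a="?A", OF op J der cont f] mo by simp
  have eq: "(LINT x|?M. w x * \<phi> n x) = (LINT x|?M. h 2 (x$1) * \<phi> n x)" for n
    using wd wd2 t[of n] unfolding weak_deriv_def mo by auto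
  have ch2: "continuous_on \<Omega> (\<lambda>x. h 2 (x$1))"
    using J by (intro continuous_on_compose2[OF cont] continuous_intros) auto
  have supp: "x \<in> cbox (a n) (a n + d n)" "a n $ 1 < x $ 1" "x $ 1 < a n $ 1 + d n $ 1"
    if "\<phi> n x \<noteq> 0" for n x
    using box_bump_support[of "d n" "a n" x, OF d] that unfolding \<phi>_def
    by (auto simp: mem_box_cart less_imp_le)
  have low': "\<mu> * c n * vol n \<le> \<sigma> * (LINT x|?M. w x * \<phi> n x)" for n
  proof -
    have "c n * (\<mu> * vol n) \<le> c n * integral\<^sup>L ?M (\<phi> n)"
      using bi(2) c by (intro mult_left_mono) auto
    also have "\<dots> = (LINT x|?M. c n * \<phi> n x)" by simp
    also have "\<dots> \<le> (LINT x|?M. \<sigma> * (h 2 (x$1) * \<phi> n x))"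
    proof (rule integral_mono)
      show "integrable ?M (\<lambda>x. c n * \<phi> n x)" using bi(1) by simp
      show "integrable ?M (\<lambda>x. \<sigma> * (h 2 (x$1) * \<phi> n x))"
        using times_test_fun_integrable(1)[OF op ch2 t] by simp
      show "c n * \<phi> n x \<le> \<sigma> * (h 2 (x$1) * \<phi> n x)" for x
      proof (cases "\<phi> n x = 0")
        case False
        have "c n * \<phi> n x \<le> (\<sigma> * h 2 (x$1)) * \<phi> n x"
          using low[OF supp(1)[OF False]] box_bump_bounds(1) by (intro mult_right_mono) (auto simp: \<phi>_def)
        then show ?thesis by (simp add: mult.assoc)
      qed simp
    qed
    finally show ?thesis by (simp add: eq mult_ac)
  qed
  have wm: "w \<in> borel_measurable ?M" and w2: "integrable ?M (\<lambda>x. (w x)\<^sup>2)"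
    using sq unfolding square_integrable_def by auto
  have w\<phi>: "integrable ?M (\<lambda>x. w x * \<phi> n x)" for n
  proof (rule Bochner_Integration.integrable_bound)
    show "integrable ?M (\<lambda>x. (w x)\<^sup>2 + (\<phi> n x)\<^sup>2)" using w2 bi(3) by simp
    show "(\<lambda>x. w x * \<phi> n x) \<in> borel_measurable ?M"
      using wm borel_measurable_integrable[OF bi(1)] by simp
    show "AE x in ?M. norm (w x * \<phi> n x) \<le> norm ((w x)\<^sup>2 + (\<phi> n x)\<^sup>2)"
    proof (rule AE_I2)
      fix x
      have "2 * \<bar>w x * \<phi> n x\<bar> \<le> (w x)\<^sup>2 + (\<phi> n x)\<^sup>2"
        using sum_squares_bound[of "\<bar>w x\<bar>" "\<bar>\<phi> n x\<bar>"] by (simp add: abs_mult)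
      then show "norm (w x * \<phi> n x) \<le> norm ((w x)\<^sup>2 + (\<phi> n x)\<^sup>2)" by simp
    qed
  qed
  have pw: "(\<Sum>n<N. 2 * k n * \<sigma> * (w x * \<phi> n x) - (k n)\<^sup>2 * (\<phi> n x)\<^sup>2) \<le> (w x)\<^sup>2" for x
  proof (cases "\<exists>n<N. \<phi> n x \<noteq> 0")
    case True
    then obtain n0 where n0: "n0 < N" "\<phi> n0 x \<noteq> 0" by blast
    have z: "\<phi> n x = 0" if "n \<noteq> n0" for n
    proof (rule ccontr)
      assume "\<phi> n x \<noteq> 0"
      then show False using supp[of n x] supp[OF n0(2)] disj[of n n0] disj[of n0 n] that
        by (cases "n < n0") auto
    qed
    have "(\<Sum>n<N. 2 * k n * \<sigma> * (w x * \<phi> n x) - (k n)\<^sup>2 * (\<phi> n x)\<^sup>2) =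
       (\<Sum>n\<in>{n0}. 2 * k n * \<sigma> * (w x * \<phi> n x) - (k n)\<^sup>2 * (\<phi> n x)\<^sup>2)"
      using n0(1) z by (intro sum.mono_neutral_right) auto
    also have "\<dots> = (w x)\<^sup>2 - (w x - k n0 * \<sigma> * \<phi> n0 x)\<^sup>2"
    proof -
      have "(k n0 * \<sigma> * \<phi> n0 x)\<^sup>2 = (k n0)\<^sup>2 * (\<phi> n0 x)\<^sup>2"
        using \<sigma> by (simp add: power_mult_distrib power2_eq_square[of \<sigma>])
      then show ?thesis by (simp add: power2_diff algebra_simps)
    qed
    also have "\<dots> \<le> (w x)\<^sup>2" by simp
    finally show ?thesis .
  next
    case False
    then have "(\<Sum>n<N. 2 * k n * \<sigma> * (w x * \<phi> n x) - (k n)\<^sup>2 * (\<phi> n x)\<^sup>2) = 0"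
      by (intro sum.neutral) auto
    then show ?thesis by simp
  qed
  have "(\<Sum>n<N. \<mu>\<^sup>2 * ((c n)\<^sup>2 * vol n)) \<le>
      (\<Sum>n<N. 2 * k n * \<sigma> * (LINT x|?M. w x * \<phi> n x) - (k n)\<^sup>2 * (LINT x|?M. (\<phi> n x)\<^sup>2))"
  proof (rule sum_mono)
    fix n
    have kn: "k n \<ge> 0" using c[of n] by (simp add: k_def \<mu>_def)
    have "2 * k n * (\<mu> * c n * vol n) \<le> 2 * k n * (\<sigma> * (LINT x|?M. w x * \<phi> n x))"
      using low'[of n] kn by (intro mult_left_mono) auto
    moreover have "(k n)\<^sup>2 * (LINT x|?M. (\<phi> n x)\<^sup>2) \<le> (k n)\<^sup>2 * vol n"
      using bi(4) by (intro mult_left_mono) auto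
    moreover have "2 * k n * (\<mu> * c n * vol n) - (k n)\<^sup>2 * vol n = \<mu>\<^sup>2 * ((c n)\<^sup>2 * vol n)"
      by (simp add: k_def power2_eq_square)
    ultimately show "\<mu>\<^sup>2 * ((c n)\<^sup>2 * vol n) \<le>
        2 * k n * \<sigma> * (LINT x|?M. w x * \<phi> n x) - (k n)\<^sup>2 * (LINT x|?M. (\<phi> n x)\<^sup>2)"
      by (simp add: mult.assoc)
  qed
  also have "\<dots> = (LINT x|?M. (\<Sum>n<N. 2 * k n * \<sigma> * (w x * \<phi> n x) - (k n)\<^sup>2 * (\<phi> n x)\<^sup>2))"
    using w\<phi> bi(3) by simp
  also have "\<dots> \<le> (LINT x|?M. (w x)\<^sup>2)"
    using w\<phi> bi(3) by (intro integral_mono w2 pw) auto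
  finally show ?thesis by (simp only: \<mu>_def vol_def)
qed

section \<open>Geometry of the domain and of its slices\<close>

lemma x1_step_continuous: "continuous_on UNIV (\<lambda>x::real. (x - 1)\<^sup>2 * H_step (x - 1))"
proof -
  \<comment> \<open>The jump of \<open>H_step\<close> sits at a double zero of its factor; the form
    with \<open>min\<close> and \<open>max\<close> makes continuity visible.\<close>
  have "(x - 1)\<^sup>2 * H_step (x - 1) = (min (x - 1) 0)\<^sup>2 + (max (x - 1) 0)\<^sup>2 / 4" for x :: real
    by (auto simp: H_step_def min_def max_def)
  then show ?thesis by (auto intro!: continuous_intros)
qed

lemma D_slice_iff:
  "x \<in> D_slice t \<longleftrightarrow>
     (x$1 - 1)\<^sup>2 * H_step (x$1 - 1) + (x$2)\<^sup>2 / 4 + (x$3)\<^sup>2 / 4 < (1 - t)\<^sup>2"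
  by (simp add: D_slice_def D_dom_def spacetime_point_def)

lemma open_D_dom: "open D_dom"
  unfolding D_dom_def
  by (intro open_Collect_less continuous_on_add continuous_intros
      continuous_on_compose2[OF x1_step_continuous]) auto

lemma open_D_slice: "open (D_slice t)"
proof -
  have "D_slice t = {x. (x$1 - 1)\<^sup>2 * H_step (x$1 - 1) + (x$2)\<^sup>2 / 4 + (x$3)\<^sup>2 / 4 < (1 - t)\<^sup>2}"
    using D_slice_iff by auto
  then show ?thesis
    by (simp only:) (intro open_Collect_less continuous_on_add continuous_intros
      continuous_on_compose2[OF x1_step_continuous], auto)
qed

text \<open>Left of x1 = 1 the defining inequality forces 1 - x1 < 1 - t, and right of it x1 \<ge> 1
  > t. So the profile is only evaluated at u > 0, where it is smooth.\<close>

lemma D_dom_retarded_pos: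
  assumes "p \<in> D_dom" "p$0 < 1"
  shows "p$1 - p$0 > 0"
proof (cases "p$1 < 1")
  case True
  have "(p$1 - 1)\<^sup>2 + ((p$2)\<^sup>2 / 4 + (p$3)\<^sup>2 / 4) < (1 - p$0)\<^sup>2"
    using assms(1) True by (simp add: D_dom_def H_step_def add.assoc)
  then have "(1 - p$1)\<^sup>2 < (1 - p$0)\<^sup>2"
    using zero_le_power2[of "p$2"] zero_le_power2[of "p$3"] power2_commute[of 1 "p$1"] by linarith
  then have "1 - p$1 < 1 - p$0" by (rule power2_less_imp_less) (use assms(2) in simp)
  then show ?thesis by simp
qed (use assms(2) in auto)

text \<open>Hence the domain falls into two disjoint open pieces, and the metric may be chosen on
  each without any matching condition.\<close>

lemma D_dom_time_ne_1: "p \<in> D_dom \<Longrightarrow> p$0 \<noteq> 1"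
proof
  assume "p \<in> D_dom" "p$0 = 1"
  then have "(p$1 - 1)\<^sup>2 * H_step (p$1 - 1) + (p$2)\<^sup>2 / 4 + (p$3)\<^sup>2 / 4 < 0" by (simp add: D_dom_def)
  moreover have "(p$1 - 1)\<^sup>2 * H_step (p$1 - 1) + (p$2)\<^sup>2 / 4 + (p$3)\<^sup>2 / 4 \<ge> 0"
    by (auto simp: H_step_def)
  ultimately show False by linarith
qed

text \<open>Left of x1 = 1 the slice satisfies x2^2/4 + x3^2/4 < 2 x1 - x1^2, the paraboloid with
  constant 8. Right of it x2^2 and x3^2 are below 4, so the same constant works there.\<close>

lemma D_slice_0_bounds:
  assumes "x \<in> D_slice 0"
  shows "0 < x$1" "x$1 < 3" "(x$2)\<^sup>2 \<le> 8 * x$1" "(x$3)\<^sup>2 \<le> 8 * x$1"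
proof -
  have z: "(x$2)\<^sup>2 \<ge> 0" "(x$3)\<^sup>2 \<ge> 0" by auto
  have "0 < x$1 \<and> x$1 < 3 \<and> (x$2)\<^sup>2 \<le> 8 * x$1 \<and> (x$3)\<^sup>2 \<le> 8 * x$1"
  proof (cases "x$1 < 1")
    case True
    then have i: "(x$1 - 1)\<^sup>2 + (x$2)\<^sup>2 / 4 + (x$3)\<^sup>2 / 4 < 1"
      using assms by (simp add: D_slice_iff H_step_def)
    then have j: "(x$2)\<^sup>2 / 4 + (x$3)\<^sup>2 / 4 < 2 * x$1 - (x$1)\<^sup>2"
      by (simp add: power2_diff)
    have "2 * x$1 > 0" using j z zero_le_power2[of "x$1"] by linarith
    then show ?thesis using j z True zero_le_power2[of "x$1"] by (intro conjI; linarith)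
  next
    case False
    then have i: "(x$1 - 1)\<^sup>2 / 4 + (x$2)\<^sup>2 / 4 + (x$3)\<^sup>2 / 4 < 1"
      using assms by (simp add: D_slice_iff H_step_def)
    then have "(x$1 - 1)\<^sup>2 < 2\<^sup>2" using z unfolding power2_eq_square[of "2::real"] by linarith
    then have "x$1 - 1 < 2" by (rule power2_less_imp_less) simp
    then show ?thesis using i z False zero_le_power2[of "x$1 - 1"] by (intro conjI; linarith)
  qed
  then show "0 < x$1" "x$1 < 3" "(x$2)\<^sup>2 \<le> 8 * x$1" "(x$3)\<^sup>2 \<le> 8 * x$1" by auto
qed

section \<open>Sobolev norms on the initial slice\<close>

text \<open>The mean of the bounds n, which holds because ln 4 \<ge> 1, and 1. The shift keeps the
  bound positive at n = 0.\<close>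

lemma lam_ge_dyadic:
  assumes "0 < s" "s \<le> 4 * (1 / 4) ^ n"
  shows "(real n + 1) / 2 \<le> lam s"
proof -
  have "real n \<le> lam s"
  proof -
    have p: "(4::real) ^ n > 0" by simp
    have "4 ^ n / 4 \<le> 1 / s" using assms by (simp add: field_simps power_divide)
    then have "ln (4 ^ n / 4) \<le> ln (1 + 1 / s)" using assms(1) p by (subst ln_le_cancel_iff) (auto simp: add_pos_pos)
    moreover have "ln (4 ^ n / 4 :: real) = (real n - 1) * ln 4" by (simp add: ln_div ln_realpow algebra_simps)
    moreover have "real n - 1 \<le> (real n - 1) * ln 4 \<or> n = 0"
    proof -
      have "(1::real) \<le> ln 4" using ln_ge_iff[of 4 1] exp_le by simp
      then show ?thesis by (cases "n = 0") (auto simp: mult_le_cancel_left1)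
    qed
    ultimately show ?thesis using lam_ge_1[OF assms(1)] by (auto simp: lam_def)
  qed
  then show ?thesis using lam_ge_1[OF assms(1)] by simp
qed

lemma dyadic_scale:
  assumes "0 < s" "s < (4::real)"
  obtains n where "(1 / 4) ^ n < s" "s \<le> 4 * (1 / 4) ^ n"
proof -
  obtain k where k: "(1 / 4 :: real) ^ k < s" using real_arch_pow_inv[of s "1 / 4"] assms by auto
  define n where "n = (LEAST k. (1 / 4 :: real) ^ k < s)"
  have n: "(1 / 4) ^ n < s" unfolding n_def by (rule LeastI[of _ k]) (rule k)
  have "s \<le> 4 * (1 / 4) ^ n"
  proof (cases n)
    case 0
    then show ?thesis using assms by simp
  next
    case (Suc j)
    then have "\<not> (1 / 4) ^ j < s" using not_less_Least[of j "\<lambda>k. (1 / 4 :: real) ^ k < s"] n_def by simp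
    then show ?thesis using Suc by simp
  qed
  then show ?thesis using n that by blast
qed

text \<open>\<open>h\<^sup>2\<close> is dominated by \<open>1 / (s\<^sup>2 \<lambda>\<^bsup>3/2\<^esup>)\<close>, which is integrable with respect to \<open>s ds\<close>.\<close>

definition tip_controlled :: "(real \<Rightarrow> real) \<Rightarrow> bool" where
  "tip_controlled h \<longleftrightarrow>
     (\<exists>C. \<forall>s. 0 < s \<and> s < 3 \<longrightarrow> (h s)\<^sup>2 * (s\<^sup>2 * (lam s * sqrt (lam s))) \<le> C)"

text \<open>The boxes given by this corner and \<open>tip_size\<close> cover the pieces 4^-n < x1
  \<le> 4 * 4^-n of the initial slice. There x2^2 \<le> 8 x1 \<le> 32 * 4^-n, which the half-width 6
  * 2^-n accommodates because 36 exceeds 32.\<close>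

definition tip_corner :: "nat \<Rightarrow> real^3" where
  "tip_corner n = (\<chi> i. if i = 1 then 0 else - 6 * (1 / 2) ^ n)"

definition tip_size :: "nat \<Rightarrow> real^3" where
  "tip_size n = (\<chi> i. if i = 1 then 4 * (1 / 4) ^ n else 12 * (1 / 2) ^ n)"

lemma measure_tip_box: "measure lborel (cbox (tip_corner n) (tip_corner n + tip_size n)) = 576 / 16 ^ n"
proof -
  have "measure lborel (cbox (tip_corner n) (tip_corner n + tip_size n)) =
      tip_size n $ 1 * tip_size n $ 2 * tip_size n $ 3"
    by (rule measure_cbox_3) (simp add: tip_size_def)
  also have "\<dots> = 576 * ((1 / 2) ^ n * (1 / 2) ^ n * (1 / 4) ^ n)" by (simp add: tip_size_def)
  also have "(1 / 2) ^ n * (1 / 2) ^ n * (1 / 4) ^ n = (1 / 16 :: real) ^ n"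
    by (simp only: power_mult_distrib[symmetric]) simp
  finally show ?thesis by (simp add: power_divide)
qed

lemma tip_box_cover:
  assumes C: "\<And>s. 0 < s \<Longrightarrow> s < 3 \<Longrightarrow> (h s)\<^sup>2 * (s\<^sup>2 * (lam s * sqrt (lam s))) \<le> C"
    and x: "x \<in> D_slice 0"
  shows "\<exists>n. x \<in> cbox (tip_corner n) (tip_corner n + tip_size n) \<and>
    (h (x$1))\<^sup>2 \<le> C * (16 ^ n * (4 / ((real n + 1) * sqrt (real n + 1))))"
proof -
  note b = D_slice_0_bounds[OF x]
  define s where "s = x$1"
  have s: "0 < s" "s < 3" using b by (auto simp: s_def)
  obtain n where n: "(1 / 4) ^ n < s" "s \<le> 4 * (1 / 4) ^ n" using dyadic_scale[of s] s by auto
  have hyp: "\<bar>y\<bar> \<le> 6 * (1 / 2) ^ n" if "y\<^sup>2 \<le> 8 * s" for y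
  proof -
    have "(1 / 2 :: real) ^ n * (1 / 2) ^ n = (1 / 4) ^ n" by (simp flip: power_mult_distrib)
    then have "y\<^sup>2 \<le> (6 * (1 / 2) ^ n)\<^sup>2" using that n(2) s by (simp add: power2_eq_square mult_ac)
    then have "\<bar>y\<bar> \<le> \<bar>6 * (1 / 2) ^ n\<bar>" by (simp only: abs_le_square_iff)
    then show ?thesis by simp
  qed
  have "x \<in> cbox (tip_corner n) (tip_corner n + tip_size n)"
    using hyp[of "x$2"] hyp[of "x$3"] b s n(2)
    by (simp add: mem_box_cart forall_3 tip_corner_def tip_size_def s_def abs_le_iff)
  moreover have "(h s)\<^sup>2 \<le> C * (16 ^ n * (4 / ((real n + 1) * sqrt (real n + 1))))"
  proof -
    define N where "N = real n + 1"
    have N: "N \<ge> 1" by (simp add: N_def)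
    have l: "N / 2 \<le> lam s" unfolding N_def by (rule lam_ge_dyadic[OF s(1) n(2)])
    have "(1 / 16) ^ n * (N * sqrt N / 4) \<le> s\<^sup>2 * (lam s * sqrt (lam s))"
    proof (rule mult_mono)
      have "((1 / 4) ^ n)\<^sup>2 \<le> s\<^sup>2" using n(1) by (intro power_mono) auto
      moreover have "((1 / 4 :: real) ^ n)\<^sup>2 = (1 / 16) ^ n"
        by (simp add: power2_eq_square flip: power_mult_distrib)
      ultimately show "(1 / 16) ^ n \<le> s\<^sup>2" by simp
      have "sqrt N / 2 \<le> sqrt (lam s)"
      proof -
        have "sqrt N / 2 = sqrt (N / 4)" by (simp add: real_sqrt_divide)
        also have "\<dots> \<le> sqrt (lam s)" using l N by simp
        finally show ?thesis .
      qed
      then have "N / 2 * (sqrt N / 2) \<le> lam s * sqrt (lam s)"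
        using l N lam_ge_1[OF s(1)] by (intro mult_mono) auto
      then show "N * sqrt N / 4 \<le> lam s * sqrt (lam s)" by simp
    qed (use N in auto)
    then have "(h s)\<^sup>2 * ((1 / 16) ^ n * (N * sqrt N / 4)) \<le> C"
      using C[OF s] by (meson mult_left_mono order_trans zero_le_power2)
    then have "(h s)\<^sup>2 \<le> C / ((1 / 16) ^ n * (N * sqrt N / 4))"
      using N by (subst pos_le_divide_eq) auto
    also have "\<dots> = C * (16 ^ n * (4 / ((real n + 1) * sqrt (real n + 1))))" by (simp add: N_def power_divide)
    finally show ?thesis .
  qed
  ultimately show ?thesis by (auto simp: s_def)
qed

lemma summable_inverse_times_sqrt: "summable (\<lambda>n. 1 / ((real n + 1) * sqrt (real n + 1)))"
proof -
  have "summable (\<lambda>n. real n powr (- 3 / 2))" by (subst summable_real_powr_iff) simp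
  then have "summable (\<lambda>n. real (Suc n) powr (- 3 / 2))" by (subst summable_Suc_iff)
  moreover have "real (Suc n) powr (- 3 / 2) = 1 / ((real n + 1) * sqrt (real n + 1))" for n
  proof -
    have "real (Suc n) powr (3 / 2) = real (Suc n) powr (1 + 1 / 2)" by simp
    also have "\<dots> = real (Suc n) powr 1 * real (Suc n) powr (1 / 2)" by (rule powr_add)
    also have "\<dots> = (real n + 1) * sqrt (real n + 1)"
      by (simp add: powr_half_sqrt add.commute)
    finally show ?thesis using powr_minus_divide[of "real (Suc n)" "3 / 2"] by simp
  qed
  ultimately show ?thesis by simp
qed

text \<open>On the n-th box the square is of order at most \<open>16^n / (n + 1)^(3/2)\<close>, and
  the volume is of order \<open>16^-n\<close>; the products form a convergent series. The boxes
  overlap and exceed the slice, which does no harm to an upper bound.\<close>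

lemma tip_controlled_square_integrable:
  assumes tc: "tip_controlled h" and cont: "continuous_on {0<..} h"
  shows "square_integrable (D_slice 0) (\<lambda>x. h (x$1))"
proof -
  let ?\<Omega> = "D_slice 0"
  obtain C0 where C0: "\<And>s. 0 < s \<Longrightarrow> s < 3 \<Longrightarrow> (h s)\<^sup>2 * (s\<^sup>2 * (lam s * sqrt (lam s))) \<le> C0"
    using tc unfolding tip_controlled_def by blast
  define C where "C = \<bar>C0\<bar>"
  have C: "(h s)\<^sup>2 * (s\<^sup>2 * (lam s * sqrt (lam s))) \<le> C" "C \<ge> 0" if "0 < s" "s < 3" for s
    using C0[OF that] by (auto simp: C_def)
  have \<Omega>: "?\<Omega> \<in> sets lebesgue" using open_D_slice by auto
  have c: "continuous_on ?\<Omega> (\<lambda>x. h (x$1))"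
    using D_slice_0_bounds(1) by (intro continuous_on_compose2[OF cont] continuous_intros) auto
  have m: "(\<lambda>x. h (x$1)) \<in> borel_measurable (lebesgue_on ?\<Omega>)"
    by (rule continuous_imp_measurable_on_sets_lebesgue[OF c \<Omega>])
  define a where "a = tip_corner"
  define d where "d = tip_size"
  define K where "K n = C * (16 ^ n * (4 / ((real n + 1) * sqrt (real n + 1))))" for n :: nat
  have vol: "measure lborel (cbox (a n) (a n + d n)) = 576 / 16 ^ n" for n
    unfolding a_def d_def by (rule measure_tip_box)
  have bound: "\<exists>n. x \<in> cbox (a n) (a n + d n) \<and> (h (x$1))\<^sup>2 \<le> K n" if x: "x \<in> ?\<Omega>" for x
    unfolding a_def d_def K_def by (rule tip_box_cover[OF C(1) x])
  have "(\<integral>\<^sup>+x. ennreal (norm ((h (x$1))\<^sup>2)) \<partial>lebesgue_on ?\<Omega>) < \<infinity>"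
  proof -
    have C_nn: "C \<ge> 0" by (simp add: C_def)
    have K0: "K n \<ge> 0" for n using C_nn by (simp add: K_def)
    have "(\<integral>\<^sup>+x. ennreal (norm ((h (x$1))\<^sup>2)) \<partial>lebesgue_on ?\<Omega>)
       = (\<integral>\<^sup>+x. ennreal (norm ((h (x$1))\<^sup>2)) * indicator ?\<Omega> x \<partial>lebesgue)"
      using \<Omega> by (intro nn_integral_restrict_space) auto
    also have "\<dots> \<le> (\<integral>\<^sup>+x. (\<Sum>n. ennreal (K n) * indicator (cbox (a n) (a n + d n)) x) \<partial>lebesgue)"
    proof (rule nn_integral_mono)
      fix x
      show "ennreal (norm ((h (x$1))\<^sup>2)) * indicator ?\<Omega> x \<le>
          (\<Sum>n. ennreal (K n) * indicator (cbox (a n) (a n + d n)) x)"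
      proof (cases "x \<in> ?\<Omega>")
        case True
        then obtain n where n: "x \<in> cbox (a n) (a n + d n)" "(h (x$1))\<^sup>2 \<le> K n" using bound by blast
        have "ennreal (norm ((h (x$1))\<^sup>2)) * indicator ?\<Omega> x \<le>
           (\<Sum>n\<in>{n}. ennreal (K n) * indicator (cbox (a n) (a n + d n)) x)"
          using n True by (simp add: ennreal_leI)
        also have "\<dots> \<le> (\<Sum>n. ennreal (K n) * indicator (cbox (a n) (a n + d n)) x)"
          by (rule sum_le_suminf) auto
        finally show ?thesis .
      qed simp
    qed
    also have "\<dots> = (\<Sum>n. \<integral>\<^sup>+x. ennreal (K n) * indicator (cbox (a n) (a n + d n)) x \<partial>lebesgue)"
      by (intro nn_integral_suminf borel_measurable_times_ennreal borel_measurable_const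
          borel_measurable_indicator) simp
    also have "\<dots> = (\<Sum>n. ennreal (K n * (576 / 16 ^ n)))"
    proof (rule suminf_cong)
      fix n
      have "emeasure lborel (cbox (a n) (a n + d n)) = ennreal (measure lborel (cbox (a n) (a n + d n)))"
        using emeasure_lborel_cbox_finite by (intro emeasure_eq_ennreal_measure) (simp add: less_top[symmetric])
      then have "emeasure lebesgue (cbox (a n) (a n + d n)) = ennreal (576 / 16 ^ n)"
        using vol[of n] by simp
      then show "(\<integral>\<^sup>+x. ennreal (K n) * indicator (cbox (a n) (a n + d n)) x \<partial>lebesgue) =
          ennreal (K n * (576 / 16 ^ n))"
        using K0[of n] ennreal_mult[of "K n" "576 / 16 ^ n"] by (simp add: nn_integral_cmult_indicator)
    qed
    also have "\<dots> < \<infinity>"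
    proof -
      have "K n * (576 / 16 ^ n) = C * 2304 * (1 / ((real n + 1) * sqrt (real n + 1)))" for n
        by (simp add: K_def)
      then have "summable (\<lambda>n. K n * (576 / 16 ^ n))"
        using summable_mult[OF summable_inverse_times_sqrt, of "C * 2304"] by simp
      then show ?thesis using K0 by (simp add: suminf_ennreal2)
    qed
    finally show ?thesis .
  qed
  then show ?thesis
    unfolding square_integrable_def using m
    by (auto intro!: integrableI_bounded borel_measurable_power)
qed

text \<open>The norm is an infimum, so one admissible family suffices: the classical derivatives in
  x1, and 0 whenever a transverse derivative occurs.\<close>

lemma sobolev_norm_finite:
  assumes der: "\<And>j s. j < k \<Longrightarrow> s > 0 \<Longrightarrow> (h j has_real_derivative h (Suc j) s) (at s)"
    and cont: "\<And>j. j \<le> k \<Longrightarrow> continuous_on {0<..} (h j)"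
    and tc: "\<And>j. j \<le> k \<Longrightarrow> tip_controlled (h j)"
    and f: "\<And>x. x \<in> D_slice 0 \<Longrightarrow> f x = h 0 (x$1)"
  shows "sobolev_norm k (D_slice 0) f < \<infinity>"
proof -
  define w where "w a = (\<lambda>x::real^3. if a (2::3) = 0 \<and> a 3 = 0 then h (a 1) (x$1) else 0)" for a
  have w: "weak_deriv (D_slice 0) a f (w a) \<and> square_integrable (D_slice 0) (w a)"
    if a: "multi_order a \<le> k" for a
  proof
    show "weak_deriv (D_slice 0) a f (w a)"
      unfolding w_def
      by (rule weak_deriv_x1[where J="{0<..}" and h=h and k=k, OF open_D_slice _ _ _ _ a])
         (use D_slice_0_bounds der cont f in auto)
    show "square_integrable (D_slice 0) (w a)"
    proof (cases "a 2 = 0 \<and> a 3 = 0")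
      case True
      have "a 1 \<le> k" using a by (simp add: multi_order_def sum_3)
      then show ?thesis
        using True tip_controlled_square_integrable[OF tc cont, of "a 1"] by (simp add: w_def)
    next
      case False
      then have "w a = (\<lambda>x. 0)" by (auto simp: w_def)
      then show ?thesis by (simp add: square_integrable_def)
    qed
  qed
  have "sobolev_norm k (D_slice 0) f \<le>
      ennreal (sqrt (\<Sum>a | multi_order a \<le> k. LINT x|lebesgue_on (D_slice 0). (w a x)\<^sup>2))"
    unfolding sobolev_norm_def by (rule INF_lower) (use w in auto)
  also have "\<dots> < \<infinity>" by simp
  finally show ?thesis .
qed

section \<open>Calculus of tip-controlled functions and finiteness of the initial norms\<close>

lemma tip_controlled_cong:
  assumes "tip_controlled f" "\<And>s. 0 < s \<Longrightarrow> s < 3 \<Longrightarrow> g s = f s"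
  shows "tip_controlled g"
  using assms unfolding tip_controlled_def by auto

lemma tip_controlled_add:
  assumes "tip_controlled f" "tip_controlled g"
  shows "tip_controlled (\<lambda>s. f s + g s)"
proof -
  obtain C1 where C1: "\<And>s. 0 < s \<Longrightarrow> s < 3 \<Longrightarrow> (f s)\<^sup>2 * (s\<^sup>2 * (lam s * sqrt (lam s))) \<le> C1"
    using assms(1) unfolding tip_controlled_def by blast
  obtain C2 where C2: "\<And>s. 0 < s \<Longrightarrow> s < 3 \<Longrightarrow> (g s)\<^sup>2 * (s\<^sup>2 * (lam s * sqrt (lam s))) \<le> C2"
    using assms(2) unfolding tip_controlled_def by blast
  have "(f s + g s)\<^sup>2 * (s\<^sup>2 * (lam s * sqrt (lam s))) \<le> 2 * C1 + 2 * C2" if s: "0 < s" "s < 3" for s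
  proof -
    have "(f s + g s)\<^sup>2 \<le> 2 * (f s)\<^sup>2 + 2 * (g s)\<^sup>2"
      using sum_squares_bound[of "f s" "g s"] by (simp add: power2_sum)
    then have "(f s + g s)\<^sup>2 * (s\<^sup>2 * (lam s * sqrt (lam s))) \<le>
        (2 * (f s)\<^sup>2 + 2 * (g s)\<^sup>2) * (s\<^sup>2 * (lam s * sqrt (lam s)))"
      using lam_ge_1[OF s(1)] by (intro mult_right_mono) auto
    also have "\<dots> = 2 * ((f s)\<^sup>2 * (s\<^sup>2 * (lam s * sqrt (lam s)))) + 2 * ((g s)\<^sup>2 * (s\<^sup>2 * (lam s * sqrt (lam s))))"
      by (simp only: distrib_right mult.assoc)
    also have "\<dots> \<le> 2 * C1 + 2 * C2" using C1[OF s] C2[OF s] by simp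
    finally show ?thesis .
  qed
  then show ?thesis unfolding tip_controlled_def by blast
qed

lemma tip_controlled_mult_bounded:
  assumes "tip_controlled f" "\<And>s. 0 < s \<Longrightarrow> s < 3 \<Longrightarrow> \<bar>c s\<bar> \<le> M"
  shows "tip_controlled (\<lambda>s. c s * f s)"
proof -
  obtain C where C: "\<And>s. 0 < s \<Longrightarrow> s < 3 \<Longrightarrow> (f s)\<^sup>2 * (s\<^sup>2 * (lam s * sqrt (lam s))) \<le> C"
    using assms(1) unfolding tip_controlled_def by blast
  have "(c s * f s)\<^sup>2 * (s\<^sup>2 * (lam s * sqrt (lam s))) \<le> M\<^sup>2 * \<bar>C\<bar>" if s: "0 < s" "s < 3" for s
  proof -
    have "(c s)\<^sup>2 \<le> M\<^sup>2" using assms(2)[OF s] by (simp add: abs_le_square_iff[symmetric])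
    moreover have "(f s)\<^sup>2 * (s\<^sup>2 * (lam s * sqrt (lam s))) \<le> \<bar>C\<bar>" using C[OF s] by linarith
    ultimately have "(c s)\<^sup>2 * ((f s)\<^sup>2 * (s\<^sup>2 * (lam s * sqrt (lam s)))) \<le> M\<^sup>2 * \<bar>C\<bar>"
      using lam_ge_1[OF s(1)] by (intro mult_mono) auto
    then show ?thesis by (simp add: power_mult_distrib mult.assoc)
  qed
  then show ?thesis unfolding tip_controlled_def by blast
qed

lemma tip_controlled_minus: "tip_controlled f \<Longrightarrow> tip_controlled (\<lambda>s. - f s)"
  unfolding tip_controlled_def by simp

lemma tip_controlled_ident_mult: "tip_controlled f \<Longrightarrow> tip_controlled (\<lambda>s. s * f s)"
  by (rule tip_controlled_mult_bounded[where M=3]) auto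

text \<open>The last derivative is left without a bound here, because the coefficient of V satisfies
  one only after multiplication by s.\<close>

definition tip_C2 :: "(real \<Rightarrow> real) \<Rightarrow> (real \<Rightarrow> real) \<Rightarrow> (real \<Rightarrow> real) \<Rightarrow> bool" where
  "tip_C2 f0 f1 f2 \<longleftrightarrow>
     (\<forall>s>0. (f0 has_real_derivative f1 s) (at s)) \<and> (\<forall>s>0. (f1 has_real_derivative f2 s) (at s)) \<and>
     continuous_on {0<..} f2 \<and> tip_controlled f0 \<and> tip_controlled f1"

lemma tip_C2_zero: "tip_C2 (\<lambda>_. 0) (\<lambda>_. 0) (\<lambda>_. 0)"
  by (auto simp: tip_C2_def tip_controlled_def)

lemma tip_C2_minus:
  "tip_C2 f0 f1 f2 \<Longrightarrow> tip_C2 (\<lambda>s. - f0 s) (\<lambda>s. - f1 s) (\<lambda>s. - f2 s)"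
  by (auto simp: tip_C2_def intro!: DERIV_minus continuous_on_minus tip_controlled_minus)

lemma has_derivative_continuous_on_pos:
  "(\<And>s. s > 0 \<Longrightarrow> (f has_real_derivative f' s) (at s)) \<Longrightarrow> continuous_on {0<..} (f :: real \<Rightarrow> real)"
  by (auto simp: continuous_on_eq_continuous_at intro: DERIV_isCont)

text \<open>Data of a component \<open>f(s) + k(s) V\<close> at \<open>t = 0\<close>, where \<open>s = V = x\<^sub>1\<close>: the last derivative
  of \<open>k\<close> only enters multiplied by \<open>V\<close>, so it may be one power of \<open>s\<close> more singular.\<close>

lemma initial_data_finite:
  assumes f: "tip_C2 f0 f1 f2" and k: "tip_C2 k0 k1 k2"
    and f2: "tip_controlled f2" and k2: "tip_controlled (\<lambda>s. s * k2 s)"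
    and u: "\<And>x. x \<in> D_slice 0 \<Longrightarrow> u x = f0 (x$1) + k0 (x$1) * x$1"
    and v: "\<And>x. x \<in> D_slice 0 \<Longrightarrow> v x = k0 (x$1) - (f1 (x$1) + k1 (x$1) * x$1)"
  shows "sobolev_norm 2 (D_slice 0) u + sobolev_norm 1 (D_slice 0) v < \<infinity>"
proof -
  have df: "(f0 has_real_derivative f1 s) (at s)" "(f1 has_real_derivative f2 s) (at s)"
    "(k0 has_real_derivative k1 s) (at s)" "(k1 has_real_derivative k2 s) (at s)" if "s > 0" for s
    using f k that by (auto simp: tip_C2_def)
  have tc: "tip_controlled f0" "tip_controlled f1" "tip_controlled k0" "tip_controlled k1"
    using f k by (auto simp: tip_C2_def)
  have c: "continuous_on {0<..} f2" "continuous_on {0<..} k2" "continuous_on {0<..} f0"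
    "continuous_on {0<..} f1" "continuous_on {0<..} k0" "continuous_on {0<..} k1"
    using f k has_derivative_continuous_on_pos[OF df(1)] has_derivative_continuous_on_pos[OF df(2)]
      has_derivative_continuous_on_pos[OF df(3)] has_derivative_continuous_on_pos[OF df(4)]
    by (auto simp: tip_C2_def)
  define h where "h j s = (if j = 0 then f0 s + s * k0 s else if j = 1 then f1 s + (k0 s + s * k1 s)
      else f2 s + (k1 s + (k1 s + s * k2 s)))" for j :: nat and s
  define l where "l j s = (if j = 0 then k0 s + - (f1 s + s * k1 s) else - (f2 s + s * k2 s))" for j :: nat and s
  have ds: "((\<lambda>s. s * g s) has_real_derivative g s + s * g') (at s)"
    if "(g has_real_derivative g') (at s)" for g g' s
    using DERIV_mult[OF DERIV_ident that] by (simp add: mult.commute)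
  have "sobolev_norm 2 (D_slice 0) u < \<infinity>"
  proof (rule sobolev_norm_finite[where h=h])
    fix j :: nat and s :: real assume j: "j < 2" and s: "s > 0"
    have "((\<lambda>s. f0 s + s * k0 s) has_real_derivative f1 s + (k0 s + s * k1 s)) (at s)"
      by (intro DERIV_add ds df s)
    moreover have "((\<lambda>s. f1 s + (k0 s + s * k1 s)) has_real_derivative f2 s + (k1 s + (k1 s + s * k2 s))) (at s)"
      by (intro DERIV_add ds df s)
    ultimately show "(h j has_real_derivative h (Suc j) s) (at s)"
      using j by (cases "j = 0") (auto simp: h_def[abs_def] less_Suc_eq numeral_2_eq_2)
  next
    fix j :: nat
    have "continuous_on {0<..} (\<lambda>s. f0 s + s * k0 s)" "continuous_on {0<..} (\<lambda>s. f1 s + (k0 s + s * k1 s))"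
      "continuous_on {0<..} (\<lambda>s. f2 s + (k1 s + (k1 s + s * k2 s)))"
      by (intro continuous_intros c)+
    then show "continuous_on {0<..} (h j)"
      by (cases "j = 0"; cases "j = 1") (simp_all add: h_def[abs_def])
    have "tip_controlled (\<lambda>s. f0 s + s * k0 s)" "tip_controlled (\<lambda>s. f1 s + (k0 s + s * k1 s))"
      "tip_controlled (\<lambda>s. f2 s + (k1 s + (k1 s + s * k2 s)))"
      by (intro tip_controlled_add tip_controlled_ident_mult tc f2 k2)+
    then show "tip_controlled (h j)"
      by (cases "j = 0"; cases "j = 1") (simp_all add: h_def[abs_def])
  qed (simp add: u h_def)
  moreover have "sobolev_norm 1 (D_slice 0) v < \<infinity>"
  proof (rule sobolev_norm_finite[where h=l])
    fix j :: nat and s :: real assume j: "j < 1" and s: "s > 0"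
    have "((\<lambda>s. k0 s + - (f1 s + s * k1 s)) has_real_derivative k1 s + - (f2 s + (k1 s + s * k2 s))) (at s)"
      by (intro DERIV_add DERIV_minus ds df s)
    moreover have "k1 s + - (f2 s + (k1 s + s * k2 s)) = - (f2 s + s * k2 s)" by simp
    ultimately show "(l j has_real_derivative l (Suc j) s) (at s)"
      using j by (simp only: l_def[abs_def]) simp
  next
    fix j :: nat
    have "continuous_on {0<..} (\<lambda>s. k0 s + - (f1 s + s * k1 s))" "continuous_on {0<..} (\<lambda>s. - (f2 s + s * k2 s))"
      by (intro continuous_intros c)+
    then show "continuous_on {0<..} (l j)" by (cases "j = 0") (simp_all only: l_def[abs_def] simp_thms if_True if_False)
    have "tip_controlled (\<lambda>s. k0 s + - (f1 s + s * k1 s))" "tip_controlled (\<lambda>s. - (f2 s + s * k2 s))"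
      by (intro tip_controlled_add tip_controlled_minus tip_controlled_ident_mult tc f2 k2)+
    then show "tip_controlled (l j)" by (cases "j = 0") (simp_all only: l_def[abs_def] simp_thms if_True if_False)
  qed (simp add: v l_def)
  ultimately show ?thesis by (simp add: ennreal_add_eq_top less_top)
qed

text \<open>The right-hand side is \<open>sgn t\<close> times the second x1-derivative of g_00 at u
  = s, where V = s + 2t. For s this small V has the sign of t and size at least |t|. The term
  \<open>wgt\<close> is absorbed because |t| qf \<ge> 1: from sqrt s \<le> |t|/12 and s lam \<le> 3
  sqrt s one gets 4 s lam \<le> |t|, whence the 144.\<close>

lemma second_derivative_lower_bound:
  assumes t: "t \<noteq> 0" "\<bar>t\<bar> < 1" and s: "0 < s" "s \<le> t\<^sup>2 / 144"
  shows "\<bar>t\<bar> / (16 * s * sqrt (lam s)) \<le> sgn t * (- wgt s + (s + 2 * t) * (qf s * wgt s))"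
proof -
  have l: "lam s \<ge> 1" by (rule lam_ge_1[OF s(1)])
  have t2: "t\<^sup>2 \<le> \<bar>t\<bar>" using mult_right_mono[of "\<bar>t\<bar>" 1 "\<bar>t\<bar>"] t by (simp add: power2_eq_square)
  have st: "s \<le> \<bar>t\<bar>" "s \<le> 1" using s t t2 by auto
  have "sqrt s \<le> sqrt (t\<^sup>2 / 144)" using s by simp
  then have sq: "sqrt s \<le> \<bar>t\<bar> / 12" by (simp add: real_sqrt_divide)
  have ss: "s = sqrt s * sqrt s" "sqrt s > 0" using s by auto
  have "s * lam s \<le> s * (1 + 2 / sqrt s)" using lam_le[OF s(1)] s by (intro mult_left_mono) auto
  also have "\<dots> = s + 2 * (s / sqrt s)" by (simp add: distrib_left)
  also have "\<dots> = s + 2 * sqrt s" using s by (simp add: real_div_sqrt)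
  also have "\<dots> \<le> 3 * sqrt s"
  proof -
    have "sqrt s * sqrt s \<le> 1 * sqrt s" using st ss(2) by (intro mult_right_mono) auto
    then show ?thesis using ss(1) by linarith
  qed
  finally have sl: "4 * (s * lam s) \<le> \<bar>t\<bar>" using sq by linarith
  have q1: "1 / (2 * s * (1 + s) * lam s) \<le> qf s" using s by (simp add: qf_def)
  have "1 \<le> \<bar>t\<bar> * qf s"
  proof -
    have "2 * s * (1 + s) * lam s \<le> 4 * (s * lam s)"
      using mult_right_mono[of "1 + s" 2 "2 * s * lam s"] s st l by (simp add: mult_ac)
    then have le: "2 * s * (1 + s) * lam s \<le> \<bar>t\<bar>" using sl by linarith
    moreover have "0 < 2 * s * (1 + s) * lam s" using s l by (simp add: add_pos_pos)
    ultimately have "1 \<le> \<bar>t\<bar> * (1 / (2 * s * (1 + s) * lam s))" by (simp add: le_divide_eq)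
    also have "\<dots> \<le> \<bar>t\<bar> * qf s" using q1 by (intro mult_left_mono) auto
    finally show ?thesis .
  qed
  note tq = this
  have qp: "qf s > 0" by (rule qf_pos[OF s(1)])
  have "\<bar>t\<bar> * qf s \<le> sgn t * (- 1 + (s + 2 * t) * qf s)"
  proof (cases "t > 0")
    case True
    have "t * qf s \<le> - 1 + (2 * t) * qf s" using tq True by simp
    also have "\<dots> \<le> - 1 + (s + 2 * t) * qf s" using s qp by simp
    finally show ?thesis using True by simp
  next
    case False
    then have "t < 0" using t by simp
    have "(- t) * qf s \<le> 1 + (- 2 * t - s) * qf s"
    proof -
      have "(- t) * qf s \<le> (- 2 * t - s) * qf s" using qp st \<open>t < 0\<close> by (intro mult_right_mono) auto
      then show ?thesis by linarith
    qed
    then show ?thesis using \<open>t < 0\<close> by (simp add: algebra_simps)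
  qed
  from mult_right_mono[OF this less_imp_le[OF wgt_pos[OF s(1)]]]
  have 1: "\<bar>t\<bar> * (qf s * wgt s) \<le> sgn t * (- wgt s + (s + 2 * t) * (qf s * wgt s))"
    by (simp add: algebra_simps)
  have "1 / (16 * s * sqrt (lam s)) \<le> qf s * wgt s"
  proof -
    have "1 / (2 * s * (1 + s) * lam s) * wgt s \<le> qf s * wgt s"
      using q1 wgt_pos[OF s(1)] by (intro mult_right_mono) auto
    moreover have "1 / (2 * s * (1 + s) * lam s) * wgt s = 1 / (2 * s * ((1 + s) ^ 3 * sqrt (lam s)))"
    proof -
      have "1 / (2 * s * u * (y * y)) * (y / u\<^sup>2) = 1 / (2 * s * (u ^ 3 * y))" if "u > 0" "y > 0" for u y :: real
        using that s by (simp add: field_simps power2_eq_square power3_eq_cube)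
      from this[of "1 + s" "sqrt (lam s)"] show ?thesis using s l by (simp add: wgt_def)
    qed
    moreover have "1 / (16 * s * sqrt (lam s)) \<le> 1 / (2 * s * ((1 + s) ^ 3 * sqrt (lam s)))"
    proof (rule divide_left_mono)
      have "(1 + s) ^ 3 \<le> 2 ^ 3" using s st by (intro power_mono) auto
      then show "2 * s * ((1 + s) ^ 3 * sqrt (lam s)) \<le> 16 * s * sqrt (lam s)"
        using mult_right_mono[of "(1 + s) ^ 3" 8 "2 * s * sqrt (lam s)"] s l by (simp add: mult_ac)
    qed (use s l in \<open>auto simp: add_pos_pos\<close>)
    ultimately show ?thesis by linarith
  qed
  then have "\<bar>t\<bar> * (1 / (16 * s * sqrt (lam s))) \<le> \<bar>t\<bar> * (qf s * wgt s)" by (intro mult_left_mono) auto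
  then show ?thesis using 1 by simp
qed

section \<open>The counterexample\<close>

context profile begin

definition "rr s = m s / L s"
definition "e s = - (qf s + rr s) / 2 * b s"
definition "A s = (L s)\<^sup>2 * exp (2 * \<beta> s)"
definition "B s = (L s)\<^sup>2 * exp (- 2 * \<beta> s)"
definition "G p = (if p$0 < 1 then pw_matrix (L (p$1 - p$0)) (m (p$1 - p$0)) (A (p$1 - p$0)) (B (p$1 - p$0)) (p$1 + p$0)
   else pw_matrix 1 0 1 1 (p$1 + p$0))" for p :: "real^4"

lemma L_pos: "s > 0 \<Longrightarrow> L s > 0"
  using L_ge_1[of s] by simp

lemma der_A:
  assumes s: "s > 0"
  shows "(A has_real_derivative 2 * (rr s + b s) * A s) (at s)"
proof -
  have "(A has_real_derivative (2 * L s * m s) * exp (2 * \<beta> s) + (exp (2 * \<beta> s) * (2 * b s)) * (L s)\<^sup>2) (at s)"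
    unfolding A_def[abs_def]
    by (auto intro!: derivative_eq_intros der_L der_\<beta> s)
  moreover have "(2 * L s * m s) * exp (2 * \<beta> s) + (exp (2 * \<beta> s) * (2 * b s)) * (L s)\<^sup>2 = 2 * (rr s + b s) * A s"
    using L_pos[OF s] by (simp add: A_def rr_def field_simps power2_eq_square)
  ultimately show ?thesis by simp
qed

lemma der_B:
  assumes s: "s > 0"
  shows "(B has_real_derivative 2 * (rr s - b s) * B s) (at s)"
proof -
  have "(B has_real_derivative (2 * L s * m s) * exp (- 2 * \<beta> s) + (exp (- 2 * \<beta> s) * (- 2 * b s)) * (L s)\<^sup>2) (at s)"
    unfolding B_def[abs_def]
    by (auto intro!: derivative_eq_intros der_L der_\<beta> s)
  moreover have "(2 * L s * m s) * exp (- 2 * \<beta> s) + (exp (- 2 * \<beta> s) * (- 2 * b s)) * (L s)\<^sup>2 = 2 * (rr s - b s) * B s"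
    using L_pos[OF s] by (simp add: B_def rr_def field_simps power2_eq_square)
  ultimately show ?thesis by simp
qed

lemma smooth_rr: "Ck_real k {0<..} rr"
  unfolding rr_def[abs_def] by (intro Ck_real_divide smooth) (use L_pos in force)

lemma smooth_A: "Ck_real k {0<..} A"
  by (rule Ck_real_linear_ode[of _ _ "\<lambda>s. 2 * (rr s + b s)"], rule der_A, simp,
      intro Ck_real_mult Ck_real_const Ck_real_add smooth smooth_rr)

lemma smooth_B: "Ck_real k {0<..} B"
  by (rule Ck_real_linear_ode[of _ _ "\<lambda>s. 2 * (rr s - b s)"], rule der_B, simp,
      intro Ck_real_mult Ck_real_const Ck_real_diff smooth smooth_rr)

lemma der_rr:
  assumes s: "s > 0"
  shows "(rr has_real_derivative - (b s)\<^sup>2 - (rr s)\<^sup>2) (at s)"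
proof -
  have "(rr has_real_derivative (- wgt s * L s - m s * m s) / (L s * L s)) (at s)"
    unfolding rr_def[abs_def] using L_pos[OF s] by (intro DERIV_divide der_m der_L s) auto
  moreover have "(- wgt s * L s - m s * m s) / (L s * L s) = - (b s)\<^sup>2 - (rr s)\<^sup>2"
    using L_pos[OF s] by (simp add: b_sq[OF s, symmetric] rr_def field_simps power2_eq_square)
  ultimately show ?thesis by simp
qed

lemma der_b': "s > 0 \<Longrightarrow> (b has_real_derivative e s) (at s)"
  using der_b by (simp add: e_def rr_def)

lemma AB_pos: "s > 0 \<Longrightarrow> A s > 0" "s > 0 \<Longrightarrow> B s > 0"
  using L_pos[of s] by (simp_all add: A_def B_def)

lemma AB_mult: "s > 0 \<Longrightarrow> A s * B s = L s ^ 4"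
proof -
  have "exp (2 * \<beta> s) * exp (- 2 * \<beta> s) = 1" by (simp flip: exp_add)
  then show ?thesis by (simp add: A_def B_def power2_eq_square power4_eq_xxxx algebra_simps)
qed

section \<open>The metric glued from its past and future pieces\<close>

lemma plane_wave_past: "plane_wave (D_dom \<inter> {p. p$0 < 1}) {0<..} G L m b e A B"
proof
  show "open (D_dom \<inter> {p. p$0 < 1})"
    by (intro open_Int open_D_dom open_Collect_less continuous_intros)
qed (use D_dom_retarded_pos der_L der_b' der_A der_B AB_mult AB_pos L_pos smooth smooth_A smooth_B
      der_m b_sq in \<open>auto simp: G_def rr_def\<close>)

lemma plane_wave_future:
  "plane_wave (D_dom \<inter> {p. 1 < p$0}) UNIV G (\<lambda>_. 1) (\<lambda>_. 0) (\<lambda>_. 0) (\<lambda>_. 0) (\<lambda>_. 1) (\<lambda>_. 1)"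
proof
  show "open (D_dom \<inter> {p. 1 < p$0})"
    by (intro open_Int open_D_dom open_Collect_less continuous_intros)
qed (auto simp: G_def intro: Ck_real_const)

lemma D_dom_split: "D_dom = (D_dom \<inter> {p. p$0 < 1}) \<union> (D_dom \<inter> {p. 1 < p$0})"
  using D_dom_time_ne_1 by fastforce

lemma G_lorentzian: "lorentzian_on D_dom G"
proof -
  note 1 = plane_wave.lorentzian[OF plane_wave_past] and 2 = plane_wave.lorentzian[OF plane_wave_future]
  have "smooth_on D_dom (\<lambda>p. G p $ \<alpha> $ \<nu>)" for \<alpha> \<nu>
    using 1 2 Ck_on_Un[OF plane_wave.open_S[OF plane_wave_past] plane_wave.open_S[OF plane_wave_future],
        folded D_dom_split]
    unfolding lorentzian_on_def smooth_on_def by blast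
  moreover have "transpose (G p) = G p \<and> (\<exists>P. invertible P \<and> transpose P ** G p ** P = minkowski)"
    if "p \<in> D_dom" for p
    using 1 2 that D_dom_split unfolding lorentzian_on_def by blast
  ultimately show ?thesis unfolding lorentzian_on_def by blast
qed

lemma G_ricci: "p \<in> D_dom \<Longrightarrow> ricci G \<mu> \<nu> p = 0"
  using plane_wave.ricci_flat[OF plane_wave_past] plane_wave.ricci_flat[OF plane_wave_future] D_dom_split
  by blast

lemma G_wave:
  "p \<in> D_dom \<Longrightarrow> (\<Sum>\<alpha>\<in>UNIV. partial \<alpha> (\<lambda>q. sqrt \<bar>det (G q)\<bar> * metric_inv G \<alpha> \<nu> q) p) = 0"
  using plane_wave.wave_coordinates[OF plane_wave_past] plane_wave.wave_coordinates[OF plane_wave_future]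
    D_dom_split by blast

lemma b_sq_le: "s > 0 \<Longrightarrow> (b s)\<^sup>2 \<le> sqrt (lam s)"
  using b_sq[of s] L_ge_1[of s] wgt_le_sqrt[of s] mult_left_mono[of 1 "L s" "(b s)\<^sup>2"] by simp

lemma b_le_lam: "s > 0 \<Longrightarrow> b s \<le> lam s"
proof -
  assume s: "s > 0"
  have "(b s)\<^sup>2 \<le> lam s" using b_sq_le[OF s] sqrt_lam_le[OF s] by linarith
  also have "\<dots> \<le> (lam s)\<^sup>2" using lam_ge_1[OF s] by (simp add: power2_eq_square)
  finally show ?thesis by (rule power2_le_imp_le) (use lam_ge_1[OF s] in simp)
qed

text \<open>A common majorant, up to constants, for what enters the second derivatives of the
  transverse components: \<open>lam\<close> dominates 1, \<open>b\<close> and its square, and the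
  other term is the singular part of b'.\<close>

definition "gam s = lam s + b s / (s * lam s)"

lemma gam_ge: "s > 0 \<Longrightarrow> lam s \<le> gam s" "s > 0 \<Longrightarrow> b s / (s * lam s) \<le> gam s" "s > 0 \<Longrightarrow> 1 \<le> gam s"
  using lam_ge_1[of s] b_pos[of s] by (simp_all add: gam_def add_increasing2)

text \<open>The singular term is where the size of \<beta>' is decisive: after multiplication by the
  weight it leaves b^2 / sqrt lam, at most 1. For the other term s lam^2 \<le> 2 s + 8 \<le> 14; the
  constant is 2 * 14^2 + 2.\<close>

lemma tip_controlled_gam: "tip_controlled gam"
proof -
  have "(gam s)\<^sup>2 * (s\<^sup>2 * (lam s * sqrt (lam s))) \<le> 394" if s: "0 < s" "s < 3" for s
  proof -
    have l: "lam s \<ge> 1" "sqrt (lam s) > 0" using lam_ge_1[OF s(1)] by auto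
    have "(gam s)\<^sup>2 \<le> 2 * (lam s)\<^sup>2 + 2 * (b s / (s * lam s))\<^sup>2"
      using sum_squares_bound[of "lam s" "b s / (s * lam s)"] by (simp add: gam_def power2_sum)
    then have "(gam s)\<^sup>2 * (s\<^sup>2 * (lam s * sqrt (lam s))) \<le>
       (2 * (lam s)\<^sup>2 + 2 * (b s / (s * lam s))\<^sup>2) * (s\<^sup>2 * (lam s * sqrt (lam s)))"
      using l by (intro mult_right_mono) auto
    also have "\<dots> = 2 * ((lam s)\<^sup>2 * (s\<^sup>2 * (lam s * sqrt (lam s)))) + 2 * ((b s)\<^sup>2 * sqrt (lam s) / lam s)"
      using s l by (simp add: distrib_right power_divide power_mult_distrib power2_eq_square)
    also have "(lam s)\<^sup>2 * (s\<^sup>2 * (lam s * sqrt (lam s))) \<le> 196"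
    proof -
      have "lam s * sqrt (lam s) \<le> lam s * lam s" using sqrt_lam_le[OF s(1)] l by (intro mult_left_mono) auto
      then have "(lam s)\<^sup>2 * (s\<^sup>2 * (lam s * sqrt (lam s))) \<le> (lam s)\<^sup>2 * (s\<^sup>2 * (lam s * lam s))"
        by (intro mult_left_mono[OF mult_left_mono]) auto
      also have "\<dots> = (s * (lam s)\<^sup>2)\<^sup>2" by (simp add: power2_eq_square mult_ac)
      also have "\<dots> \<le> 14\<^sup>2"
      proof (rule power_mono)
        have "(lam s)\<^sup>2 \<le> (1 + 2 / sqrt s)\<^sup>2" using lam_le[OF s(1)] l by (intro power_mono) auto
        also have "\<dots> \<le> 2 * 1\<^sup>2 + 2 * (2 / sqrt s)\<^sup>2"
          using sum_squares_bound[of 1 "2 / sqrt s"] by (simp add: power2_sum)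
        also have "\<dots> = 2 + 8 / s" using s by (simp add: power_divide)
        finally have "s * (lam s)\<^sup>2 \<le> s * (2 + 8 / s)" using s by (intro mult_left_mono) auto
        also have "\<dots> = 2 * s + 8" using s by (simp add: distrib_left)
        finally show "s * (lam s)\<^sup>2 \<le> 14" using s by simp
      qed (use s in simp)
      finally show ?thesis by simp
    qed
    also have "(b s)\<^sup>2 * sqrt (lam s) / lam s \<le> 1"
    proof -
      have "(b s)\<^sup>2 * sqrt (lam s) \<le> sqrt (lam s) * sqrt (lam s)"
        using b_sq_le[OF s(1)] l by (intro mult_right_mono) auto
      then show ?thesis using l by (simp add: divide_le_eq)
    qed
    finally show ?thesis by simp
  qed
  then show ?thesis unfolding tip_controlled_def by blast
qed

lemma tip_controlledI:
  assumes "\<And>s. 0 < s \<Longrightarrow> s < 3 \<Longrightarrow> \<bar>h s\<bar> \<le> C * gam s"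
  shows "tip_controlled h"
proof -
  have "tip_controlled (\<lambda>s. (h s / gam s) * gam s)"
  proof (rule tip_controlled_mult_bounded[OF tip_controlled_gam, where M=C])
    show "\<bar>h s / gam s\<bar> \<le> C" if "0 < s" "s < 3" for s
      using assms[OF that] gam_ge(3)[OF that(1)] by (simp add: divide_le_eq)
  qed
  then show ?thesis
  proof (rule tip_controlled_cong)
    show "h s = h s / gam s * gam s" if "0 < s" "s < 3" for s
      using gam_ge(3)[OF that(1)] by simp
  qed
qed

lemma tip_controlled_bounded:
  assumes "\<And>s. 0 < s \<Longrightarrow> s < 3 \<Longrightarrow> \<bar>h s\<bar> \<le> C"
  shows "tip_controlled h"
proof (rule tip_controlledI[where C="\<bar>C\<bar>"])
  fix s :: real assume s: "0 < s" "s < 3"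
  have "\<bar>h s\<bar> \<le> \<bar>C\<bar> * 1" using assms[OF s] by linarith
  also have "\<dots> \<le> \<bar>C\<bar> * gam s" by (rule mult_left_mono[OF gam_ge(3)[OF s(1)]]) simp
  finally show "\<bar>h s\<bar> \<le> \<bar>C\<bar> * gam s" .
qed

lemma tip_controlled_wgt: "tip_controlled wgt"
proof (rule tip_controlledI[where C=1])
  show "\<bar>wgt s\<bar> \<le> 1 * gam s" if "0 < s" "s < 3" for s
    using wgt_le_sqrt[OF that(1)] sqrt_lam_le[OF that(1)] gam_ge(1)[OF that(1)] wgt_pos[OF that(1)] by simp
qed

lemma rr_bounds: "s > 0 \<Longrightarrow> 0 \<le> rr s \<and> rr s \<le> 5"
proof -
  assume s: "s > 0"
  have "m s / L s \<le> m s / 1" using L_ge_1[OF s] m_bounds[OF s] by (intro divide_left_mono) auto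
  then show ?thesis using L_ge_1[OF s] m_bounds[OF s] by (auto simp: rr_def)
qed

lemma tip_C2_L: "tip_C2 L m (\<lambda>s. - wgt s)"
  unfolding tip_C2_def
proof (intro conjI allI impI)
  show "continuous_on {0<..} (\<lambda>s. - wgt s)" using Ck_real_minus[OF smooth_wgt[of 0]] by simp
  show "tip_controlled L"
    by (rule tip_controlled_bounded[where C=16]) (use L_le L_ge_1 in fastforce)
  show "tip_controlled m"
    by (rule tip_controlled_bounded[where C=5]) (use m_bounds in fastforce)
qed (auto intro: der_L der_m)

lemma tip_C2_m: "tip_C2 m (\<lambda>s. - wgt s) (\<lambda>s. qf s * wgt s)"
  unfolding tip_C2_def
proof (intro conjI allI impI)
  show "((\<lambda>s. - wgt s) has_real_derivative qf s * wgt s) (at s)" if "s > 0" for s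
    using DERIV_minus[OF der_wgt[OF that]] by simp
  show "continuous_on {0<..} (\<lambda>s. qf s * wgt s)" using Ck_real_mult[OF smooth_qf[of 0] smooth_wgt[of 0]] by simp
  show "tip_controlled (\<lambda>s. - wgt s)" by (rule tip_controlled_minus[OF tip_controlled_wgt])
qed (use tip_C2_L in \<open>auto intro: der_m simp: tip_C2_def\<close>)

text \<open>The effect special to t = 0: there V = s, and s qf is bounded, so the singular L'''
  occurs only in a product no larger than a multiple of \<open>wgt\<close>.\<close>

lemma tip_controlled_qf_wgt: "tip_controlled (\<lambda>s. s * (qf s * wgt s))"
proof -
  have "tip_controlled (\<lambda>s. (s * qf s) * wgt s)"
  proof (rule tip_controlled_mult_bounded[OF tip_controlled_wgt, where M=7])
    show "\<bar>s * qf s\<bar> \<le> 7" if s: "0 < s" "s < 3" for s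
    proof -
      have "s * (2 / u + 1 / (2 * s * u * l)) = 2 * s / u + 1 / (2 * (u * l))" if "u > 0" "l > 0" for u l
        using s that by (simp add: field_simps)
      from this[of "1 + s" "lam s"] have "s * qf s = 2 * s / (1 + s) + 1 / (2 * ((1 + s) * lam s))"
        using s lam_ge_1[OF s(1)] by (simp add: qf_def)
      moreover have "2 * s / (1 + s) \<le> 2" using s by (simp add: divide_le_eq)
      moreover have "1 / (2 * ((1 + s) * lam s)) \<le> 1"
        using s lam_ge_1[OF s(1)] mult_mono[of 1 "1 + s" 1 "lam s"] by (simp add: divide_le_eq)
      moreover have "s * qf s > 0" using qf_pos s by simp
      ultimately show ?thesis by simp
    qed
  qed
  then show ?thesis by (simp add: mult.assoc)
qed

lemma AB_le:
  assumes "0 < s" "s < 3"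
  shows "A s \<le> 256 * exp 64" "B s \<le> 256 * exp 64"
proof -
  have "(L s)\<^sup>2 \<le> 16\<^sup>2" using L_le[OF assms] L_ge_1[OF assms(1)] by (intro power_mono) auto
  moreover have "exp (2 * \<beta> s) \<le> exp 64" "exp (- 2 * \<beta> s) \<le> exp 64"
    using \<beta>_bound[OF assms] by (auto simp: abs_le_iff)
  ultimately show "A s \<le> 256 * exp 64" "B s \<le> 256 * exp 64"
    unfolding A_def B_def by (auto intro!: mult_mono)
qed

text \<open>The quantity inside the absolute value is X''/X for X = L^2 exp (2 z \<beta>), so z = 1
  and z = -1 treat both transverse components. Every term is a multiple of \<open>gam\<close>; the
  constants add up to 268.\<close>

lemma quadratic_bound:
  assumes s: "0 < s" "s < 3" and z: "z = 1 \<or> z = -1"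
  shows "\<bar>2 * (- (b s)\<^sup>2 - (rr s)\<^sup>2 + z * e s) + 4 * (rr s + z * b s)\<^sup>2\<bar> \<le> 300 * gam s"
proof -
  have l: "lam s \<ge> 1" by (rule lam_ge_1[OF s(1)])
  have b2: "(b s)\<^sup>2 \<le> gam s" "b s \<le> gam s" "0 < b s"
    using b_sq_le[OF s(1)] sqrt_lam_le[OF s(1)] b_le_lam[OF s(1)] gam_ge(1)[OF s(1)] b_pos[OF s(1)] by auto
  have r: "0 \<le> rr s" "rr s \<le> 5" using rr_bounds[OF s(1)] by auto
  have r2: "(rr s)\<^sup>2 \<le> 25 * gam s"
  proof -
    have "(rr s)\<^sup>2 \<le> 5\<^sup>2" using r by (intro power_mono) auto
    then show ?thesis using gam_ge(3)[OF s(1)] by simp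
  qed
  have sq: "(rr s + z * b s)\<^sup>2 \<le> 2 * (rr s)\<^sup>2 + 2 * (b s)\<^sup>2"
    using sum_squares_bound[of "rr s" "z * b s"] z by (auto simp: power2_sum power_mult_distrib power2_diff)
  have qb: "\<bar>e s\<bar> \<le> 4 * gam s"
  proof -
    have "qf s * b s \<le> 3 * gam s"
    proof -
      have "2 / (1 + s) * b s \<le> 2 * b s" using b2 s by (intro mult_right_mono) (auto simp: divide_le_eq)
      moreover have "1 / (2 * s * (1 + s) * lam s) * b s \<le> b s / (s * lam s)"
      proof -
        have "1 / (2 * s * (1 + s) * lam s) \<le> 1 / (s * lam s)"
          using s l mult_right_mono[of 1 "2 * (1 + s)" "s * lam s"]
          by (intro divide_left_mono) (auto simp: mult_ac add_pos_pos)
        then have "1 / (2 * s * (1 + s) * lam s) * b s \<le> 1 / (s * lam s) * b s"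
          using b2 by (intro mult_right_mono) auto
        then show ?thesis by simp
      qed
      ultimately show ?thesis using b2 gam_ge(2)[OF s(1)] by (simp add: qf_def distrib_right)
    qed
    moreover have "rr s * b s \<le> 5 * gam s" using r b2 by (intro mult_mono) auto
    moreover have "\<bar>e s\<bar> = (qf s * b s + rr s * b s) / 2"
      using qf_pos[OF s(1)] r b2 by (simp add: e_def abs_mult distrib_right add_divide_distrib)
    ultimately show ?thesis by simp
  qed
  have ze: "\<bar>z * e s\<bar> = \<bar>e s\<bar>" using z by auto
  have "\<bar>2 * (- (b s)\<^sup>2 - (rr s)\<^sup>2 + z * e s) + 4 * (rr s + z * b s)\<^sup>2\<bar> \<le>
     2 * (b s)\<^sup>2 + 2 * (rr s)\<^sup>2 + 2 * \<bar>z * e s\<bar> + 4 * (rr s + z * b s)\<^sup>2"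
  proof -
    have "\<bar>2 * (- x - y + v) + 4 * q\<bar> \<le> 2 * x + 2 * y + 2 * \<bar>v\<bar> + 4 * q"
      if "x \<ge> 0" "y \<ge> 0" "q \<ge> 0" for x y v q :: real
      using that by (auto simp: abs_if)
    then show ?thesis by simp
  qed
  also have "\<dots> \<le> 300 * gam s" using sq qb ze b2 r2 by linarith
  finally show ?thesis .
qed

lemma tip_C2_quadratic:
  assumes z: "z = 1 \<or> z = -1"
    and X: "\<And>s. s > 0 \<Longrightarrow> (X has_real_derivative 2 * (rr s + z * b s) * X s) (at s)"
    and Xb: "\<And>s. 0 < s \<Longrightarrow> s < 3 \<Longrightarrow> \<bar>X s\<bar> \<le> M"
  shows "\<exists>X1 X2. tip_C2 X X1 X2 \<and> tip_controlled X2 \<and> (\<forall>s. X1 s = 2 * (rr s + z * b s) * X s)"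
proof -
  define X1 where "X1 s = 2 * (rr s + z * b s) * X s" for s
  define Y where "Y s = 2 * (- (b s)\<^sup>2 - (rr s)\<^sup>2 + z * e s) + 4 * (rr s + z * b s)\<^sup>2" for s
  define X2 where "X2 s = X s * Y s" for s
  have cX: "continuous_on {0<..} X" by (rule has_derivative_continuous_on_pos[OF X])
  have cb: "continuous_on {0<..} b" by (rule has_derivative_continuous_on_pos[OF der_b'])
  have cr: "continuous_on {0<..} rr" by (rule has_derivative_continuous_on_pos[OF der_rr])
  have ce: "continuous_on {0<..} e"
    unfolding e_def[abs_def] using smooth_qf[of 0] by (intro continuous_intros cb cr) auto
  have tX: "tip_controlled X" by (rule tip_controlled_bounded[OF Xb])
  have tX1: "tip_controlled X1"
  proof (rule tip_controlledI[where C="12 * \<bar>M\<bar>"])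
    fix s :: real assume s: "0 < s" "s < 3"
    have "\<bar>rr s + z * b s\<bar> \<le> 6 * gam s"
      using rr_bounds[OF s(1)] b_le_lam[OF s(1)] b_pos[OF s(1)] gam_ge(1,3)[OF s(1)] z by auto
    then have "\<bar>rr s + z * b s\<bar> * \<bar>X s\<bar> \<le> (6 * gam s) * \<bar>M\<bar>"
      using Xb[OF s] by (intro mult_mono) auto
    moreover have "\<bar>X1 s\<bar> = 2 * (\<bar>rr s + z * b s\<bar> * \<bar>X s\<bar>)" unfolding X1_def abs_mult by simp
    ultimately show "\<bar>X1 s\<bar> \<le> 12 * \<bar>M\<bar> * gam s" by (simp add: mult_ac)
  qed
  have tX2: "tip_controlled X2"
  proof -
    have "tip_controlled Y" unfolding Y_def[abs_def] by (rule tip_controlledI[OF quadratic_bound[OF _ _ z]])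
    then show ?thesis unfolding X2_def[abs_def] by (rule tip_controlled_mult_bounded[OF _ Xb])
  qed
  have dX1: "(X1 has_real_derivative X2 s) (at s)" if s: "s > 0" for s
  proof -
    have "((\<lambda>s. 2 * (rr s + z * b s)) has_real_derivative 2 * (- (b s)\<^sup>2 - (rr s)\<^sup>2 + z * e s)) (at s)"
      by (intro DERIV_cmult DERIV_add der_rr der_b' s)
    from DERIV_mult[OF this X[OF s]] show ?thesis
      unfolding X1_def[abs_def] X2_def Y_def
      by (rule DERIV_cong) (simp add: algebra_simps power2_eq_square)
  qed
  have "tip_C2 X X1 X2"
    unfolding tip_C2_def
  proof (intro conjI allI impI)
    show "continuous_on {0<..} X2" unfolding X2_def[abs_def] Y_def
      by (intro continuous_intros cX cb cr ce)
  qed (use X dX1 tX tX1 in \<open>auto simp: X1_def\<close>)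
  then show ?thesis using tX2 X1_def by blast
qed

lemma spacetime_point_in_past: "x \<in> D_slice t \<Longrightarrow> t < 1 \<Longrightarrow> spacetime_point t x \<in> D_dom \<inter> {p. p$0 < 1}"
  by (auto simp: D_slice_def spacetime_point_def)

lemma spacetime_point_nth: "spacetime_point t x $ 0 = t" "spacetime_point t x $ 1 = x$1"
  by (simp_all add: spacetime_point_def)

lemma G_initial_data:
  "sobolev_norm 2 (D_slice 0) (at_time 0 (\<lambda>p. G p $ \<alpha> $ \<nu>))
     + sobolev_norm 1 (D_slice 0) (at_time 0 (partial 0 (\<lambda>p. G p $ \<alpha> $ \<nu>))) < \<infinity>"
proof -
  interpret pw: plane_wave "D_dom \<inter> {p. p$0 < 1}" "{0<..}" G L m b e A B by (rule plane_wave_past)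
  obtain A1 A2 where A: "tip_C2 A A1 A2" "tip_controlled A2" "\<And>s. A1 s = 2 * (rr s + b s) * A s"
  proof -
    have "\<exists>A1 A2. tip_C2 A A1 A2 \<and> tip_controlled A2 \<and> (\<forall>s. A1 s = 2 * (rr s + 1 * b s) * A s)"
    proof (rule tip_C2_quadratic)
      show "\<bar>A s\<bar> \<le> 256 * exp 64" if "0 < s" "s < 3" for s
        using AB_le(1)[OF that] AB_pos(1)[OF that(1)] by simp
    qed (use der_A in simp_all)
    then show ?thesis using that by auto
  qed
  obtain B1 B2 where B: "tip_C2 B B1 B2" "tip_controlled B2" "\<And>s. B1 s = 2 * (rr s - b s) * B s"
  proof -
    have "\<exists>B1 B2. tip_C2 B B1 B2 \<and> tip_controlled B2 \<and> (\<forall>s. B1 s = 2 * (rr s + - 1 * b s) * B s)"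
    proof (rule tip_C2_quadratic)
      show "\<bar>B s\<bar> \<le> 256 * exp 64" if "0 < s" "s < 3" for s
        using AB_le(2)[OF that] AB_pos(2)[OF that(1)] by simp
    qed (use der_B in simp_all)
    then show ?thesis using that by auto
  qed
  have r: "pw.r = rr" by (simp add: pw.r_def[abs_def] rr_def[abs_def])
  have "\<exists>f1 f2. tip_C2 (pw.g0 \<alpha> \<nu>) f1 f2 \<and> tip_controlled f2 \<and> f1 = pw.dg0 \<alpha> \<nu>"
  proof -
    consider "\<alpha> = 0 \<and> \<nu> = 0" | "\<alpha> = 1 \<and> \<nu> = 1" | "\<alpha> = 2 \<and> \<nu> = 2" | "\<alpha> = 3 \<and> \<nu> = 3"
      | "\<not> (\<alpha> = 0 \<and> \<nu> = 0)" "\<not> (\<alpha> = 1 \<and> \<nu> = 1)" "\<not> (\<alpha> = 2 \<and> \<nu> = 2)" "\<not> (\<alpha> = 3 \<and> \<nu> = 3)"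
      by blast
    then show ?thesis
    proof cases
      case 1
      then have "pw.g0 \<alpha> \<nu> = (\<lambda>s. - L s)" "pw.dg0 \<alpha> \<nu> = (\<lambda>s. - m s)"
        by (simp_all add: pw.g0_def pw.dg0_def fun_eq_iff)
      then show ?thesis
        using tip_C2_minus[OF tip_C2_L] tip_controlled_minus[OF tip_controlled_minus[OF tip_controlled_wgt]]
        by (intro exI[of _ "\<lambda>s. - m s"] exI[of _ "\<lambda>s. - (- wgt s)"]) simp
    next
      case 2
      then have "pw.g0 \<alpha> \<nu> = L" "pw.dg0 \<alpha> \<nu> = m"
        by (simp_all add: pw.g0_def pw.dg0_def fun_eq_iff)
      then show ?thesis using tip_C2_L tip_controlled_minus[OF tip_controlled_wgt]
        by (intro exI[of _ m] exI[of _ "\<lambda>s. - wgt s"]) simp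
    next
      case 3
      then have "pw.g0 \<alpha> \<nu> = A" "pw.dg0 \<alpha> \<nu> = A1"
        by (simp_all add: pw.g0_def pw.dg0_def fun_eq_iff A r)
      then show ?thesis using A(1,2) by (intro exI[of _ A1] exI[of _ A2]) simp
    next
      case 4
      then have "pw.g0 \<alpha> \<nu> = B" "pw.dg0 \<alpha> \<nu> = B1"
        by (simp_all add: pw.g0_def pw.dg0_def fun_eq_iff B r)
      then show ?thesis using B(1,2) by (intro exI[of _ B1] exI[of _ B2]) simp
    next
      case 5
      then have "pw.g0 \<alpha> \<nu> = (\<lambda>_. 0)" "pw.dg0 \<alpha> \<nu> = (\<lambda>_. 0)"
        by (simp_all only: pw.g0_def pw.dg0_def fun_eq_iff if_False simp_thms)
      then show ?thesis using tip_C2_zero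
        by (intro exI[of _ "\<lambda>_. 0"] conjI) (auto simp: tip_C2_def)
    qed
  qed
  then obtain f2 where f2: "tip_C2 (pw.g0 \<alpha> \<nu>) (pw.dg0 \<alpha> \<nu>) f2" "tip_controlled f2" by blast
  \<comment> \<open>The identity \<open>b_sq\<close> holds only for s > 0. In the cases with
    \<open>m\<close> the derivative is therefore expressed by \<open>wgt\<close> and matched with
    \<open>pw.dg1\<close> on the half-line alone.\<close>
  have "\<exists>k1 k2. tip_C2 (pw.g1 \<alpha> \<nu>) k1 k2 \<and> tip_controlled (\<lambda>s. s * k2 s) \<and> (\<forall>s>0. k1 s = pw.dg1 \<alpha> \<nu> s)"
  proof -
    consider "\<alpha> = 0 \<and> \<nu> = 0 \<or> \<alpha> = 1 \<and> \<nu> = 1" | "\<alpha> = 0 \<and> \<nu> = 1 \<or> \<alpha> = 1 \<and> \<nu> = 0"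
      | "\<not> (\<alpha> = 0 \<and> \<nu> = 0 \<or> \<alpha> = 1 \<and> \<nu> = 1)" "\<not> (\<alpha> = 0 \<and> \<nu> = 1 \<or> \<alpha> = 1 \<and> \<nu> = 0)"
      by blast
    then show ?thesis
    proof cases
      case 1
      then have "pw.g1 \<alpha> \<nu> = m" "\<forall>s>0. - wgt s = pw.dg1 \<alpha> \<nu> s"
        by (auto simp: pw.g1_def pw.dg1_def fun_eq_iff b_sq)
      then show ?thesis using tip_C2_m tip_controlled_qf_wgt
        by (intro exI[of _ "\<lambda>s. - wgt s"] exI[of _ "\<lambda>s. qf s * wgt s"]) simp
    next
      case 2
      then have "pw.g1 \<alpha> \<nu> = (\<lambda>s. - m s)" "\<forall>s>0. - (- wgt s) = pw.dg1 \<alpha> \<nu> s"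
        by (auto simp: pw.g1_def pw.dg1_def fun_eq_iff b_sq)
      then show ?thesis using tip_C2_minus[OF tip_C2_m] tip_controlled_minus[OF tip_controlled_qf_wgt]
        by (intro exI[of _ "\<lambda>s. - (- wgt s)"] exI[of _ "\<lambda>s. - (qf s * wgt s)"]) simp
    next
      case 3
      then have "pw.g1 \<alpha> \<nu> = (\<lambda>_. 0)" "pw.dg1 \<alpha> \<nu> = (\<lambda>_. 0)"
        by (simp_all only: pw.g1_def pw.dg1_def fun_eq_iff if_False simp_thms)
      then show ?thesis using tip_C2_zero
        by (intro exI[of _ "\<lambda>s. 0"]) (auto simp: tip_C2_def)
    qed
  qed
  then obtain k1 k2 where k: "tip_C2 (pw.g1 \<alpha> \<nu>) k1 k2" "tip_controlled (\<lambda>s. s * k2 s)"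
    "\<And>s. s > 0 \<Longrightarrow> k1 s = pw.dg1 \<alpha> \<nu> s" by blast
  show ?thesis
  proof (rule initial_data_finite[OF f2(1) k(1) f2(2) k(2)])
    fix x :: "real^3" assume x: "x \<in> D_slice 0"
    have p: "spacetime_point 0 x \<in> D_dom \<inter> {p. p$0 < 1}" using spacetime_point_in_past[OF x] by simp
    show "at_time 0 (\<lambda>p. G p $ \<alpha> $ \<nu>) x = pw.g0 \<alpha> \<nu> (x$1) + pw.g1 \<alpha> \<nu> (x$1) * x$1"
      using pw.g_entry[OF p, of \<alpha> \<nu>] by (simp add: at_time_def spacetime_point_nth)
    show "at_time 0 (partial 0 (\<lambda>p. G p $ \<alpha> $ \<nu>)) x =
        pw.g1 \<alpha> \<nu> (x$1) - (pw.dg0 \<alpha> \<nu> (x$1) + k1 (x$1) * x$1)"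
      using pw.partial_g[OF p, of 0 \<alpha> \<nu>] k(3)[OF D_slice_0_bounds(1)[OF x]]
      by (simp add: at_time_def spacetime_point_nth)
  qed
qed

section \<open>Divergence of the norm at times other than 0\<close>

lemma lam_le_dyadic:
  assumes "\<delta> > 0" "\<delta> * (1 / 4) ^ (n + 1) \<le> s"
  shows "lam s \<le> (real n + 1) * (4 + ln (1 + 1 / \<delta>))"
proof -
  have p: "\<delta> * (1 / 4) ^ (n + 1) > 0" using assms(1) by simp
  then have s: "s > 0" using assms(2) by linarith
  have "1 / s \<le> 1 / (\<delta> * (1 / 4) ^ (n + 1))" using p s assms(2) by (intro divide_left_mono) auto
  also have "\<dots> = 4 ^ (n + 1) * (1 / \<delta>)" by (simp add: power_divide)
  finally have "1 + 1 / s \<le> 4 ^ (n + 1) * (1 + 1 / \<delta>)"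
    using one_le_power[of "4::real" "n + 1"] unfolding distrib_left by linarith
  then have "ln (1 + 1 / s) \<le> ln (4 ^ (n + 1) * (1 + 1 / \<delta>))"
    using s by (subst ln_le_cancel_iff) (auto simp: add_pos_pos assms(1))
  also have "\<dots> = ln (4 ^ (n + 1)) + ln (1 + 1 / \<delta>)"
    using assms(1) by (intro ln_mult_pos) (auto simp: add_pos_pos)
  also have "ln (4 ^ (n + 1) :: real) = (real n + 1) * ln 4" by (subst ln_realpow) auto
  finally have "ln (1 + 1 / s) \<le> (real n + 1) * ln 4 + ln (1 + 1 / \<delta>)" .
  moreover have "(real n + 1) * ln 4 \<le> (real n + 1) * 3"
    using ln_le_minus_one[of 4] by (intro mult_left_mono) auto
  moreover have "0 \<le> ln (1 + 1 / \<delta>)" using assms(1) by (intro ln_ge_zero) simp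
  then have "ln (1 + 1 / \<delta>) \<le> (real n + 1) * ln (1 + 1 / \<delta>)" by (simp add: mult_le_cancel_right1)
  ultimately show ?thesis by (simp add: lam_def algebra_simps)
qed

text \<open>With s = x1 - t, the slice left of x1 = 1 is x2^2/4 + x3^2/4 < 2 (1 - t) s - s^2. On the
  box the left side is at most (1 - t) s / 4, while s \<le> (1 - t)/2 makes the right side at least
  (3/2) (1 - t) s.\<close>

lemma tip_box_subset:
  assumes t: "t < 1" and \<delta>: "\<delta> > 0" "\<delta> \<le> (1 - t) / 2"
    and x: "\<delta> * (1 / 4) ^ (n + 1) \<le> x$1 - t" "x$1 - t \<le> \<delta> * (1 / 4) ^ n"
      "\<bar>x$2\<bar> \<le> \<delta> / 2 * (1 / 2) ^ n" "\<bar>x$3\<bar> \<le> \<delta> / 2 * (1 / 2) ^ n"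
  shows "x \<in> D_slice t"
proof -
  define s where "s = x$1 - t"
  define k :: real where "k = (1 / 4) ^ n"
  have k: "0 < k" "k \<le> 1" by (auto simp: k_def power_le_one)
  have s: "\<delta> * k / 4 \<le> s" "s \<le> \<delta> * k" using x by (auto simp: s_def k_def)
  have dk: "\<delta> * k \<le> \<delta>" "\<delta> * k > 0" using k \<delta> by (auto simp: mult_left_le)
  have s1: "s > 0" "s \<le> (1 - t) / 2" using s dk \<delta> by linarith+
  have y: "y\<^sup>2 \<le> \<delta>\<^sup>2 / 4 * k" if "\<bar>y\<bar> \<le> \<delta> / 2 * (1 / 2) ^ n" for y
  proof -
    have "\<bar>y\<bar>\<^sup>2 \<le> (\<delta> / 2 * (1 / 2) ^ n)\<^sup>2" using that by (intro power_mono) auto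
    moreover have "((1 / 2 :: real) ^ n)\<^sup>2 = k" by (simp add: k_def power2_eq_square flip: power_mult_distrib)
    then have "(\<delta> / 2 * (1 / 2) ^ n)\<^sup>2 = \<delta>\<^sup>2 / 4 * k"
      unfolding power_mult_distrib by (simp only: power_divide) simp
    ultimately show ?thesis by simp
  qed
  have "\<delta> * (\<delta> * k) \<le> (1 - t) / 2 * (\<delta> * k)" using \<delta> dk by (intro mult_right_mono) auto
  also have "\<dots> \<le> (1 - t) / 2 * (4 * s)" using s t by (intro mult_left_mono) auto
  also have "\<dots> = 2 * ((1 - t) * s)" by simp
  finally have "\<delta>\<^sup>2 * k \<le> 2 * ((1 - t) * s)" by (simp only: power2_eq_square mult.assoc)
  then have yy: "(x$2)\<^sup>2 / 4 + (x$3)\<^sup>2 / 4 \<le> (1 - t) * s / 4"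
    using y[OF x(3)] y[OF x(4)] by linarith
  have "s * s \<le> (1 - t) / 2 * s" using s1 by (intro mult_right_mono) auto
  moreover have "(1 - t) * s > 0" using s1 t by simp
  ultimately have "(1 - t) * s / 4 < 2 * ((1 - t) * s) - s * s" by linarith
  moreover have "(x$1 - 1)\<^sup>2 = (1 - t)\<^sup>2 - (2 * ((1 - t) * s) - s * s)"
    by (simp add: s_def power2_eq_square algebra_simps)
  ultimately have "(x$1 - 1)\<^sup>2 + (x$2)\<^sup>2 / 4 + (x$3)\<^sup>2 / 4 < (1 - t)\<^sup>2" using yy by linarith
  moreover have "x$1 < 1" using s1 t by (simp add: s_def)
  ultimately show ?thesis by (simp add: D_slice_iff H_step_def)
qed

lemma G_not_H2:
  assumes t: "t \<in> {-1<..<1} - {0}"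
  shows "sobolev_norm 2 (D_slice t) (at_time t (\<lambda>p. G p $ 0 $ 0)) = \<infinity>"
proof (rule ccontr)
  interpret pw: plane_wave "D_dom \<inter> {p. p$0 < 1}" "{0<..}" G L m b e A B by (rule plane_wave_past)
  let ?f = "at_time t (\<lambda>p. G p $ 0 $ 0)" and ?\<Omega> = "D_slice t"
  have t': "t < 1" "t \<noteq> 0" "\<bar>t\<bar> < 1" using t by auto
  \<comment> \<open>If the norm is not infinite, the infimum is over a non-empty set. Of the weak
    derivatives it provides, only the second one in x1 is used.\<close>
  assume "sobolev_norm 2 ?\<Omega> ?f \<noteq> \<infinity>"
  moreover have "sobolev_norm 2 ?\<Omega> ?f = \<infinity>"
    if e: "{w. \<forall>a. multi_order a \<le> 2 \<longrightarrow> weak_deriv ?\<Omega> a ?f (w a) \<and> square_integrable ?\<Omega> (w a)} = {}"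
    unfolding sobolev_norm_def e by simp
  ultimately have "{w. \<forall>a. multi_order a \<le> 2 \<longrightarrow> weak_deriv ?\<Omega> a ?f (w a) \<and> square_integrable ?\<Omega> (w a)} \<noteq> {}"
    by blast
  then obtain w0 where w0: "\<And>a. multi_order a \<le> 2 \<Longrightarrow> weak_deriv ?\<Omega> a ?f (w0 a) \<and> square_integrable ?\<Omega> (w0 a)"
    by blast
  define w where "w = w0 (\<lambda>i. if i = 1 then 2 else 0)"
  have w: "weak_deriv ?\<Omega> (\<lambda>i. if i = 1 then 2 else 0) ?f w" "square_integrable ?\<Omega> w"
    using w0[of "\<lambda>i. if i = 1 then 2 else 0"] by (auto simp: w_def multi_order_def sum_3)
  \<comment> \<open>g_00 and its first two x1-derivatives on the slice, with u = y - t and V = y +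
    t. In the first derivative the contribution -L' of -L cancels against the L' of V L', leaving V
    L''.\<close>
  define h where "h j y = (if j = 0 then - L (y - t) + (y + t) * m (y - t)
     else if j = 1 then (y + t) * - wgt (y - t)
     else - wgt (y - t) + (y + t) * (qf (y - t) * wgt (y - t)))" for j :: nat and y
  have J: "x$1 \<in> {t<..}" and f: "?f x = h 0 (x$1)" if x: "x \<in> ?\<Omega>" for x
  proof -
    have p: "spacetime_point t x \<in> D_dom \<inter> {p. p$0 < 1}" by (rule spacetime_point_in_past[OF x t'(1)])
    show "x$1 \<in> {t<..}" using pw.in_I[OF p] by (simp add: spacetime_point_nth)
    show "?f x = h 0 (x$1)"
      using pw.g_entry[OF p, of 0 0]
      by (simp add: at_time_def spacetime_point_nth pw.g0_def pw.g1_def h_def mult.commute)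
  qed
  have der: "(h j has_real_derivative h (Suc j) y) (at y)" if j: "j < 2" and y: "y \<in> {t<..}" for j y
  proof -
    have sh: "((\<lambda>y. F (y - t)) has_real_derivative F') (at y)"
      if "(F has_real_derivative F') (at (y - t))" for F F'
      using DERIV_shift[of F F' y "- t"] that by simp
    have s: "y - t > 0" using y by simp
    have V: "((\<lambda>y. y + t) has_real_derivative 1) (at y)" by (auto intro!: derivative_eq_intros)
    have "((\<lambda>y. - L (y - t) + (y + t) * m (y - t)) has_real_derivative (y + t) * - wgt (y - t)) (at y)"
      by (rule DERIV_cong[OF DERIV_add[OF DERIV_minus[OF sh[OF der_L[OF s]]] DERIV_mult[OF V sh[OF der_m[OF s]]]]])
         simp
    moreover have "((\<lambda>y. (y + t) * - wgt (y - t)) has_real_derivative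
        - wgt (y - t) + (y + t) * (qf (y - t) * wgt (y - t))) (at y)"
      by (rule DERIV_cong[OF DERIV_mult[OF V DERIV_minus[OF sh[OF der_wgt[OF s]]]]]) simp
    moreover have "j = 0 \<or> j = 1" using j by auto
    ultimately show ?thesis by (auto simp: h_def[abs_def])
  qed
  have cont: "continuous_on {t<..} (h j)" if "j \<le> 2" for j
  proof (cases "j < 2")
    case True
    then show ?thesis
      using der[OF True] by (auto simp: continuous_on_eq_continuous_at intro: DERIV_isCont)
  next
    case False
    have c: "continuous_on {0<..} wgt" "continuous_on {0<..} qf"
      using smooth_wgt[of 0] smooth_qf[of 0] by auto
    have "continuous_on {t<..} (\<lambda>y. - wgt (y - t) + (y + t) * (qf (y - t) * wgt (y - t)))"
      by (intro continuous_intros continuous_on_compose2[OF c(1)] continuous_on_compose2[OF c(2)]) auto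
    then show ?thesis using False by (simp add: h_def[abs_def])
  qed
  define \<delta> where "\<delta> = min (t\<^sup>2 / 144) ((1 - t) / 2)"
  have \<delta>: "\<delta> > 0" "\<delta> \<le> t\<^sup>2 / 144" "\<delta> \<le> (1 - t) / 2"
    using t' min.cobounded1[of "t\<^sup>2 / 144" "(1 - t) / 2"] min.cobounded2[of "t\<^sup>2 / 144" "(1 - t) / 2"]
    unfolding \<delta>_def by simp_all
  \<comment> \<open>The boxes occupy the shells from \<delta> 4^-(n+1) to \<delta> 4^-n in x1 - t,
    hence have disjoint interiors, and are \<delta> 2^-n wide across, the scaling of the
    paraboloid.\<close>
  define a where "a n = (\<chi> i::3. if i = 1 then t + \<delta> * (1 / 4) ^ (n + 1) else - (\<delta> / 2 * (1 / 2) ^ n))" for n :: nat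
  define d where "d n = (\<chi> i::3. if i = 1 then 3 * (\<delta> * (1 / 4) ^ (n + 1)) else \<delta> * (1 / 2) ^ n)" for n :: nat
  have box: "\<delta> * (1 / 4) ^ (n + 1) \<le> x$1 - t" "x$1 - t \<le> \<delta> * (1 / 4) ^ n"
      "\<bar>x$2\<bar> \<le> \<delta> / 2 * (1 / 2) ^ n" "\<bar>x$3\<bar> \<le> \<delta> / 2 * (1 / 2) ^ n"
    if "x \<in> cbox (a n) (a n + d n)" for x n
    using that by (auto simp: mem_box_cart forall_3 a_def d_def abs_le_iff)
  define C\<delta> where "C\<delta> = 4 + ln (1 + 1 / \<delta>)"
  have "0 \<le> ln (1 + 1 / \<delta>)" using \<delta>(1) by (intro ln_ge_zero) simp
  then have C\<delta>: "C\<delta> > 0" unfolding C\<delta>_def by linarith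
  \<comment> \<open>Chosen so that \<open>c n\<close> is the bound |t| / (16 s sqrt lam) at the far
    end s = \<delta> 4^-n of the shell, with \<open>lam\<close> replaced by its majorant (n + 1)
    \<open>C\<delta>\<close>.\<close>
  define \<kappa> where "\<kappa> = \<bar>t\<bar> / (16 * \<delta> * sqrt C\<delta>)"
  define c where "c n = \<kappa> * (4 ^ n / sqrt (real n + 1))" for n :: nat
  have \<kappa>: "\<kappa> > 0" using t' \<delta> C\<delta> by (simp add: \<kappa>_def)
  have low: "c n \<le> sgn t * h 2 (x$1)" if x: "x \<in> cbox (a n) (a n + d n)" for n x
  proof -
    define s where "s = x$1 - t"
    have p: "\<delta> * (1 / 4) ^ (n + 1) > 0" using \<delta>(1) by simp
    have s: "\<delta> * (1 / 4) ^ (n + 1) \<le> s" "s \<le> \<delta> * (1 / 4) ^ n" using box[OF x] by (auto simp: s_def)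
    have s0: "s > 0" using p s(1) by linarith
    have "\<delta> * (1 / 4) ^ n \<le> \<delta>" using \<delta>(1) by (simp add: mult_left_le power_le_one)
    then have st: "s \<le> t\<^sup>2 / 144" using s(2) \<delta>(2) by linarith
    have "c n = \<bar>t\<bar> / (16 * (\<delta> * (1 / 4) ^ n) * (sqrt (real n + 1) * sqrt C\<delta>))"
      by (simp add: c_def \<kappa>_def power_divide)
    also have "\<dots> \<le> \<bar>t\<bar> / (16 * s * sqrt (lam s))"
    proof (rule divide_left_mono)
      have "sqrt (lam s) \<le> sqrt ((real n + 1) * C\<delta>)"
        using lam_le_dyadic[OF \<delta>(1) s(1)] by (simp add: C\<delta>_def)
      then have "sqrt (lam s) \<le> sqrt (real n + 1) * sqrt C\<delta>" by (simp only: real_sqrt_mult)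
      then show "16 * s * sqrt (lam s) \<le> 16 * (\<delta> * (1 / 4) ^ n) * (sqrt (real n + 1) * sqrt C\<delta>)"
        using s s0 lam_ge_1[OF s0] \<delta>(1) by (intro mult_mono) auto
      show "0 < 16 * (\<delta> * (1 / 4) ^ n) * (sqrt (real n + 1) * sqrt C\<delta>) * (16 * s * sqrt (lam s))"
        using \<delta>(1) C\<delta> s0 lam_ge_1[OF s0] by simp
    qed simp
    also have "\<dots> \<le> sgn t * (- wgt s + (s + 2 * t) * (qf s * wgt s))"
      by (rule second_derivative_lower_bound[OF t'(2,3) s0 st])
    also have "\<dots> = sgn t * h 2 (x$1)" by (simp add: h_def s_def)
    finally show ?thesis .
  qed
  have bound: "(\<Sum>n<N. (exp (- 24) / 8)\<^sup>2 * ((c n)\<^sup>2 * (d n $ 1 * d n $ 2 * d n $ 3)))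
      \<le> (LINT x|lebesgue_on ?\<Omega>. (w x)\<^sup>2)" for N
  proof (rule weak_second_derivative_lower_bound[OF open_D_slice J der cont f w])
    show "d n $ i > 0" for n i using \<delta>(1) by (simp add: d_def)
    show "cbox (a n) (a n + d n) \<subseteq> ?\<Omega>" for n
      using tip_box_subset[OF t'(1) \<delta>(1,3)] box by blast
    show "a k $ 1 + d k $ 1 \<le> a j $ 1" if "j < k" for j k
    proof -
      have "(1 / 4 :: real) ^ k \<le> (1 / 4) ^ (j + 1)" using that by (intro power_decreasing) auto
      then have "\<delta> * (1 / 4) ^ k \<le> \<delta> * (1 / 4) ^ (j + 1)" using \<delta>(1) by (intro mult_left_mono) auto
      then show ?thesis by (simp add: a_def d_def)
    qed
    show "sgn t * sgn t = 1" using t'(2) by (simp add: sgn_if)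
    show "c n \<ge> 0" for n using \<kappa> by (simp add: c_def)
  qed (use low in auto)
  define E where "E = (exp (- 24) / 8)\<^sup>2 * (\<kappa>\<^sup>2 * (3 / 4 * \<delta> ^ 3))"
  have E: "E > 0" using \<kappa> \<delta>(1) by (simp add: E_def)
  \<comment> \<open>The square of \<open>c n\<close> grows like 16^n / (n + 1) and the volume is
    (3/4) \<delta>^3 16^-n, so the lower bounds sum to the harmonic series.\<close>
  have summand: "(exp (- 24) / 8)\<^sup>2 * ((c n)\<^sup>2 * (d n $ 1 * d n $ 2 * d n $ 3)) = E * (1 / (real n + 1))" for n
  proof -
    have "(4 ^ n)\<^sup>2 * ((1 / 4) ^ n * ((1 / 2) ^ n * (1 / 2) ^ n)) = (4 * 4 * (1 / 4 * (1 / 2 * (1 / 2))) :: real) ^ n"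
      unfolding power_mult_distrib power2_eq_square ..
    then have 1: "(4 ^ n)\<^sup>2 * ((1 / 4) ^ n * ((1 / 2) ^ n * (1 / 2) ^ n)) = (1 :: real)" by simp
    have "(c n)\<^sup>2 = \<kappa>\<^sup>2 * ((4 ^ n)\<^sup>2 * (1 / (real n + 1)))"
      by (simp add: c_def power_mult_distrib power_divide)
    moreover have "d n $ 1 * d n $ 2 * d n $ 3 = 3 / 4 * \<delta> ^ 3 * ((1 / 4) ^ n * ((1 / 2) ^ n * (1 / 2) ^ n))"
      by (simp add: d_def power3_eq_cube)
    ultimately have "(c n)\<^sup>2 * (d n $ 1 * d n $ 2 * d n $ 3) = \<kappa>\<^sup>2 * (3 / 4 * \<delta> ^ 3) * (1 / (real n + 1)) *
        ((4 ^ n)\<^sup>2 * ((1 / 4) ^ n * ((1 / 2) ^ n * (1 / 2) ^ n)))"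
      by (simp only: mult_ac)
    then show ?thesis unfolding 1 by (simp add: E_def)
  qed
  have "summable (\<lambda>n. E * (1 / (real n + 1)))"
  proof (rule summableI_nonneg_bounded)
    show "(\<Sum>n<N. E * (1 / (real n + 1))) \<le> (LINT x|lebesgue_on ?\<Omega>. (w x)\<^sup>2)" for N
      using bound[of N] unfolding summand .
  qed (use E in simp)
  then have "summable (\<lambda>n. 1 / E * (E * (1 / (real n + 1))))" by (rule summable_mult)
  then have "summable (\<lambda>n. real (Suc n) powr (- 1))"
    using E by (simp add: powr_minus_divide add.commute)
  then have "summable (\<lambda>n. real n powr (- 1))" by (subst (asm) summable_Suc_iff)
  then show False by (subst (asm) summable_real_powr_iff) simp
qed

end

theorem theorem3p1:
  "\<exists>g :: metric.
     lorentzian_on D_dom g \<and>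
     (\<forall>p\<in>D_dom. \<forall>\<mu> \<nu>. ricci g \<mu> \<nu> p = 0) \<and>
     (\<forall>p\<in>D_dom. \<forall>\<beta>.
        (\<Sum>\<alpha>\<in>UNIV. partial \<alpha> (\<lambda>q. sqrt \<bar>det (g q)\<bar> * metric_inv g \<alpha> \<beta> q) p) = 0) \<and>
     (\<forall>\<alpha> \<beta>. sobolev_norm 2 (D_slice 0) (at_time 0 (\<lambda>p. g p $ \<alpha> $ \<beta>))
           + sobolev_norm 1 (D_slice 0) (at_time 0 (partial 0 (\<lambda>p. g p $ \<alpha> $ \<beta>))) < \<infinity>) \<and>
     (\<forall>t\<in>{-1<..<1} - {0}. sobolev_norm 2 (D_slice t) (at_time t (\<lambda>p. g p $ 0 $ 0)) = \<infinity>)"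
proof -
  obtain L m b \<beta> where "profile L m b \<beta>" using ex_profile by blast
  then interpret profile L m b \<beta> .
  show ?thesis
    using G_lorentzian G_ricci G_wave G_initial_data G_not_H2 by (intro exI[of _ G] conjI ballI allI)
qed

end
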